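(* Let $w\in W$ and let $$\mathfrak S_w=\sum_{i_1,\dots,i_k}a_{i_1,\dots,i_k}\,q_{\lambda(i_1,\dots,i_k)}\otimes\omega_{i_1}\omega_{i_2}\cdots\omega_{i_k}\in S[q]\otimes_{\mathbb Z}\mathbb Z[\omega_i\mid i\in I]$$ (a finite sum, with $a_{i_1,\dots,i_k}\in S$ and $\lambda(i_1,\dots,i_k)\in\bigoplus_{i\in I}\mathbb Z_{\ge0}\alpha_i^\vee$) be an equivariant quantum Schubert polynomial representing the class $\sigma^w\in QH^T(G/B)$. Let $\lambda\in\tilde Q$ be sufficiently superregular. Then $$j(\xi_{wt_\lambda})=\sum_{i_1,\dots,i_k}a_{i_1,\dots,i_k}\;b\big(\lambda+\lambda(i_1,\dots,i_k);\,\omega_{i_1},\omega_{i_2},\dots,\omega_{i_k}\big).$$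
   Context: Root data. $G$ is a simple, simply-connected complex algebraic group with Borel $B$ and maximal torus $T$; $I$ is the set of Dynkin nodes, $\alpha_i,\alpha_i^\vee$ the simple roots and coroots, $R=R^+\sqcup-R^+$ the roots, $\theta$ the highest root, $Q^\vee$ the coroot lattice, $\Lambda=\bigoplus\mathbb Z\omega_i$ the weight lattice, $\rho=\sum\omega_i$, $W$ the Weyl group (length $\ell$, reflections $r_\alpha$). $S=H^T(\mathrm{pt})=\mathrm{Sym}_{\mathbb Z}(\Lambda)$; $S[q]=S[q_i\mid i\in I]$; $q_\lambda=\prod q_i^{a_i}$ for $\lambda=\sum a_i\alpha_i^\vee$. $\tilde Q$ is the set of antidominant elements of $Q^\vee$ ($\langle\lambda,\alpha_i\rangle\le0$ for all $i$). Affine Weyl group. $W_{\mathrm{af}}=W\ltimes Q^\vee$, translations $t_\lambda$, Coxeter generators $r_i$, $i\in I_{\mathrm{af}}=I\sqcup\{0\}$, $r_0=r_\theta t_{-\theta^\vee}$, Bruhat order $<$; $y\lessdot x$ means $y<x$ and $\ell(y)=\ell(x)-1$. $r_{\alpha+n\delta}=r_\alpha t_{n\alpha^\vee}$ for $\alpha\in R$, $n\in\mathbb Z$. $W_{\mathrm{af}}^-$ is the set of minimal length representatives of $W_{\mathrm{af}}/W$. Superregularity. $\lambda\in Q^\vee$ is superregular if $|\langle\lambda,\alpha\rangle|>2|W|+2$ for all $\alpha\in R^+$; $wt_\lambda$ is superregular if $\lambda$ is; $W_{\mathrm{af}}^{\mathrm{sreg}}$ is the set of superregular elements. A statement holds for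 sufficiently superregular $x$ if there is a positive integer $k$ (depending on the other data in the statement, not on $x$) such that it holds for all $x\in W_{\mathrm{af}}^{\mathrm{sreg}}$ with the property: if $y<x$ and $\ell(x)-\ell(y)<k$ then $y\in W_{\mathrm{af}}^{\mathrm{sreg}}$. An antidominant $\lambda$ is sufficiently superregular if all $t_{v\lambda}$, $v\in W$, are. Near Bruhat operators. $S[X]$ is the free left $S$-module on $X$. Let $x=wt_{v\lambda}$ with $\lambda$ antidominant superregular. A cocover $y=xr_{v\alpha+n\delta}\lessdot x$ ($\alpha\in R^+$, $n\in\mathbb Z$) is near, written $y\lessdot_n x$, if either $n=\langle\lambda,\alpha\rangle$ and $y=wr_{v\alpha}t_{v\lambda}$, or $n=\langle\lambda,\alpha\rangle+1$ and $y=wr_{v\alpha}t_{v(\lambda+\alpha^\vee)}$ (near cocovers stay in the same chamber $v$). For $\mu\in\Lambda$ the $S$-linear operator $B^\mu$ is $$B^\mu(x)=(\mu-wv\mu)\,x+\sum_{\alpha\in R^+}\ \sum_{xr_{v\alpha+n\delta}\lessdot_n x}\langle\alpha^\vee,\mu\rangle\,xr_{v\alpha+n\delta}.$$ NilHecke ring. $\mathbb A_{\mathrm{af}}$ is generated by $A_i$ ($i\in I_{\mathrm{af}}$) and $S$ with $A_i\lambda=(r_i\lambda)A_i+\langle\alpha_i^\vee,\lambda\rangle$ for $\lambda\in\Lambda$ ($r_0$ acts as $r_\theta$, $\alpha_0^\vee$ pairs as $-\theta^\vee$), $A_i^2=0$, braid relations; left $S$-basis $A_x$, $x\in W_{\mathrm{af}}$.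 $\Upsilon:S[W_{\mathrm{af}}]\to\mathbb A_{\mathrm{af}}$ is $\sum a_xx\mapsto\sum a_xA_x$. For sufficiently superregular antidominant $\lambda$ and $\mu^1,\dots,\mu^k\in\Lambda$ (with $k\ge0$), $$b(\lambda;\mu^1,\dots,\mu^k)=\Upsilon\Big(B^{\mu^k}\cdots B^{\mu^1}\sum_{v\in W}t_{v\lambda}\Big).$$ Homology. $H_T(\operatorname{Gr}_G)$ is the $T$-equivariant homology (Pontryagin product) of the affine Grassmannian, free over $S$ with Schubert basis $\xi_x$, $x\in W_{\mathrm{af}}^-$; $j:H_T(\operatorname{Gr}_G)\to Z_{\mathbb A_{\mathrm{af}}}(S)$ is the $S$-algebra isomorphism onto the centralizer of $S$ such that $j(\xi_x)$ is the unique element of $Z_{\mathbb A_{\mathrm{af}}}(S)$ congruent to $A_x$ modulo the left ideal $\sum_{w\in W\setminus\{\mathrm{id}\}}\mathbb A_{\mathrm{af}}A_w$. Quantum cohomology. $QH^T(G/B)$ is the equivariant small quantum cohomology ring, commutative, associative, free over $S[q]$ with Schubert basis $\sigma^w$, determined by $\sigma^{r_i}*\sigma^w=(\omega_i-w\omega_i)\sigma^w+\sum_\alpha\langle\alpha^\vee,\omega_i\rangle\sigma^{wr_\alpha}+\sum_\alpha\langle\alpha^\vee,\omega_i\rangle q_{\alpha^\vee}\sigma^{wr_\alpha}$ (first sum: $\alpha\in R^+$, $\ell(wr_\alpha)=\ell(w)+1$; second: $\alpha\in R^+$, $\ell(wr_\alpha)=\ell(w)+1-\langle\alpha^\vee,2\rho\rangle$).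 A polynomial $\mathfrak S_w$ is an equivariant quantum Schubert polynomial for $w$ if replacing each $\omega_i$ by $[\omega_i]:=\sigma^{r_i}$ (with products taken using $*$) yields $\sigma^w$. *)

theory Defs
  imports "HOL-Analysis.Analysis" "HOL-Library.Poly_Mapping"
begin

section \<open>Ring homomorphisms, free modules, words\<close>

definition is_ring_hom :: "('r::ring_1 \<Rightarrow> 's::ring_1) \<Rightarrow> bool" where
  "is_ring_hom \<phi> \<longleftrightarrow>
     \<phi> 1 = 1 \<and> (\<forall>x y. \<phi> (x + y) = \<phi> x + \<phi> y) \<and> (\<forall>x y. \<phi> (x * y) = \<phi> x * \<phi> y)"

text \<open>\<open>(b x)\<close>, \<open>x \<in> X\<close>, is a basis of the ring \<open>'m\<close> as a left module over \<open>'r\<close>, which acts by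
  left multiplication through \<open>\<phi>\<close>.\<close>

definition is_left_basis :: "('r::ring_1 \<Rightarrow> 'm::ring_1) \<Rightarrow> 'x set \<Rightarrow> ('x \<Rightarrow> 'm) \<Rightarrow> bool" where
  "is_left_basis \<phi> X b \<longleftrightarrow>
     (\<forall>m. \<exists>!c :: 'x \<Rightarrow>\<^sub>0 'r. Poly_Mapping.keys c \<subseteq> X \<and>
        m = (\<Sum>x\<in>Poly_Mapping.keys c. \<phi> (Poly_Mapping.lookup c x) * b x))"

definition word_prod :: "'g \<Rightarrow> ('g \<Rightarrow> 'g \<Rightarrow> 'g) \<Rightarrow> ('k \<Rightarrow> 'g) \<Rightarrow> 'k list \<Rightarrow> 'g" where
  "word_prod e f gen ks = foldr (\<lambda>k. f (gen k)) ks e"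

definition word_length :: "'g \<Rightarrow> ('g \<Rightarrow> 'g \<Rightarrow> 'g) \<Rightarrow> ('k \<Rightarrow> 'g) \<Rightarrow> 'g \<Rightarrow> nat" where
  "word_length e f gen x = (LEAST n. \<exists>ks. length ks = n \<and> word_prod e f gen ks = x)"

text \<open>The word \<open>i j i \<dots>\<close> of length \<open>m\<close>.\<close>

primrec alternating :: "'k \<Rightarrow> 'k \<Rightarrow> nat \<Rightarrow> 'k list" where
  "alternating i j 0 = []"
| "alternating i j (Suc m) = i # alternating j i m"


section \<open>Lattices and polynomial rings\<close>

text \<open>The type \<open>int ^ 'i\<close> serves both as the weight lattice, in coordinates with respect to the
  fundamental weights \<open>\<omega>\<^sub>i\<close>, and as the coroot lattice, in coordinates with respect to the simple
  coroots \<open>\<alpha>\<^sub>i\<^sup>\<or>\<close>; these two bases are dual to each other.  A Weyl group element is given by its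
  action on weights, and the pair \<open>(w, \<lambda>)\<close> stands for the affine Weyl group element
  \<open>w t\<^sub>\<lambda>\<close>.\<close>

type_synonym 'i weight = "int ^ 'i"
type_synonym 'i coweight = "int ^ 'i"
type_synonym 'i weyl = "'i weight \<Rightarrow> 'i weight"
type_synonym 'i waf = "'i weyl \<times> 'i coweight"

text \<open>The rings \<open>S = \<int>[\<omega>\<^sub>i | i \<in> I]\<close>, \<open>S[q]\<close> and \<open>S[q] \<otimes> \<int>[\<omega>\<^sub>i | i \<in> I]\<close>; the last one is a
  polynomial ring over \<open>S[q]\<close> in a second set of variables \<open>\<omega>\<^sub>i\<close>.\<close>

type_synonym 'i S = "('i \<Rightarrow>\<^sub>0 nat) \<Rightarrow>\<^sub>0 int"
type_synonym 'i Sq = "('i \<Rightarrow>\<^sub>0 nat) \<Rightarrow>\<^sub>0 'i S"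
type_synonym 'i Sq_omega = "('i \<Rightarrow>\<^sub>0 nat) \<Rightarrow>\<^sub>0 'i Sq"

definition pairing :: "('i::finite) coweight \<Rightarrow> 'i weight \<Rightarrow> int" where
  "pairing lam \<mu> = (\<Sum>i\<in>UNIV. lam $ i * \<mu> $ i)"

definition fundamental_weight :: "'i::finite \<Rightarrow> 'i weight" where
  "fundamental_weight i = axis i 1"

definition simple_coroot :: "'i::finite \<Rightarrow> 'i coweight" where
  "simple_coroot i = axis i 1"

definition rho :: "('i::finite) weight" where
  "rho = (\<Sum>i\<in>UNIV. fundamental_weight i)"

definition var_poly :: "'i \<Rightarrow> ('i \<Rightarrow>\<^sub>0 nat) \<Rightarrow>\<^sub>0 ('r::comm_ring_1)" where
  "var_poly i = Poly_Mapping.single (Poly_Mapping.single i 1) 1"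

definition const_poly :: "'r::comm_ring_1 \<Rightarrow> ('i \<Rightarrow>\<^sub>0 nat) \<Rightarrow>\<^sub>0 'r" where
  "const_poly c = Poly_Mapping.single 0 c"

definition weight_in_S :: "('i::finite) weight \<Rightarrow> 'i S" where
  "weight_in_S \<mu> = (\<Sum>i\<in>UNIV. of_int (\<mu> $ i) * var_poly i)"

text \<open>\<open>q\<^sub>\<lambda>\<close>, for \<open>\<lambda>\<close> a nonnegative combination of simple coroots.\<close>

definition q_monomial :: "('i::finite) coweight \<Rightarrow> 'i Sq" where
  "q_monomial lam = (\<Prod>i\<in>UNIV. var_poly i ^ nat (lam $ i))"

text \<open>\<open>w\<lambda>\<close> for a coweight \<open>\<lambda>\<close>, determined by \<open>\<langle>w\<lambda>, \<mu>\<rangle> = \<langle>\<lambda>, w\<inverse>\<mu>\<rangle>\<close> for \<open>\<mu> = \<omega>\<^sub>i\<close>.\<close>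

definition act_coweight :: "('i::finite) weyl \<Rightarrow> 'i coweight \<Rightarrow> 'i coweight" where
  "act_coweight w lam = (\<chi> i. pairing lam (inv w (fundamental_weight i)))"

text \<open>\<open>u t\<^sub>\<lambda> \<cdot> v t\<^sub>\<nu> = u v t\<^sub>\<kappa>\<close> with \<open>\<kappa> = v\<inverse>\<lambda> + \<nu>\<close>.\<close>

definition waf_one :: "('i::finite) waf" where
  "waf_one = (id, 0)"

definition waf_mult :: "('i::finite) waf \<Rightarrow> 'i waf \<Rightarrow> 'i waf" where
  "waf_mult x y = (fst x \<circ> fst y, act_coweight (inv (fst y)) (snd x) + snd y)"

definition translation :: "('i::finite) coweight \<Rightarrow> 'i waf" where
  "translation lam = (id, lam)"


section \<open>The root datum of a simple simply-connected group\<close>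

text \<open>\<open>C i j = \<langle>\<alpha>\<^sub>i\<^sup>\<or>, \<alpha>\<^sub>j\<rangle>\<close> is an indecomposable Cartan matrix of finite type, with Dynkin nodes the
  elements of \<open>'i\<close>.  Simple connectedness enters through the cocharacter and character lattices
  being the coroot and the weight lattice.\<close>

locale root_datum =
  fixes C :: "'i::finite \<Rightarrow> 'i \<Rightarrow> int"
  assumes diagonal: "C i i = 2"
    and off_diagonal: "i \<noteq> j \<Longrightarrow> C i j \<le> 0"
    and zero_iff: "C i j = 0 \<longleftrightarrow> C j i = 0"
    and finite_type:
      "\<exists>d :: 'i \<Rightarrow> real. (\<forall>i. d i > 0) \<and> (\<forall>i j. d i * of_int (C i j) = d j * of_int (C j i)) \<and>
         (\<forall>x :: 'i \<Rightarrow> real. (\<exists>i. x i \<noteq> 0) \<longrightarrow>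
            (\<Sum>i\<in>UNIV. \<Sum>j\<in>UNIV. d i * of_int (C i j) * x i * x j) > 0)"
    and indecomposable: "J \<noteq> {} \<Longrightarrow> J \<noteq> UNIV \<Longrightarrow> \<exists>i\<in>J. \<exists>j\<in>-J. C i j \<noteq> 0"
begin

definition simple_root :: "'i \<Rightarrow> 'i weight" where
  "simple_root j = (\<chi> i. C i j)"

definition simple_reflection :: "'i \<Rightarrow> 'i weyl" where
  "simple_reflection i \<mu> = \<mu> - pairing (simple_coroot i) \<mu> *s simple_root i"

inductive_set weyl_group :: "'i weyl set" where
  one: "id \<in> weyl_group"
| mult: "w \<in> weyl_group \<Longrightarrow> simple_reflection i \<circ> w \<in> weyl_group"

definition weyl_length :: "'i weyl \<Rightarrow> nat" where
  "weyl_length = word_length id (\<circ>) simple_reflection"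

definition roots :: "'i weight set" where
  "roots = {w (simple_root i) |w i. w \<in> weyl_group}"

definition nonneg_root_combinations :: "'i weight set" where
  "nonneg_root_combinations = {\<Sum>i\<in>UNIV. int (c i) *s simple_root i |c. True}"

definition positive_roots :: "'i weight set" where
  "positive_roots = roots \<inter> nonneg_root_combinations"

text \<open>The coroot of \<open>\<alpha> = w\<alpha>\<^sub>i\<close> is \<open>w\<alpha>\<^sub>i\<^sup>\<or>\<close>.\<close>

definition coroot :: "'i weight \<Rightarrow> 'i coweight" where
  "coroot \<alpha> = (THE h. \<exists>w\<in>weyl_group. \<exists>i.
     \<alpha> = w (simple_root i) \<and> h = act_coweight w (simple_coroot i))"

definition reflection :: "'i weight \<Rightarrow> 'i weyl" where
  "reflection \<alpha> \<mu> = \<mu> - pairing (coroot \<alpha>) \<mu> *s \<alpha>"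

definition highest_root :: "'i weight" where
  "highest_root = (THE \<theta>. \<theta> \<in> roots \<and> (\<forall>\<alpha>\<in>roots. \<theta> - \<alpha> \<in> nonneg_root_combinations))"

definition antidominant :: "'i coweight \<Rightarrow> bool" where
  "antidominant lam \<longleftrightarrow> (\<forall>i. pairing lam (simple_root i) \<le> 0)"


subsection \<open>The affine Weyl group\<close>

definition affine_weyl_group :: "'i waf set" where
  "affine_weyl_group = weyl_group \<times> UNIV"

text \<open>The affine node \<open>0\<close> is \<open>None\<close>.\<close>

definition affine_generator :: "'i option \<Rightarrow> 'i waf" where
  "affine_generator k = (case k of
     Some i \<Rightarrow> (simple_reflection i, 0)
   | None \<Rightarrow> (reflection highest_root, - coroot highest_root))"

text \<open>\<open>\<alpha>\<^sub>0\<^sup>\<or>\<close> pairs with (level zero) weights as \<open>-\<theta>\<^sup>\<or>\<close>.\<close>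

definition affine_simple_coroot :: "'i option \<Rightarrow> 'i coweight" where
  "affine_simple_coroot k = (case k of
     Some i \<Rightarrow> simple_coroot i
   | None \<Rightarrow> - coroot highest_root)"

abbreviation affine_word_prod :: "'i option list \<Rightarrow> 'i waf" where
  "affine_word_prod \<equiv> word_prod waf_one waf_mult affine_generator"

definition affine_length :: "'i waf \<Rightarrow> nat" where
  "affine_length = word_length waf_one waf_mult affine_generator"

definition reduced_word :: "'i waf \<Rightarrow> 'i option list \<Rightarrow> bool" where
  "reduced_word x ks \<longleftrightarrow> affine_word_prod ks = x \<and> length ks = affine_length x"

text \<open>\<open>affine_reflection \<alpha> n\<close> is the reflection in the affine root \<open>\<alpha> + n\<delta>\<close>.\<close>

definition affine_reflection :: "'i weight \<Rightarrow> int \<Rightarrow> 'i waf" where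
  "affine_reflection \<alpha> n = (reflection \<alpha>, n *s coroot \<alpha>)"

definition bruhat_step :: "'i waf \<Rightarrow> 'i waf \<Rightarrow> bool" where
  "bruhat_step y x \<longleftrightarrow> x \<in> affine_weyl_group \<and> affine_length y < affine_length x \<and>
     (\<exists>\<alpha>\<in>roots. \<exists>n. y = waf_mult x (affine_reflection \<alpha> n))"

definition bruhat_less :: "'i waf \<Rightarrow> 'i waf \<Rightarrow> bool" where
  "bruhat_less = bruhat_step\<^sup>+\<^sup>+"

definition cocover :: "'i waf \<Rightarrow> 'i waf \<Rightarrow> bool" where
  "cocover y x \<longleftrightarrow> bruhat_less y x \<and> affine_length x = affine_length y + 1"

definition grassmannian_elements :: "'i waf set" where
  "grassmannian_elements =
     {x \<in> affine_weyl_group. \<forall>v\<in>weyl_group. affine_length x \<le> affine_length (waf_mult x (v, 0))}"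

text \<open>The element \<open>A\<^sub>x\<close> of the nilHecke ring with generators \<open>A k\<close>: the product of these along a
  reduced word of \<open>x\<close>.  By the braid relations it does not depend on the choice of the word.\<close>

definition A_elem :: "('i option \<Rightarrow> 'a::ring_1) \<Rightarrow> 'i waf \<Rightarrow> 'a" where
  "A_elem A x = prod_list (map A (SOME ks. reduced_word x ks))"


subsection \<open>Superregularity and near Bruhat operators\<close>

definition superregular :: "'i coweight \<Rightarrow> bool" where
  "superregular lam \<longleftrightarrow> (\<forall>\<alpha>\<in>positive_roots. \<bar>pairing lam \<alpha>\<bar> > 2 * int (card weyl_group) + 2)"

definition superregular_elements :: "'i waf set" where
  "superregular_elements = {x \<in> affine_weyl_group. superregular (snd x)}"

definition sufficiently_superregular :: "nat \<Rightarrow> 'i waf \<Rightarrow> bool" where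
  "sufficiently_superregular k x \<longleftrightarrow> x \<in> superregular_elements \<and>
     (\<forall>y. bruhat_less y x \<and> affine_length x - affine_length y < k \<longrightarrow> y \<in> superregular_elements)"

definition sufficiently_superregular_coweight :: "nat \<Rightarrow> 'i coweight \<Rightarrow> bool" where
  "sufficiently_superregular_coweight k lam \<longleftrightarrow>
     (\<forall>v\<in>weyl_group. sufficiently_superregular k (translation (act_coweight v lam)))"

text \<open>A superregular coweight is uniquely of the form \<open>v\<lambda>\<close> with \<open>v\<close> in the Weyl group and \<open>\<lambda>\<close>
  antidominant; \<open>chamber\<close> and \<open>antidominant_part\<close> return \<open>v\<close> and \<open>\<lambda>\<close>.\<close>

definition chamber :: "'i coweight \<Rightarrow> 'i weyl" where
  "chamber \<nu> = (THE v. v \<in> weyl_group \<and> antidominant (act_coweight (inv v) \<nu>))"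

definition antidominant_part :: "'i coweight \<Rightarrow> 'i coweight" where
  "antidominant_part \<nu> = act_coweight (inv (chamber \<nu>)) \<nu>"

text \<open>\<open>near_cocover x \<alpha> n\<close> says that \<open>x r\<^sub>\<beta>\<close>, where \<open>\<beta> = v\<alpha> + n\<delta>\<close> and \<open>v\<close> is the chamber of \<open>x\<close>,
  is a near cocover of \<open>x\<close>.\<close>

definition near_cocover :: "'i waf \<Rightarrow> 'i weight \<Rightarrow> int \<Rightarrow> bool" where
  "near_cocover x \<alpha> n \<longleftrightarrow>
     (let w = fst x; v = chamber (snd x); lam = antidominant_part (snd x);
          y = waf_mult x (affine_reflection (v \<alpha>) n)
      in cocover y x \<and>
         (n = pairing lam \<alpha> \<and> y = (w \<circ> reflection (v \<alpha>), act_coweight v lam) \<or>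
          n = pairing lam \<alpha> + 1 \<and> y = (w \<circ> reflection (v \<alpha>), act_coweight v (lam + coroot \<alpha>))))"

definition near_bruhat_basis :: "'i weight \<Rightarrow> 'i waf \<Rightarrow> 'i waf \<Rightarrow>\<^sub>0 'i S" where
  "near_bruhat_basis \<mu> x =
     (let w = fst x; v = chamber (snd x) in
        Poly_Mapping.single x (weight_in_S (\<mu> - w (v \<mu>))) +
        (\<Sum>\<alpha>\<in>positive_roots. \<Sum>n | near_cocover x \<alpha> n.
           Poly_Mapping.single (waf_mult x (affine_reflection (v \<alpha>) n))
             (of_int (pairing (coroot \<alpha>) \<mu>))))"

text \<open>The \<open>S\<close>-linear operator \<open>B\<^sup>\<mu>\<close>.  It is only meaningful on the span of the superregular
  elements; by convention it kills the other basis elements.\<close>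

definition near_bruhat_operator :: "'i weight \<Rightarrow> ('i waf \<Rightarrow>\<^sub>0 'i S) \<Rightarrow> ('i waf \<Rightarrow>\<^sub>0 'i S)" where
  "near_bruhat_operator \<mu> f =
     (\<Sum>x\<in>Poly_Mapping.keys f \<inter> superregular_elements.
        Poly_Mapping.map ((*) (Poly_Mapping.lookup f x)) (near_bruhat_basis \<mu> x))"

end


section \<open>The affine nilHecke ring and the homology of the affine Grassmannian\<close>

text \<open>The ring is characterised by its generators \<open>A k\<close> and \<open>\<iota> s\<close> (\<open>s \<in> S\<close>), their relations, and the
  left \<open>S\<close>-basis \<open>A\<^sub>x\<close>.  The premises of \<open>braid\<close> say that \<open>r\<^sub>k r\<^sub>l\<close> has finite order \<open>m\<close>.\<close>

locale nil_hecke_ring = root_datum C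
  for C :: "'i::finite \<Rightarrow> 'i \<Rightarrow> int" +
  fixes \<iota> :: "'i S \<Rightarrow> 'a::ring_1" and A :: "'i option \<Rightarrow> 'a"
  assumes scalars: "is_ring_hom \<iota>"
    and commutation: "A k * \<iota> (weight_in_S \<mu>) =
      \<iota> (weight_in_S (fst (affine_generator k) \<mu>)) * A k + of_int (pairing (affine_simple_coroot k) \<mu>)"
    and nilpotent: "A k * A k = 0"
    and braid: "k \<noteq> l \<Longrightarrow> m > 0 \<Longrightarrow> affine_word_prod (alternating k l (2 * m)) = waf_one \<Longrightarrow>
      (\<And>n. 0 < n \<Longrightarrow> n < m \<Longrightarrow> affine_word_prod (alternating k l (2 * n)) \<noteq> waf_one) \<Longrightarrow>
      prod_list (map A (alternating k l m)) = prod_list (map A (alternating l k m))"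
    and basis: "is_left_basis \<iota> affine_weyl_group (A_elem A)"
begin

definition centralizer :: "'a set" where
  "centralizer = {a. \<forall>s. a * \<iota> s = \<iota> s * a}"

definition finite_left_ideal :: "'a set" where
  "finite_left_ideal = {\<Sum>w\<in>weyl_group - {id}. h w * A_elem A (w, 0) |h. True}"

definition Upsilon :: "('i waf \<Rightarrow>\<^sub>0 'i S) \<Rightarrow> 'a" where
  "Upsilon f = (\<Sum>x\<in>Poly_Mapping.keys f. \<iota> (Poly_Mapping.lookup f x) * A_elem A x)"

definition b :: "'i coweight \<Rightarrow> 'i weight list \<Rightarrow> 'a" where
  "b lam \<mu>s = Upsilon (fold near_bruhat_operator \<mu>s
     (\<Sum>v\<in>weyl_group. Poly_Mapping.single (translation (act_coweight v lam)) 1))"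

end

text \<open>\<open>H\<^sub>T(Gr\<^sub>G)\<close> with its Pontryagin product is represented by a commutative ring \<open>'h\<close> with structure map
  \<open>\<eta>\<close> from \<open>S\<close>, Schubert classes \<open>\<xi>\<close> and the isomorphism \<open>j\<close> onto the centralizer of \<open>S\<close>.\<close>

locale grassmannian_homology = nil_hecke_ring C \<iota> A
  for C :: "'i::finite \<Rightarrow> 'i \<Rightarrow> int" and \<iota> :: "'i S \<Rightarrow> 'a::ring_1" and A :: "'i option \<Rightarrow> 'a" +
  fixes \<eta> :: "'i S \<Rightarrow> 'h::comm_ring_1" and \<xi> :: "'i waf \<Rightarrow> 'h" and j :: "'h \<Rightarrow> 'a"
  assumes homology_scalars: "is_ring_hom \<eta>"
    and schubert_basis: "is_left_basis \<eta> grassmannian_elements \<xi>"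
    and j_hom: "is_ring_hom j"
    and j_linear: "j (\<eta> s) = \<iota> s"
    and j_bij: "bij_betw j UNIV centralizer"
    and j_schubert: "x \<in> grassmannian_elements \<Longrightarrow> j (\<xi> x) - A_elem A x \<in> finite_left_ideal"
    and j_schubert_unique: "x \<in> grassmannian_elements \<Longrightarrow> a \<in> centralizer \<Longrightarrow>
      a - A_elem A x \<in> finite_left_ideal \<Longrightarrow> a = j (\<xi> x)"


section \<open>Equivariant quantum cohomology of the flag variety\<close>

text \<open>\<open>QH\<^sup>T(G/B)\<close> is represented by a commutative ring \<open>'q\<close> with structure map \<open>\<kappa>\<close> from \<open>S[q]\<close>, the
  Schubert basis \<open>\<sigma>\<close>, and the quantum Chevalley rule that determines the ring.\<close>

locale quantum_cohomology = root_datum C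
  for C :: "'i::finite \<Rightarrow> 'i \<Rightarrow> int" +
  fixes \<kappa> :: "'i Sq \<Rightarrow> 'q::comm_ring_1" and \<sigma> :: "'i weyl \<Rightarrow> 'q"
  assumes quantum_scalars: "is_ring_hom \<kappa>"
    and quantum_schubert_basis: "is_left_basis \<kappa> weyl_group \<sigma>"
    and sigma_one: "\<sigma> id = 1"
    and quantum_chevalley: "w \<in> weyl_group \<Longrightarrow>
      \<sigma> (simple_reflection i) * \<sigma> w =
        \<kappa> (const_poly (weight_in_S (fundamental_weight i - w (fundamental_weight i)))) * \<sigma> w +
        (\<Sum>\<alpha> | \<alpha> \<in> positive_roots \<and> weyl_length (w \<circ> reflection \<alpha>) = weyl_length w + 1.
           of_int (pairing (coroot \<alpha>) (fundamental_weight i)) * \<sigma> (w \<circ> reflection \<alpha>)) +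
        (\<Sum>\<alpha> | \<alpha> \<in> positive_roots \<and>
             int (weyl_length (w \<circ> reflection \<alpha>)) = int (weyl_length w) + 1 - pairing (coroot \<alpha>) (2 *s rho).
           of_int (pairing (coroot \<alpha>) (fundamental_weight i)) * \<kappa> (q_monomial (coroot \<alpha>)) *
             \<sigma> (w \<circ> reflection \<alpha>))"
begin

definition evaluate :: "'i Sq_omega \<Rightarrow> 'q" where
  "evaluate P = (\<Sum>m\<in>Poly_Mapping.keys P. \<kappa> (Poly_Mapping.lookup P m) *
     (\<Prod>i\<in>UNIV. \<sigma> (simple_reflection i) ^ Poly_Mapping.lookup m i))"

definition quantum_schubert_polynomial :: "'i weyl \<Rightarrow> 'i Sq_omega \<Rightarrow> bool" where
  "quantum_schubert_polynomial w P \<longleftrightarrow> evaluate P = \<sigma> w"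

end

end

theory Submission
  imports Defs
begin

text \<open>A chamber \<open>v \<in> W\<close> and \<open>\<lambda>\<close> deep in the antidominant cone give an \<open>S\<close>-linear dictionary
  \<open>q\<^sub>\<kappa> \<sigma>\<^sup>u \<mapsto> u v\<inverse> t\<close>, where \<open>t\<close> is the translation by \<open>v(\<lambda> + \<kappa>)\<close>.  Near cocovers in the chamber correspond
  to edges of the quantum Bruhat graph, so \<open>B\<close> at \<open>\<omega>\<^sub>i\<close> becomes quantum multiplication by \<open>\<sigma>\<close> at \<open>r\<^sub>i\<close>.
  Since \<open>t\<^sub>v\<^sub>\<lambda>\<close> corresponds to \<open>\<sigma>\<^sup>v\<close>, the right-hand side of the theorem is the sum over \<open>v\<close> of the images \<open>\<psi>\<^sub>v\<close>
  of \<open>\<sigma>\<^sup>w * \<sigma>\<^sup>v\<close> in the nilHecke ring.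

  The remaining, far cocovers lead from the chamber \<open>v\<close> to \<open>v r\<^sub>\<alpha>\<close> and leave \<open>u\<close> unchanged; they are governed by
  the quantum Bruhat graph edges between \<open>v r\<^sub>\<alpha>\<close> and \<open>v\<close>.  In the commutator of \<open>\<Sum>\<^sub>v \<psi>\<^sub>v(\<tau> * \<sigma>\<^sup>v)\<close> with a weight, their
  contribution is therefore the one of quantum multiplication on the factor \<open>\<sigma>\<^sup>v\<close>, and it cancels the near
  contribution because quantum multiplication is associative and commutative.  So the sum is central
  over \<open>S\<close>; its part in the chamber \<open>v = id\<close> is \<open>A\<close> at \<open>w t\<^sub>\<lambda>\<close>, and the other chambers contribute elements of the left
  ideal, which characterises \<open>j\<close> of the Schubert class.\<close>


text \<open>Lengths are defined as least word lengths, and \<open>A_elem\<close> chooses some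
  reduced word. Length computations therefore have to wait until lengths are known to count
  inversions, and products along reduced words until the braid relations make the choice irrelevant.
  Inversion counting is needed for the finite and for the affine group, hence the common axiomatic
  treatment. Sufficient superregularity speaks of elements below a translation in Bruhat order,
  while cocovers are controlled by inequalities for the pairings of \<lambda> with positive roots.
  The predicate \<open>deep\<close> records such inequalities with an explicit margin. An edge of
  weight q changes the coweight by a coroot, which pairs with any root to at most 4, and a given
  polynomial involves only finitely many monomials, chambers and initial words. So one depth, and
  with it one \<open>k\<close>, can be fixed before \<lambda>. Depth also has to protect every
  intermediate product, because the formal operator kills basis elements that are not superregular.
  The sign of the commutator terms comes from the inverted affine roots, whose finite part is
  -v\<alpha> with \<alpha> positive.\<close>

lemma word_prod_Cons: "word_prod e f g (k # ks) = f (g k) (word_prod e f g ks)"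
  by (simp add: word_prod_def)

section \<open>Groups acting on root systems\<close>

text \<open>Instantiated by the Weyl group on its roots and by the affine Weyl group on the real
  affine roots. Inverses are not among the axioms; reversed words provide them. Reflections are
  given for all roots, not only for the simple ones, because exchange and cocovers concern arbitrary
  reflections.\<close>

locale word_reflection_system =
  fixes G :: "'g set" and e :: 'g and m :: "'g \<Rightarrow> 'g \<Rightarrow> 'g" (infixl "\<odot>" 70)
    and gen :: "'k \<Rightarrow> 'g" and act :: "'g \<Rightarrow> 'r \<Rightarrow> 'r" and \<Phi> :: "'r set" and Pos :: "'r set"
    and neg :: "'r \<Rightarrow> 'r" and sr :: "'k \<Rightarrow> 'r" and refl :: "'r \<Rightarrow> 'g"
  assumes mult_closed: "x \<in> G \<Longrightarrow> y \<in> G \<Longrightarrow> x \<odot> y \<in> G"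
    and assoc: "x \<in> G \<Longrightarrow> y \<in> G \<Longrightarrow> z \<in> G \<Longrightarrow> x \<odot> y \<odot> z = x \<odot> (y \<odot> z)"
    and e_closed: "e \<in> G"
    and e_left: "x \<in> G \<Longrightarrow> e \<odot> x = x" and e_right: "x \<in> G \<Longrightarrow> x \<odot> e = x"
    and gen_closed: "gen k \<in> G" and gen_gen: "gen k \<odot> gen k = e"
    and act_mult: "x \<in> G \<Longrightarrow> y \<in> G \<Longrightarrow> a \<in> \<Phi> \<Longrightarrow> act (x \<odot> y) a = act x (act y a)"
    and act_e: "a \<in> \<Phi> \<Longrightarrow> act e a = a"
    and act_closed: "x \<in> G \<Longrightarrow> a \<in> \<Phi> \<Longrightarrow> act x a \<in> \<Phi>"
    and Pos_subset: "Pos \<subseteq> \<Phi>"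
    and neg_Pos: "a \<in> \<Phi> \<Longrightarrow> neg a \<in> Pos \<longleftrightarrow> a \<notin> Pos"
    and act_neg: "x \<in> G \<Longrightarrow> a \<in> \<Phi> \<Longrightarrow> act x (neg a) = neg (act x a)"
    and sr_Pos: "sr k \<in> Pos" and gen_sr: "act (gen k) (sr k) = neg (sr k)"
    and gen_Pos: "a \<in> Pos \<Longrightarrow> a \<noteq> sr k \<Longrightarrow> act (gen k) a \<in> Pos"
    and finite_inversions: "x \<in> G \<Longrightarrow> finite {a \<in> Pos. act x a \<notin> Pos}"
    and refl_closed: "a \<in> \<Phi> \<Longrightarrow> refl a \<in> G"
    and refl_conj: "x \<in> G \<Longrightarrow> a \<in> \<Phi> \<Longrightarrow> x \<odot> refl a = refl (act x a) \<odot> x"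
    and refl_sr: "refl (sr k) = gen k"
    and refl_neg: "a \<in> \<Phi> \<Longrightarrow> refl (neg a) = refl a"
    and refl_refl: "a \<in> \<Phi> \<Longrightarrow> refl a \<odot> refl a = e"
    and refl_self: "a \<in> \<Phi> \<Longrightarrow> act (refl a) a = neg a"
begin

abbreviation prd :: "'k list \<Rightarrow> 'g" where "prd \<equiv> word_prod e m gen"

abbreviation len :: "'g \<Rightarrow> nat" where "len \<equiv> word_length e m gen"

definition inversions :: "'g \<Rightarrow> 'r set" where
  "inversions x = {a \<in> Pos. act x a \<notin> Pos}"

definition reduced :: "'k list \<Rightarrow> bool" where
  "reduced ks \<longleftrightarrow> length ks = len (prd ks)"

lemma Pos_root: "a \<in> Pos \<Longrightarrow> a \<in> \<Phi>"
  using Pos_subset by blast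

lemma sr_root: "sr k \<in> \<Phi>"
  using sr_Pos Pos_root by blast

lemma prd_Nil [simp]: "prd [] = e"
  by (simp add: word_prod_def)

lemma prd_Cons [simp]: "prd (k # ks) = gen k \<odot> prd ks"
  by (simp add: word_prod_def)

lemma prd_closed [simp]: "prd ks \<in> G"
  by (induction ks) (auto intro: e_closed mult_closed gen_closed)

lemma prd_append: "prd (xs @ ys) = prd xs \<odot> prd ys"
  by (induction xs) (auto simp: e_left assoc gen_closed)

lemma prd_snoc: "prd (xs @ [k]) = prd xs \<odot> gen k"
  by (simp add: prd_append e_right gen_closed)

lemma gen_cancel: "x \<in> G \<Longrightarrow> gen k \<odot> (gen k \<odot> x) = x"
  by (metis assoc gen_closed gen_gen e_left)

lemma gen_cancel_right: "x \<in> G \<Longrightarrow> x \<odot> gen k \<odot> gen k = x"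
  by (metis assoc gen_closed gen_gen e_right)

lemma prd_rev_left: "prd (rev ks) \<odot> prd ks = e"
proof (induction ks)
  case Nil
  then show ?case by (simp add: e_left e_closed)
next
  case (Cons k ks)
  have "prd (rev (k # ks)) \<odot> prd (k # ks) = prd (rev ks) \<odot> (gen k \<odot> (gen k \<odot> prd ks))"
    by (simp add: prd_snoc assoc gen_closed mult_closed)
  then show ?case using Cons by (simp add: gen_cancel)
qed

lemma prd_rev_right: "prd ks \<odot> prd (rev ks) = e"
  using prd_rev_left[of "rev ks"] by simp

text \<open>Applied to \<open>a\<close>, the letters from the right keep it positive up to some
  letter \<open>k\<close>. The root met there must be \<open>sr k\<close>, the only positive root
  that \<open>gen k\<close> makes negative, so multiplying by \<open>refl a\<close> deletes exactly
  this letter. The word need not be reduced.\<close>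

lemma strong_exchange:
  assumes "a \<in> Pos" "act (prd ks) a \<notin> Pos"
  shows "\<exists>p<length ks. prd ks \<odot> refl a = prd (take p ks @ drop (Suc p) ks)"
  using assms(2)
proof (induction ks)
  case Nil
  then show ?case using assms(1) by (simp add: act_e Pos_root)
next
  case (Cons k ks)
  have r: "a \<in> \<Phi>" using assms(1) Pos_root by blast
  note rG = refl_closed[OF r]
  show ?case
  proof (cases "act (prd ks) a \<in> Pos")
    case False
    then obtain p where p: "p < length ks" "prd ks \<odot> refl a = prd (take p ks @ drop (Suc p) ks)"
      using Cons.IH by blast
    have "prd (k # ks) \<odot> refl a = gen k \<odot> (prd ks \<odot> refl a)"
      by (simp add: assoc gen_closed rG)
    also have "\<dots> = prd (take (Suc p) (k # ks) @ drop (Suc (Suc p)) (k # ks))"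
      using p by simp
    finally show ?thesis using p(1) by (intro exI[of _ "Suc p"]) auto
  next
    case True
    then have "act (prd ks) a = sr k"
      using gen_Pos Cons.prems r by (auto simp: act_mult gen_closed)
    then have "prd ks \<odot> refl a = gen k \<odot> prd ks"
      using refl_conj[OF prd_closed r] refl_sr by metis
    then have "prd (k # ks) \<odot> refl a = prd ks"
      by (simp add: assoc gen_closed rG gen_cancel)
    then show ?thesis by (intro exI[of _ 0]) auto
  qed
qed

text \<open>If a nonempty word ends in \<open>k\<close>, the word without this letter sends
  \<open>sr k\<close> to a negative root. Strong exchange then expresses the same element by a word
  that is two letters shorter, and induction applies.\<close>

lemma word_simple_Pos_imp_e: "(\<And>k. act (prd ks) (sr k) \<in> Pos) \<Longrightarrow> prd ks = e"
proof (induction "length ks" arbitrary: ks rule: less_induct)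
  case less
  show ?case
  proof (cases ks rule: rev_cases)
    case (snoc js k)
    have "act (prd js) (sr k) \<notin> Pos"
      using less.prems[of k] neg_Pos[of "act (prd js) (sr k)"] snoc
      by (simp add: prd_snoc act_mult gen_closed sr_root gen_sr act_neg act_closed)
    then obtain p where p: "p < length js" "prd js \<odot> refl (sr k) = prd (take p js @ drop (Suc p) js)"
      using strong_exchange[OF sr_Pos] by blast
    then have *: "prd ks = prd (take p js @ drop (Suc p) js)"
      using snoc by (simp add: prd_snoc refl_sr)
    show ?thesis unfolding * using less.prems unfolding *
      by (intro less.hyps) (use p(1) snoc in auto)
  qed simp
qed

end

text \<open>The axiom \<open>simple_Pos_imp_e\<close> is kept apart because for the finite Weyl group it follows from the others, by
  \<open>word_simple_Pos_imp_e\<close>; for the affine Weyl group it is proved first and yields the generation by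
  simple reflections.\<close>

locale reflection_system = word_reflection_system G e m gen act \<Phi> Pos neg sr refl
  for G :: "'g set" and e :: 'g and m :: "'g \<Rightarrow> 'g \<Rightarrow> 'g" (infixl "\<odot>" 70)
    and gen :: "'k \<Rightarrow> 'g" and act :: "'g \<Rightarrow> 'r \<Rightarrow> 'r" and \<Phi> :: "'r set" and Pos :: "'r set"
    and neg :: "'r \<Rightarrow> 'r" and sr :: "'k \<Rightarrow> 'r" and refl :: "'r \<Rightarrow> 'g" +
  assumes simple_Pos_imp_e: "x \<in> G \<Longrightarrow> (\<And>k. act x (sr k) \<in> Pos) \<Longrightarrow> x = e"
begin

section \<open>Length as the number of inversions\<close>

text \<open>The action of \<open>gen k\<close> permutes the positive roots other than
  \<open>sr k\<close>. Right multiplication therefore transports the old inversions and creates the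
  single new one \<open>sr k\<close>.\<close>

lemma inversions_gen:
  assumes "x \<in> G" "act x (sr k) \<in> Pos"
  shows "inversions (x \<odot> gen k) = insert (sr k) (act (gen k) ` inversions x)"
    and "sr k \<notin> act (gen k) ` inversions x"
proof -
  have gg: "act (gen k) (act (gen k) a) = a" if "a \<in> \<Phi>" for a
    using that act_mult[OF gen_closed gen_closed, of a k k] by (simp add: gen_gen act_e)
  have 1: "sr k \<in> inversions (x \<odot> gen k)"
    using assms by (simp add: inversions_def sr_Pos act_mult gen_closed sr_root gen_sr act_neg
        neg_Pos act_closed)
  have 2: "act (gen k) a \<in> inversions (x \<odot> gen k)" if "a \<in> inversions x" for a
  proof -
    have a: "a \<in> Pos" "act x a \<notin> Pos" "a \<noteq> sr k"
      using that assms by (auto simp: inversions_def)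
    then show ?thesis
      using assms gen_Pos[of a k] by (simp add: inversions_def act_mult gen_closed Pos_root gg)
  qed
  have 3: "a \<in> act (gen k) ` inversions x" if "a \<in> inversions (x \<odot> gen k)" "a \<noteq> sr k" for a
  proof -
    have a: "a \<in> Pos" "act x (act (gen k) a) \<notin> Pos"
      using that assms by (auto simp: inversions_def act_mult gen_closed Pos_root)
    then have "act (gen k) a \<in> inversions x"
      using gen_Pos that(2) by (simp add: inversions_def)
    then show ?thesis using gg a(1) Pos_root by (metis image_eqI)
  qed
  show "inversions (x \<odot> gen k) = insert (sr k) (act (gen k) ` inversions x)"
    using 1 2 3 by blast
  show "sr k \<notin> act (gen k) ` inversions x"
  proof
    assume "sr k \<in> act (gen k) ` inversions x"
    then obtain a where a: "a \<in> inversions x" "sr k = act (gen k) a" by blast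
    then have "a \<in> Pos" by (simp add: inversions_def)
    then have "a = neg (sr k)" using a(2) gg gen_sr Pos_root by metis
    then show False using \<open>a \<in> Pos\<close> sr_Pos neg_Pos sr_root by metis
  qed
qed

lemma finite_inv: "x \<in> G \<Longrightarrow> finite (inversions x)"
  by (simp add: inversions_def finite_inversions)

lemma act_inj: "x \<in> G \<Longrightarrow> x = prd ks \<Longrightarrow> inj_on (act x) \<Phi>"
  by (rule inj_on_inverseI[where g = "act (prd (rev ks))"])
    (simp add: act_mult[symmetric] prd_rev_left act_e)

lemma card_inversions_up:
  assumes "x \<in> G" "act x (sr k) \<in> Pos"
  shows "card (inversions (x \<odot> gen k)) = Suc (card (inversions x))"
proof -
  have "inj_on (act (gen k)) (inversions x)"
    using act_inj[of "gen k" "[k]"] by (rule inj_on_subset)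
      (auto simp: inversions_def gen_closed e_right Pos_root)
  then show ?thesis
    using inversions_gen[OF assms] finite_inv[OF assms(1)] by (simp add: card_image)
qed

lemma card_inversions_down:
  assumes "x \<in> G" "act x (sr k) \<notin> Pos"
  shows "card (inversions x) = Suc (card (inversions (x \<odot> gen k)))"
proof -
  have "act (x \<odot> gen k) (sr k) \<in> Pos"
    using assms by (simp add: act_mult gen_closed sr_root gen_sr act_neg neg_Pos act_closed)
  then show ?thesis
    using card_inversions_up[of "x \<odot> gen k" k] assms
    by (simp add: mult_closed gen_closed gen_cancel_right)
qed

text \<open>Each right descent that is stripped off removes one inversion, and
  \<open>simple_Pos_imp_e\<close> supplies a descent for every nontrivial element. This is also the
  proof that the simple reflections generate \<open>G\<close>.\<close>

lemma exists_word:
  assumes "x \<in> G" shows "\<exists>ks. prd ks = x \<and> length ks = card (inversions x)"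
  using assms
proof (induction "card (inversions x)" arbitrary: x)
  case 0
  then have "inversions x = {}" using finite_inv by simp
  then have "x = e"
    using 0(2) sr_Pos by (intro simple_Pos_imp_e) (auto simp: inversions_def)
  then show ?case using 0 by (intro exI[of _ "[]"]) auto
next
  case (Suc n)
  have "\<exists>k. act x (sr k) \<notin> Pos"
  proof (rule ccontr)
    assume "\<not> ?thesis"
    then have "x = e" using simple_Pos_imp_e Suc.prems by blast
    then have "inversions x = {}" by (auto simp: inversions_def act_e Pos_root)
    then show False using Suc.hyps by simp
  qed
  then obtain k where k: "act x (sr k) \<notin> Pos" by blast
  have "n = card (inversions (x \<odot> gen k))" using card_inversions_down[OF Suc.prems k] Suc.hyps by simp
  then obtain ks where ks: "prd ks = x \<odot> gen k" "length ks = n"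
    using Suc.hyps(1) Suc.prems mult_closed gen_closed by metis
  then have "prd (ks @ [k]) = x" using Suc.prems by (simp add: prd_snoc gen_cancel_right)
  then show ?case using ks Suc.hyps(2) by (metis length_append_singleton)
qed

lemma card_inversions_le: "card (inversions (prd ks)) \<le> length ks"
proof (induction ks rule: rev_induct)
  case Nil
  have "inversions e = {}" by (auto simp: inversions_def act_e Pos_root)
  then show ?case by simp
next
  case (snoc k ks)
  then show ?case
    using card_inversions_up[of "prd ks" k] card_inversions_down[of "prd ks" k]
    by (cases "act (prd ks) (sr k) \<in> Pos") (auto simp: prd_snoc)
qed

lemma len_eq_card:
  assumes "x \<in> G" shows "len x = card (inversions x)"
  unfolding word_length_def
proof (rule Least_equality)
  show "\<exists>ks. length ks = card (inversions x) \<and> prd ks = x" using exists_word[OF assms] by blast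
next
  fix y assume "\<exists>ks. length ks = y \<and> prd ks = x"
  then show "card (inversions x) \<le> y" using card_inversions_le by blast
qed

lemma len_prd_le: "len (prd ks) \<le> length ks"
  by (simp add: len_eq_card card_inversions_le)

lemma exists_reduced:
  assumes "x \<in> G" obtains ks where "prd ks = x" "length ks = len x"
  using exists_word[OF assms] len_eq_card[OF assms] by auto

lemma len_e: "len e = 0"
  using len_prd_le[of "[]"] by simp

lemma inverse_exists:
  assumes "x \<in> G" obtains y where "y \<in> G" "y \<odot> x = e" "x \<odot> y = e"
  using exists_reduced[OF assms] prd_rev_left prd_rev_right prd_closed by metis

lemma cancel_right:
  assumes "x \<in> G" "y \<in> G" "z \<in> G" "x \<odot> z = y \<odot> z" shows "x = y"
  using assms inverse_exists[of z] by (metis assoc e_right)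

lemma cancel_left:
  assumes "x \<in> G" "y \<in> G" "z \<in> G" "z \<odot> x = z \<odot> y" shows "x = y"
  using assms inverse_exists[of z] by (metis assoc e_left)

lemma act_injective: "x \<in> G \<Longrightarrow> a \<in> \<Phi> \<Longrightarrow> b \<in> \<Phi> \<Longrightarrow> act x a = act x b \<Longrightarrow> a = b"
  using act_inj exists_reduced by (metis inj_onD)

lemma len_refl_less:
  assumes "x \<in> G" "a \<in> Pos" "act x a \<notin> Pos"
  shows "len (x \<odot> refl a) < len x"
proof -
  obtain ks where ks: "prd ks = x" "length ks = len x" using exists_reduced[OF assms(1)] by blast
  then obtain p where p: "p < length ks" "x \<odot> refl a = prd (take p ks @ drop (Suc p) ks)"
    using strong_exchange[of a ks] assms by blast
  then show ?thesis using len_prd_le[of "take p ks @ drop (Suc p) ks"] ks by simp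
qed

lemma refl_cancel: "x \<in> G \<Longrightarrow> a \<in> \<Phi> \<Longrightarrow> x \<odot> refl a \<odot> refl a = x"
  by (simp add: assoc refl_closed refl_refl e_right)

lemma len_refl_greater:
  assumes "x \<in> G" "a \<in> Pos" "act x a \<in> Pos"
  shows "len x < len (x \<odot> refl a)"
  using assms len_refl_less[of "x \<odot> refl a" a]
  by (simp add: refl_cancel Pos_root mult_closed refl_closed act_mult refl_self act_neg neg_Pos act_closed)

lemma len_refl_less_iff:
  assumes "x \<in> G" "a \<in> Pos" shows "len (x \<odot> refl a) < len x \<longleftrightarrow> act x a \<notin> Pos"
  using len_refl_less len_refl_greater assms by (meson order_less_asym)

lemma len_gen_le: "x \<in> G \<Longrightarrow> len (gen k \<odot> x) \<le> Suc (len x)"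
  using exists_reduced[of x] len_prd_le[of "k # _"] by (metis length_Cons prd_Cons)

text \<open>Exchange is formulated for right multiplication. A left factor \<open>gen k\<close>
  becomes a right reflection in the preimage of \<open>sr k\<close> under \<open>x\<close>, whose
  sign is adjusted to make it positive.\<close>

lemma gen_as_refl:
  assumes "x \<in> G" obtains a where "a \<in> Pos" "gen k \<odot> x = x \<odot> refl a"
    "act x a = sr k \<or> act x a = neg (sr k)"
proof -
  obtain y where y: "y \<in> G" "y \<odot> x = e" "x \<odot> y = e" using inverse_exists[OF assms] by blast
  define a where "a = act y (sr k)"
  have a: "a \<in> \<Phi>" using y by (simp add: a_def act_closed sr_root)
  have xa: "act x a = sr k" using assms y by (simp add: a_def act_mult[symmetric] sr_root act_e)
  then have *: "gen k \<odot> x = x \<odot> refl a" using refl_conj[OF assms a] by (simp add: refl_sr)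
  show ?thesis
  proof (cases "a \<in> Pos")
    case True
    then show ?thesis using that * xa by blast
  next
    case False
    then show ?thesis
      using that[of "neg a"] * xa a neg_Pos assms by (simp add: refl_neg act_neg)
  qed
qed

lemma len_gen:
  assumes "x \<in> G"
  shows "len (gen k \<odot> x) = Suc (len x) \<or> len x = Suc (len (gen k \<odot> x))"
proof -
  have "len x \<noteq> len (gen k \<odot> x)"
    using gen_as_refl[OF assms, of k] len_refl_less[OF assms] len_refl_greater[OF assms]
    by (metis nat_neq_iff)
  moreover have "len x \<le> Suc (len (gen k \<odot> x))"
    using len_gen_le[of "gen k \<odot> x" k] assms by (simp add: gen_cancel mult_closed gen_closed)
  ultimately show ?thesis using len_gen_le[OF assms, of k] by linarith
qed

lemma len_gen_down_exchange:
  assumes "len (gen k \<odot> prd ks) < len (prd ks)"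
  shows "\<exists>p<length ks. gen k \<odot> prd ks = prd (take p ks @ drop (Suc p) ks)"
proof -
  obtain a where a: "a \<in> Pos" "gen k \<odot> prd ks = prd ks \<odot> refl a"
    using gen_as_refl[of "prd ks" k] by auto
  then have "act (prd ks) a \<notin> Pos" using assms len_refl_less_iff[of "prd ks" a] by simp
  then show ?thesis using strong_exchange[OF a(1)] a(2) by simp
qed

lemma reduced_suffix: "reduced (xs @ ys) \<Longrightarrow> reduced ys"
proof (induction xs)
  case (Cons x xs)
  have "len (prd (x # xs @ ys)) \<le> Suc (len (prd (xs @ ys)))"
    using len_gen_le[of "prd (xs @ ys)"] by simp
  then have "reduced (xs @ ys)"
    using Cons.prems len_prd_le[of "xs @ ys"] by (simp add: reduced_def)
  then show ?case using Cons.IH by blast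
qed simp

lemma len_mult_le: "x \<in> G \<Longrightarrow> y \<in> G \<Longrightarrow> len (x \<odot> y) \<le> len x + len y"
  using exists_reduced[of x] exists_reduced[of y] len_prd_le by (metis length_append prd_append)

lemma reduced_prefix: "reduced (xs @ ys) \<Longrightarrow> reduced xs"
  using len_mult_le[of "prd xs" "prd ys"] len_prd_le[of xs] len_prd_le[of ys]
  by (simp add: reduced_def prd_append)

subsection \<open>Independence of reduced words\<close>

lemma alternating_add:
  "alternating i j (p + q) =
    alternating i j p @ (if even p then alternating i j q else alternating j i q)"
  by (induction p arbitrary: i j) auto

lemma alternating_snoc: "alternating i j (Suc p) = alternating i j p @ [if even p then i else j]"
  using alternating_add[of i j p 1] by simp

lemma rev_alternating: "rev (alternating i j p) = (if even p then alternating j i p else alternating i j p)"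
proof (induction p arbitrary: i j)
  case (Suc p)
  have "rev (alternating i j (Suc p)) = rev (alternating j i p) @ [i]" by simp
  also have "\<dots> = (if even p then alternating i j p @ [i] else alternating j i p @ [i])"
    by (simp add: Suc)
  also have "\<dots> = (if even p then alternating i j (Suc p) else alternating j i (Suc p))"
    by (simp only: alternating_snoc if_True if_False split: if_split) simp
  finally show ?case by simp
qed simp

lemma length_alternating [simp]: "length (alternating i j p) = p"
  by (induction p arbitrary: i j) auto

lemma take_alternating: "p \<le> q \<Longrightarrow> take p (alternating i j q) = alternating i j p"
  using alternating_add[of i j p "q - p"] by simp

lemma alternating_even_swap:
  "prd (alternating i j (2 * p)) = e \<longleftrightarrow> prd (alternating j i (2 * p)) = e"
  using rev_alternating[of i j "2 * p"] prd_rev_left[of "alternating i j (2 * p)"]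
    prd_rev_right[of "alternating i j (2 * p)"] e_left e_right
  by (metis dvd_triv_left prd_closed)

lemma alternating_braid:
  assumes "prd (alternating i j (2 * p)) = e"
  shows "prd (alternating i j p) = prd (alternating j i p)"
proof -
  have "prd (alternating j i (2 * p)) = e" using assms alternating_even_swap by blast
  moreover have "alternating j i (2 * p) = alternating j i p @ rev (alternating i j p)"
    using alternating_add[of j i p p] rev_alternating[of i j p] by (simp add: mult_2)
  ultimately have "prd (alternating j i p) \<odot> prd (rev (alternating i j p)) =
      prd (alternating i j p) \<odot> prd (rev (alternating i j p))"
    using prd_rev_right by (simp add: prd_append)
  then show ?thesis using cancel_right by (metis prd_closed)
qed

text \<open>The alternating prefix of length \<open>n\<close> is as long as possible, and
  \<open>j\<close> is a left descent although the prefix starts with \<open>i\<close>. Exchange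
  along \<open>j\<close> deletes a letter inside the prefix, and cancelling the common tail leaves a
  relation between alternating words. An earlier relation would make the prefix non-reduced, so the
  relation found has exactly the order \<open>n\<close>.\<close>

lemma dihedral_step:
  assumes red: "reduced (alternating i j n @ ys)" and n: "n > 0"
    and x: "x = prd (alternating i j n @ ys)"
    and down: "len (gen j \<odot> x) < len x"
    and max: "\<And>zs. \<not> (reduced (alternating j i (Suc n) @ zs) \<and> x = prd (alternating j i (Suc n) @ zs))"
  shows "prd (alternating i j (2 * n)) = e \<and>
    (\<forall>q. 0 < q \<longrightarrow> q < n \<longrightarrow> prd (alternating i j (2 * q)) \<noteq> e)"
proof -
  let ?a = "alternating i j n"
  have ra: "reduced ?a" using red reduced_prefix by blast
  have minimal: "prd (alternating i j (2 * q)) \<noteq> e" if q: "0 < q" "q < n" for q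
  proof
    assume "prd (alternating i j (2 * q)) = e"
    then have b: "prd (alternating i j q) = prd (alternating j i q)" by (rule alternating_braid)
    have "take (Suc q) ?a = alternating i j (Suc q)" using q by (intro take_alternating) simp
    then have rq: "reduced (alternating i j (Suc q))"
      using ra reduced_prefix by (metis append_take_drop_id)
    obtain q' where q': "q = Suc q'" using q by (cases q) auto
    have "prd (alternating i j (Suc q)) = gen i \<odot> prd (alternating i j q)" using b by simp
    also have "\<dots> = prd (alternating j i q')" by (simp add: q' gen_cancel)
    finally have "len (prd (alternating i j (Suc q))) \<le> q'"
      using len_prd_le[of "alternating j i q'"] by simp
    then show False using rq q' by (simp add: reduced_def)
  qed
  obtain p where p: "p < length (?a @ ys)"
    "gen j \<odot> prd (?a @ ys) = prd (take p (?a @ ys) @ drop (Suc p) (?a @ ys))"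
    using len_gen_down_exchange[of j "?a @ ys"] down x by blast
  have "p < n"
  proof (rule ccontr)
    assume "\<not> p < n"
    then obtain r where r: "p = n + r" by (metis le_add_diff_inverse not_less)
    let ?zs = "take r ys @ drop (Suc r) ys"
    have "gen j \<odot> x = prd (?a @ ?zs)" using p(2) r x by simp
    then have "x = gen j \<odot> prd (?a @ ?zs)" using gen_cancel[of x j] x by (metis prd_closed)
    then have *: "x = prd (alternating j i (Suc n) @ ?zs)" by simp
    have "length (alternating j i (Suc n) @ ?zs) = length (?a @ ys)" using p(1) r by simp
    then have "reduced (alternating j i (Suc n) @ ?zs)"
      using red * x by (simp add: reduced_def)
    then show False using max * by blast
  qed
  let ?l = "if even p then i else j"
  have split: "?a = alternating i j p @ ?l # drop (Suc p) ?a"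
    using take_alternating[of "Suc p" n i j] alternating_snoc[of i j p] \<open>p < n\<close>
      append_take_drop_id[of "Suc p" ?a] by simp
  let ?r = "drop (Suc p) ?a @ ys"
  have "take p (?a @ ys) = alternating i j p" using \<open>p < n\<close> take_alternating[of p n i j] by simp
  moreover have "drop (Suc p) (?a @ ys) = ?r" using \<open>p < n\<close> by simp
  ultimately have "gen j \<odot> prd (?a @ ys) = prd (alternating i j p) \<odot> prd ?r"
    using p(2) by (simp add: prd_append)
  moreover have "?a @ ys = alternating i j (Suc p) @ ?r"
    using split alternating_snoc[of i j p] by simp
  then have "gen j \<odot> prd (?a @ ys) = prd (alternating j i (Suc (Suc p))) \<odot> prd ?r"
    by (simp only: prd_append prd_Cons alternating.simps(2)[of j i "Suc p"])
      (simp add: assoc gen_closed mult_closed)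
  ultimately have "prd (alternating j i (Suc (Suc p))) = prd (alternating i j p)"
    using cancel_right by (metis prd_closed)
  \<comment> \<open>Two alternating words of lengths \<open>p + 2\<close> and \<open>p\<close>
    agree; appending the reverse of the shorter one gives a relation of length
    \<open>2 * Suc p\<close>.\<close>
  then have "prd (alternating j i (Suc (Suc p)) @ rev (alternating i j p)) = e"
    using prd_rev_right by (simp only: prd_append)
  moreover have "alternating j i (Suc (Suc p)) @ rev (alternating i j p) = alternating j i (2 * Suc p)"
  proof -
    have *: "2 * Suc p = Suc (Suc p) + p" by simp
    show ?thesis unfolding * alternating_add[of j i "Suc (Suc p)" p] rev_alternating[of i j p] by simp
  qed
  ultimately have *: "prd (alternating i j (2 * Suc p)) = e" using alternating_even_swap by metis
  then have "\<not> Suc p < n" using minimal by blast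
  then have "Suc p = n" using \<open>p < n\<close> by simp
  then show ?thesis using * minimal by blast
qed

text \<open>Two left descents of \<open>x\<close> lie in a finite dihedral parabolic subgroup: its
  longest element, written in its two alternating ways, can be split off with one and the same tail
  \<open>ys\<close>.\<close>

lemma braid_word:
  assumes x: "x \<in> G" and ij: "len (gen i \<odot> x) < len x" "len (gen j \<odot> x) < len x"
  obtains n ys where "n > 0" "prd (alternating i j (2 * n)) = e"
    "\<And>q. 0 < q \<Longrightarrow> q < n \<Longrightarrow> prd (alternating i j (2 * q)) \<noteq> e"
    "reduced (alternating i j n @ ys)" "prd (alternating i j n @ ys) = x"
    "reduced (alternating j i n @ ys)" "prd (alternating j i n @ ys) = x"
proof -
  define Q where "Q i j n ys \<longleftrightarrow> reduced (alternating i j n @ ys) \<and> x = prd (alternating i j n @ ys)"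
    for i j n ys
  \<comment> \<open>Prefixes starting with \<open>i\<close> and with \<open>j\<close> compete for
    the maximum, so that \<open>dihedral_step\<close> applies whichever letter the longest one
    starts with.\<close>
  define X where "X = {n. \<exists>ys. Q i j n ys \<or> Q j i n ys}"
  have bound: "n \<le> len x" if "n \<in> X" for n
    using that by (auto simp: X_def Q_def reduced_def)
  then have fin: "finite X" by (metis finite_nat_set_iff_bounded_le)
  obtain ks where ks: "prd ks = gen i \<odot> x" "length ks = len (gen i \<odot> x)"
    using exists_reduced[of "gen i \<odot> x"] x mult_closed gen_closed by metis
  have "Q i j 1 ks"
    using ks len_gen[OF x, of i] ij(1) gen_cancel[OF x] by (simp add: Q_def reduced_def)
  then have "1 \<in> X" by (auto simp: X_def)
  define n where "n = Max X"
  have n: "n \<in> X" "n > 0" using Max_in[OF fin] Max_ge[OF fin \<open>1 \<in> X\<close>] \<open>1 \<in> X\<close> by (auto simp: n_def)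
  have nmax: "\<not> Q i j (Suc n) zs" "\<not> Q j i (Suc n) zs" for zs
    using Max_ge[OF fin, of "Suc n"] by (auto simp: n_def X_def)
  obtain ys where "Q i j n ys \<or> Q j i n ys" using n(1) by (auto simp: X_def)
  then have *: "prd (alternating i j (2 * n)) = e \<and>
    (\<forall>q. 0 < q \<longrightarrow> q < n \<longrightarrow> prd (alternating i j (2 * q)) \<noteq> e)"
  proof
    assume "Q i j n ys"
    then show ?thesis using dihedral_step[of i j n ys x] n(2) ij(2) nmax(2) by (auto simp: Q_def)
  next
    assume "Q j i n ys"
    then have "prd (alternating j i (2 * n)) = e \<and>
      (\<forall>q. 0 < q \<longrightarrow> q < n \<longrightarrow> prd (alternating j i (2 * q)) \<noteq> e)"
      using dihedral_step[of j i n ys x] n(2) ij(1) nmax(1) by (auto simp: Q_def)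
    then show ?thesis using alternating_even_swap by blast
  qed
  then have "prd (alternating i j n) = prd (alternating j i n)" using alternating_braid by blast
  then have "Q i j n ys \<and> Q j i n ys"
    using \<open>Q i j n ys \<or> Q j i n ys\<close> by (auto simp: Q_def reduced_def prd_append)
  then show ?thesis using that[OF n(2), of ys] * by (auto simp: Q_def)
qed

text \<open>The word theorem of Matsumoto and Tits. Two reduced words with different first letters
  are each compared with one side of a braid relation followed by a common tail. Each comparison
  shares its first letter and reduces to shorter words. The braid hypothesis is requested only at
  the exact order of the product of the two generators, as in the axiom \<open>braid\<close> of the
  nilHecke ring.\<close>

theorem reduced_words_unique:
  fixes F :: "'k \<Rightarrow> 'b::monoid_mult"
  assumes braid: "\<And>k l n. k \<noteq> l \<Longrightarrow> n > 0 \<Longrightarrow> prd (alternating k l (2 * n)) = e \<Longrightarrow>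
      (\<And>q. 0 < q \<Longrightarrow> q < n \<Longrightarrow> prd (alternating k l (2 * q)) \<noteq> e) \<Longrightarrow>
      prod_list (map F (alternating k l n)) = prod_list (map F (alternating l k n))"
  assumes "reduced ks" "reduced ls" "prd ks = prd ls"
  shows "prod_list (map F ks) = prod_list (map F ls)"
  using assms(2-4)
proof (induction "length ks" arbitrary: ks ls rule: less_induct)
  case less
  have len: "length ks = length ls" using less.prems by (simp add: reduced_def)
  show ?case
  proof (cases ks)
    case Nil
    then show ?thesis using len by simp
  next
    case (Cons i ks')
    then obtain j ls' where ls: "ls = j # ls'" using len by (cases ls) auto
    have r: "reduced ks'" "reduced ls'"
      using less.prems(1,2) reduced_suffix[of "[_]"] Cons ls by auto
    show ?thesis
    proof (cases "i = j")
      case True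
      then have "prd ks' = prd ls'"
        using less.prems(3) Cons ls cancel_left gen_closed by (metis prd_Cons prd_closed)
      then show ?thesis using less.hyps[of ks' ls'] r Cons ls True by simp
    next
      case False
      let ?x = "prd ks"
      have "gen i \<odot> ?x = prd ks'" using Cons by (simp add: gen_cancel)
      moreover have "gen j \<odot> ?x = prd ls'" using ls less.prems(3) by (simp add: gen_cancel)
      ultimately have down: "len (gen i \<odot> ?x) < len ?x" "len (gen j \<odot> ?x) < len ?x"
        using less.prems r Cons ls by (auto simp: reduced_def)
      obtain n ys where n: "n > 0" "prd (alternating i j (2 * n)) = e"
        "\<And>q. 0 < q \<Longrightarrow> q < n \<Longrightarrow> prd (alternating i j (2 * q)) \<noteq> e"
        and 1: "reduced (alternating i j n @ ys)" "prd (alternating i j n @ ys) = ?x"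
        and 2: "reduced (alternating j i n @ ys)" "prd (alternating j i n @ ys) = ?x"
        using braid_word[OF prd_closed down] by metis
      obtain n' where n': "n = Suc n'" using n(1) by (cases n) auto
      let ?u = "alternating j i n' @ ys" and ?v = "alternating i j n' @ ys"
      have ru: "reduced ?u" and rv: "reduced ?v"
        using 1(1) 2(1) n' reduced_suffix[of "[_]"] by auto
      have "gen i \<odot> prd ?u = gen i \<odot> prd ks'" using 1(2) n' Cons by simp
      then have "prd ks' = prd ?u" using cancel_left gen_closed prd_closed by metis
      then have p1: "prod_list (map F ks') = prod_list (map F ?u)"
        using less.hyps[of ks' ?u] Cons r(1) ru by simp
      have "gen j \<odot> prd ?v = gen j \<odot> prd ls'" using 2(2) n' ls less.prems(3) by simp
      then have "prd ls' = prd ?v" using cancel_left gen_closed prd_closed by metis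
      then have p2: "prod_list (map F ls') = prod_list (map F ?v)"
        using less.hyps[of ls' ?v] ls len r(2) rv by simp
      have "prod_list (map F ks) = prod_list (map F (alternating i j n @ ys))"
        using p1 Cons n' by simp
      also have "\<dots> = prod_list (map F (alternating j i n @ ys))"
        using braid[OF False n] by simp
      also have "\<dots> = prod_list (map F ls)" using p2 ls n' by simp
      finally show ?thesis .
    qed
  qed
qed

subsection \<open>Cocovers\<close>

definition cocover_roots :: "'g \<Rightarrow> 'r set" where
  "cocover_roots x = {a \<in> Pos. len x = Suc (len (x \<odot> refl a))}"

lemma cocover_roots_subset: "x \<in> G \<Longrightarrow> cocover_roots x \<subseteq> inversions x"
  using len_refl_greater by (fastforce simp: cocover_roots_def inversions_def)

lemma finite_cocover_roots: "x \<in> G \<Longrightarrow> finite (cocover_roots x)"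
  using cocover_roots_subset finite_inv finite_subset by blast

text \<open>The combinatorial counterpart of moving a weight past \<open>A k\<close>. The cocovers
  of a longer element \<open>gen k\<close> times \<open>y\<close> are \<open>y\<close> itself and
  the lifts of those cocovers of \<open>y\<close> that become longer under \<open>gen k\<close>. A
  new root other than \<open>a\<close> cannot arise, because \<open>a\<close> is the only root that
  \<open>y\<close> sends to \<open>sr k\<close>.\<close>

lemma cocover_roots_gen:
  assumes y: "y \<in> G" and up: "len (gen k \<odot> y) = Suc (len y)"
  obtains a where "a \<in> Pos" "act y a = sr k" "gen k \<odot> y \<odot> refl a = y"
    "cocover_roots (gen k \<odot> y) =
      insert a {c \<in> cocover_roots y. len (gen k \<odot> (y \<odot> refl c)) = Suc (len (y \<odot> refl c))}"
    "a \<notin> cocover_roots y"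
proof -
  obtain a where a: "a \<in> Pos" "gen k \<odot> y = y \<odot> refl a" "act y a = sr k \<or> act y a = neg (sr k)"
    using gen_as_refl[OF y, of k] by blast
  have "act y a \<in> Pos" using len_refl_less[OF y a(1)] a(2) up by fastforce
  then have ya: "act y a = sr k" using a(3) neg_Pos sr_Pos sr_root by metis
  let ?x = "gen k \<odot> y"
  have xG: "?x \<in> G" using y gen_closed mult_closed by blast
  have xa: "?x \<odot> refl a = y" using a(1,2) y by (simp add: refl_cancel Pos_root)
  have *: "?x \<odot> refl c = gen k \<odot> (y \<odot> refl c)" if "c \<in> Pos" for c
    using that y by (simp add: assoc gen_closed refl_closed Pos_root)
  have "c \<in> cocover_roots y \<and> len (gen k \<odot> (y \<odot> refl c)) = Suc (len (y \<odot> refl c))"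
    if c: "c \<in> cocover_roots ?x" "c \<noteq> a" for c
  proof -
    have cP: "c \<in> Pos" and cl: "len ?x = Suc (len (gen k \<odot> (y \<odot> refl c)))"
      using c * by (auto simp: cocover_roots_def)
    have ycG: "y \<odot> refl c \<in> G" using y cP by (simp add: mult_closed refl_closed Pos_root)
    have "act ?x c \<notin> Pos"
      using len_refl_less_iff[OF xG cP] *[OF cP] cl by simp
    have "act y c \<notin> Pos"
    proof
      assume "act y c \<in> Pos"
      then have "act y c = sr k"
        using gen_Pos[of "act y c" k] \<open>act ?x c \<notin> Pos\<close> y cP
        by (auto simp: act_mult gen_closed Pos_root)
      then show False using act_injective[OF y] ya a(1) cP c(2) Pos_root by metis
    qed
    then have "len (y \<odot> refl c) < len y" using len_refl_less[OF y cP] by blast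
    then show ?thesis using len_gen[OF ycG, of k] cl up cP by (auto simp: cocover_roots_def)
  qed
  moreover have "c \<in> cocover_roots ?x"
    if "c \<in> cocover_roots y" "len (gen k \<odot> (y \<odot> refl c)) = Suc (len (y \<odot> refl c))" for c
    using that * up by (auto simp: cocover_roots_def)
  moreover have "a \<in> cocover_roots ?x" using a(1) xa up by (simp add: cocover_roots_def)
  moreover have "a \<notin> cocover_roots y"
    using cocover_roots_subset[OF y] \<open>act y a \<in> Pos\<close> by (auto simp: inversions_def)
  ultimately show ?thesis using that[OF a(1) ya xa] by blast
qed

end


section \<open>The finite root system\<close>

lemma pairing_add_left: "pairing (x + y) \<mu> = pairing x \<mu> + pairing y \<mu>"
  by (simp add: pairing_def algebra_simps sum.distrib)

lemma pairing_add_right: "pairing x (\<mu> + \<nu>) = pairing x \<mu> + pairing x \<nu>"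
  by (simp add: pairing_def algebra_simps sum.distrib)

lemma pairing_scale_left: "pairing (k *s x) \<mu> = k * pairing x \<mu>"
  by (simp add: pairing_def sum_distrib_left mult.assoc)

lemma pairing_scale_right: "pairing x (k *s \<mu>) = k * pairing x \<mu>"
  by (simp add: pairing_def sum_distrib_left algebra_simps)

lemma pairing_minus_left: "pairing (- x) \<mu> = - pairing x \<mu>"
  by (simp add: pairing_def sum_negf)

lemma pairing_minus_right: "pairing x (- \<mu>) = - pairing x \<mu>"
  by (simp add: pairing_def sum_negf)

lemma pairing_diff_left: "pairing (x - y) \<mu> = pairing x \<mu> - pairing y \<mu>"
  by (simp add: pairing_def algebra_simps sum_subtractf)

lemma pairing_diff_right: "pairing x (\<mu> - \<nu>) = pairing x \<mu> - pairing x \<nu>"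
  by (simp add: pairing_def algebra_simps sum_subtractf)

lemma pairing_zero_left [simp]: "pairing 0 \<mu> = 0"
  by (simp add: pairing_def)

lemma pairing_zero_right [simp]: "pairing x 0 = 0"
  by (simp add: pairing_def)

lemma pairing_sum_right: "pairing x (\<Sum>i\<in>A. f i) = (\<Sum>i\<in>A. pairing x (f i))"
  by (induction A rule: infinite_finite_induct) (simp_all add: pairing_add_right)

lemma pairing_fundamental_weight [simp]: "pairing x (fundamental_weight i) = x $ i"
  by (simp add: pairing_def fundamental_weight_def axis_def mult_delta_left mult_delta_right cong: if_cong)

lemma pairing_simple_coroot [simp]: "pairing (simple_coroot i) \<mu> = \<mu> $ i"
  by (simp add: pairing_def simple_coroot_def axis_def mult_delta_left mult_delta_right cong: if_cong)

lemma pairing_eqI: "(\<And>\<mu>. pairing x \<mu> = pairing y \<mu>) \<Longrightarrow> x = y"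
  by (metis pairing_fundamental_weight vec_eq_iff)

lemma weight_expansion: "\<mu> = (\<Sum>i\<in>UNIV. \<mu> $ i *s fundamental_weight i)" for \<mu> :: "int ^ 'i::finite"
  by (simp add: vec_eq_iff fundamental_weight_def axis_def mult_delta_left mult_delta_right cong: if_cong)

lemma even_symmetric_sum:
  fixes t :: "'x \<Rightarrow> 'x \<Rightarrow> int"
  assumes "finite X" "\<And>i j. t i j = t j i" "\<And>i. even (t i i)"
  shows "even (\<Sum>i\<in>X. \<Sum>j\<in>X. t i j)"
  using assms(1)
proof (induction X)
  case (insert x X)
  have "(\<Sum>i\<in>insert x X. \<Sum>j\<in>insert x X. t i j) =
      t x x + (\<Sum>j\<in>X. t x j) + ((\<Sum>i\<in>X. t i x) + (\<Sum>i\<in>X. \<Sum>j\<in>X. t i j))"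
    using insert by (simp add: sum.distrib)
  also have "(\<Sum>i\<in>X. t i x) = (\<Sum>j\<in>X. t x j)" using assms(2) by simp
  finally show ?case using insert.IH assms(3) by simp
qed simp

lemma finite_bounded_int_vectors: "finite {x :: int ^ 'i::finite. \<forall>i. \<bar>x $ i\<bar> \<le> n}"
proof -
  have "{x :: int ^ 'i. \<forall>i. \<bar>x $ i\<bar> \<le> n} \<subseteq> vec_lambda ` (PiE UNIV (\<lambda>_. {- n..n}))"
  proof
    fix x :: "int ^ 'i" assume "x \<in> {x. \<forall>i. \<bar>x $ i\<bar> \<le> n}"
    then have "vec_nth x \<in> PiE UNIV (\<lambda>_. {- n..n})" by (auto simp: abs_le_iff minus_le_iff)
    then show "x \<in> vec_lambda ` (PiE UNIV (\<lambda>_. {- n..n}))" by (metis image_eqI vec_nth_inverse)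
  qed
  then show ?thesis by (rule finite_subset) (intro finite_imageI finite_PiE, auto)
qed

context root_datum
begin

section \<open>Root coordinates and the invariant form\<close>

definition symmetrizer :: "'i \<Rightarrow> real" where
  "symmetrizer = (SOME d. (\<forall>i. d i > 0) \<and> (\<forall>i j. d i * of_int (C i j) = d j * of_int (C j i)) \<and>
         (\<forall>x :: 'i \<Rightarrow> real. (\<exists>i. x i \<noteq> 0) \<longrightarrow>
            (\<Sum>i\<in>UNIV. \<Sum>j\<in>UNIV. d i * of_int (C i j) * x i * x j) > 0))"

lemma
  shows symmetrizer_pos: "symmetrizer i > 0"
    and symmetrizer_sym: "symmetrizer i * C i j = symmetrizer j * C j i"
    and symmetrizer_posdef: "x i \<noteq> 0 \<Longrightarrow>
      (\<Sum>i\<in>UNIV. \<Sum>j\<in>UNIV. symmetrizer i * C i j * x i * x j) > 0"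
  using someI_ex[OF finite_type, folded symmetrizer_def] by blast+

definition cartan :: "real ^ 'i ^ 'i" where
  "cartan = (\<chi> i j. real_of_int (C i j))"

lemma cartan_injective:
  assumes "cartan *v x = 0" shows "x = 0"
proof (rule ccontr)
  assume "x \<noteq> 0"
  then obtain i where "x $ i \<noteq> 0" by (metis vec_eq_iff zero_index)
  then have "0 < (\<Sum>i\<in>UNIV. \<Sum>j\<in>UNIV. symmetrizer i * C i j * x $ i * x $ j)"
    by (rule symmetrizer_posdef)
  also have "\<dots> = (\<Sum>i\<in>UNIV. symmetrizer i * x $ i * (cartan *v x) $ i)"
    by (simp add: cartan_def matrix_vector_mult_def sum_distrib_left algebra_simps)
  finally show False using assms by simp
qed

text \<open>Coordinates of a weight with respect to the simple roots; in general they are only rational.\<close>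

definition root_coords :: "'i weight \<Rightarrow> real ^ 'i" where
  "root_coords \<mu> = matrix_inv cartan *v (\<chi> i. real_of_int (\<mu> $ i))"

lemma cartan_invertible: "invertible cartan"
  using cartan_injective matrix_left_invertible_ker invertible_left_inverse by metis

lemma cartan_inverse: "cartan ** matrix_inv cartan = mat 1" "matrix_inv cartan ** cartan = mat 1"
  using someI_ex[OF cartan_invertible[unfolded invertible_def], folded matrix_inv_def] by auto

lemma cartan_root_coords: "(cartan *v root_coords \<mu>) $ i = \<mu> $ i"
  by (simp add: root_coords_def matrix_vector_mul_assoc cartan_inverse)

lemma root_coords_cartan: "(\<And>i. (cartan *v x) $ i = \<mu> $ i) \<Longrightarrow> root_coords \<mu> = x"
proof -
  assume "\<And>i. (cartan *v x) $ i = \<mu> $ i"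
  then have "(\<chi> i. real_of_int (\<mu> $ i)) = cartan *v x" by (simp add: vec_eq_iff)
  then show ?thesis
    by (simp add: root_coords_def matrix_vector_mul_assoc cartan_inverse)
qed

lemma weight_nth: "real_of_int (\<mu> $ i) = (\<Sum>j\<in>UNIV. C i j * root_coords \<mu> $ j)"
  using cartan_root_coords[of \<mu> i] by (simp add: cartan_def matrix_vector_mult_def)

lemma root_coords_add: "root_coords (\<mu> + \<nu>) = root_coords \<mu> + root_coords \<nu>"
  by (rule root_coords_cartan) (simp add: matrix_vector_right_distrib cartan_root_coords)

lemma root_coords_scale: "root_coords (k *s \<mu>) = real_of_int k *\<^sub>R root_coords \<mu>"
  by (rule root_coords_cartan) (simp add: matrix_vector_mult_scaleR cartan_root_coords)

lemma root_coords_minus: "root_coords (- \<mu>) = - root_coords \<mu>"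
  using root_coords_scale[of "-1" \<mu>] by (simp add: vector_sneg_minus1[symmetric])

lemma root_coords_diff: "root_coords (\<mu> - \<nu>) = root_coords \<mu> - root_coords \<nu>"
  using root_coords_add[of \<mu> "- \<nu>"] by (simp add: root_coords_minus)

lemma root_coords_0 [simp]: "root_coords 0 = 0"
  using root_coords_diff[of 0 0] by simp

lemma root_coords_sum: "root_coords (\<Sum>i\<in>A. f i) = (\<Sum>i\<in>A. root_coords (f i))"
  by (induction A rule: infinite_finite_induct) (simp_all add: root_coords_add)

lemma root_coords_simple_root: "root_coords (simple_root j) = axis j 1"
  by (rule root_coords_cartan)
    (simp add: simple_root_def cartan_def matrix_vector_mult_def axis_def mult_delta_left mult_delta_right cong: if_cong)

lemma root_coords_combination: "root_coords (\<Sum>j\<in>UNIV. c j *s simple_root j) $ i = real_of_int (c i)"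
  by (simp add: root_coords_sum root_coords_scale root_coords_simple_root axis_def mult_delta_left mult_delta_right
      cong: if_cong)

lemma root_coords_eqI: "root_coords \<mu> = root_coords \<nu> \<Longrightarrow> \<mu> = \<nu>"
  by (metis (mono_tags, lifting) cartan_root_coords of_int_eq_iff vec_eq_iff)

text \<open>The Weyl-invariant scalar product, normalised so that a simple root has norm twice its
  symmetrizer. The left argument is expanded in simple roots and the right one in fundamental
  weights, because these two bases are orthogonal to each other up to the symmetrizer.\<close>

definition form :: "'i weight \<Rightarrow> 'i weight \<Rightarrow> real" where
  "form \<mu> \<nu> = (\<Sum>j\<in>UNIV. root_coords \<mu> $ j * symmetrizer j * \<nu> $ j)"

lemma form_add_left: "form (\<mu> + \<mu>') \<nu> = form \<mu> \<nu> + form \<mu>' \<nu>"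
  by (simp add: form_def root_coords_add algebra_simps sum.distrib)

lemma form_scale_left: "form (k *s \<mu>) \<nu> = k * form \<mu> \<nu>"
  by (simp add: form_def root_coords_scale sum_distrib_left algebra_simps)

lemma form_sym: "form \<mu> \<nu> = form \<nu> \<mu>"
proof -
  have *: "form \<mu> \<nu> = (\<Sum>j\<in>UNIV. \<Sum>k\<in>UNIV. symmetrizer j * C j k * root_coords \<mu> $ j * root_coords \<nu> $ k)"
    for \<mu> \<nu> by (simp add: form_def weight_nth sum_distrib_left algebra_simps)
  show ?thesis unfolding *[of \<mu>]
    by (subst sum.swap) (simp add: * symmetrizer_sym algebra_simps)
qed

lemma form_scale_right: "form \<nu> (k *s \<mu>) = k * form \<nu> \<mu>"
  using form_scale_left form_sym by metis

lemma form_minus_left: "form (- \<mu>) \<nu> = - form \<mu> \<nu>"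
  by (simp add: form_def root_coords_minus sum_negf)

lemma form_minus_right: "form \<nu> (- \<mu>) = - form \<nu> \<mu>"
  using form_minus_left form_sym by metis

lemma form_diff_left: "form (\<mu> - \<mu>') \<nu> = form \<mu> \<nu> - form \<mu>' \<nu>"
  using form_add_left[of \<mu> "- \<mu>'"] by (simp add: form_minus_left)

lemma form_diff_right: "form \<nu> (\<mu> - \<mu>') = form \<nu> \<mu> - form \<nu> \<mu>'"
  using form_diff_left form_sym by metis

lemma form_pos: "\<mu> \<noteq> 0 \<Longrightarrow> form \<mu> \<mu> > 0"
proof -
  assume "\<mu> \<noteq> 0"
  then obtain i where "root_coords \<mu> $ i \<noteq> 0"
    using root_coords_eqI[of \<mu> 0] by (metis root_coords_0 vec_eq_iff zero_index)
  then show ?thesis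
    using symmetrizer_posdef[of "\<lambda>i. root_coords \<mu> $ i" i]
    by (simp add: form_def weight_nth sum_distrib_left algebra_simps)
qed

lemma form_nonneg: "form \<mu> \<mu> \<ge> 0"
  using form_pos[of \<mu>] by (cases "\<mu> = 0") (auto simp: form_def)

lemma form_simple_root: "form (simple_root j) \<nu> = symmetrizer j * \<nu> $ j"
  by (simp add: form_def root_coords_simple_root axis_def mult_delta_left mult_delta_right cong: if_cong)

lemma form_simple_root_right: "form \<nu> (simple_root j) = symmetrizer j * \<nu> $ j"
  using form_simple_root form_sym by metis

lemma simple_root_nth: "simple_root j $ i = C i j"
  by (simp add: simple_root_def)

lemma form_simple_simple: "form (simple_root j) (simple_root j) = 2 * symmetrizer j"
  by (simp add: form_simple_root simple_root_nth diagonal)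

lemma simple_reflection_eq: "simple_reflection i \<mu> = \<mu> - (\<mu> $ i) *s simple_root i"
  by (simp add: simple_reflection_def)

lemma form_simple_reflection: "form (simple_reflection i \<mu>) (simple_reflection i \<nu>) = form \<mu> \<nu>"
  by (simp add: simple_reflection_eq form_diff_left form_diff_right form_scale_left form_scale_right
      form_simple_root form_simple_root_right simple_root_nth diagonal algebra_simps)

lemma simple_reflection_involution: "simple_reflection i (simple_reflection i \<mu>) = \<mu>"
  by (simp add: simple_reflection_eq vec_eq_iff simple_root_nth diagonal algebra_simps)

subsection \<open>The Weyl group\<close>

lemma weyl_simple: "simple_reflection i \<in> weyl_group"
  using weyl_group.mult[OF weyl_group.one, of i] by simp

lemma weyl_comp: "u \<in> weyl_group \<Longrightarrow> v \<in> weyl_group \<Longrightarrow> u \<circ> v \<in> weyl_group"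
  by (induction rule: weyl_group.induct) (auto intro: weyl_group.mult simp: comp_assoc)

lemma weyl_inverse_ex: "w \<in> weyl_group \<Longrightarrow> \<exists>v\<in>weyl_group. v \<circ> w = id \<and> w \<circ> v = id"
proof (induction rule: weyl_group.induct)
  case one
  then show ?case by (intro bexI[OF _ weyl_group.one]) auto
next
  case (mult w i)
  then obtain v where v: "v \<in> weyl_group" "v \<circ> w = id" "w \<circ> v = id" by blast
  have "(v \<circ> simple_reflection i) \<circ> (simple_reflection i \<circ> w) = id"
    "(simple_reflection i \<circ> w) \<circ> (v \<circ> simple_reflection i) = id"
    using v(2,3) by (auto simp: fun_eq_iff simple_reflection_involution)
  then show ?case by (intro bexI[OF _ weyl_comp[OF v(1) weyl_simple]] conjI)
qed

lemma weyl_bij: "w \<in> weyl_group \<Longrightarrow> bij w"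
  by (drule weyl_inverse_ex) (auto intro: o_bij)

lemma weyl_inv: "w \<in> weyl_group \<Longrightarrow> inv w \<in> weyl_group"
  by (frule weyl_inverse_ex) (use inv_unique_comp[of w] in auto)

lemma weyl_inv_apply [simp]: "w \<in> weyl_group \<Longrightarrow> inv w (w \<mu>) = \<mu>"
  using weyl_bij by (simp add: bij_is_inj inv_f_f)

lemma weyl_apply_inv [simp]: "w \<in> weyl_group \<Longrightarrow> w (inv w \<mu>) = \<mu>"
  using weyl_bij by (simp add: bij_is_surj surj_f_inv_f)

lemma weyl_comp_inv: "w \<in> weyl_group \<Longrightarrow> w \<circ> inv w = id" "w \<in> weyl_group \<Longrightarrow> inv w \<circ> w = id"
  by (auto simp: fun_eq_iff)

lemma weyl_inv_comp: "u \<in> weyl_group \<Longrightarrow> v \<in> weyl_group \<Longrightarrow> inv (u \<circ> v) = inv v \<circ> inv u"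
  by (simp add: o_inv_distrib weyl_bij)

lemma weyl_inv_inv: "w \<in> weyl_group \<Longrightarrow> inv (inv w) = w"
  by (simp add: inv_inv_eq weyl_bij)

lemma weyl_add: "w \<in> weyl_group \<Longrightarrow> w (\<mu> + \<nu>) = w \<mu> + w \<nu>"
  by (induction rule: weyl_group.induct)
    (auto simp: simple_reflection_eq vec_eq_iff algebra_simps)

lemma weyl_scale: "w \<in> weyl_group \<Longrightarrow> w (k *s \<mu>) = k *s w \<mu>"
  by (induction rule: weyl_group.induct)
    (auto simp: simple_reflection_eq vec_eq_iff algebra_simps)

lemma weyl_minus: "w \<in> weyl_group \<Longrightarrow> w (- \<mu>) = - w \<mu>"
  using weyl_scale[of w "-1" \<mu>] by (simp add: vector_sneg_minus1[symmetric])

lemma weyl_diff: "w \<in> weyl_group \<Longrightarrow> w (\<mu> - \<nu>) = w \<mu> - w \<nu>"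
  using weyl_add[of w \<mu> "- \<nu>"] by (simp add: weyl_minus)

lemma weyl_zero: "w \<in> weyl_group \<Longrightarrow> w 0 = 0"
  using weyl_diff[of w 0 0] by simp

lemma weyl_sum: "w \<in> weyl_group \<Longrightarrow> w (\<Sum>i\<in>A. f i) = (\<Sum>i\<in>A. w (f i))"
  by (induction A rule: infinite_finite_induct) (simp_all add: weyl_add weyl_zero)

lemma form_weyl: "w \<in> weyl_group \<Longrightarrow> form (w \<mu>) (w \<nu>) = form \<mu> \<nu>"
  by (induction rule: weyl_group.induct) (auto simp: form_simple_reflection)

text \<open>Simple roots span the weight lattice only rationally, so linearity over the integers is
  not enough. An element that fixes the simple roots preserves the form with each of them, and these
  values are the coordinates of a weight up to positive factors.\<close>

lemma weyl_eqI:
  assumes "u \<in> weyl_group" "v \<in> weyl_group" "\<And>i. u (simple_root i) = v (simple_root i)"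
  shows "u = v"
proof
  fix \<mu>
  have "symmetrizer i * u \<mu> $ i = symmetrizer i * (v \<mu>) $ i" if "True" for i
  proof -
    let ?w = "inv v \<circ> u"
    have w: "?w \<in> weyl_group" using assms weyl_comp weyl_inv by blast
    have fixed: "?w (simple_root j) = simple_root j" for j using assms by simp
    have "symmetrizer j * ?w \<mu> $ j = symmetrizer j * \<mu> $ j" for j
      using form_weyl[OF w, of "simple_root j" \<mu>] fixed by (simp add: form_simple_root)
    then have "?w \<mu> = \<mu>" using symmetrizer_pos by (simp add: vec_eq_iff less_imp_neq[symmetric])
    then have "u \<mu> = v \<mu>" using assms(2) by (metis comp_apply weyl_apply_inv)
    then show ?thesis by simp
  qed
  then show "u \<mu> = v \<mu>" using symmetrizer_pos by (simp add: vec_eq_iff less_imp_neq[symmetric])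
qed

lemma pairing_act_coweight:
  assumes "w \<in> weyl_group" shows "pairing (act_coweight w x) \<mu> = pairing x (inv w \<mu>)"
proof -
  have "pairing x (inv w \<mu>) = pairing x (inv w (\<Sum>i\<in>UNIV. \<mu> $ i *s fundamental_weight i))"
    using weight_expansion[of \<mu>] by simp
  also have "\<dots> = (\<Sum>i\<in>UNIV. \<mu> $ i * pairing x (inv w (fundamental_weight i)))"
    using weyl_inv[OF assms] by (simp add: weyl_sum weyl_scale pairing_sum_right pairing_scale_right)
  also have "\<dots> = pairing (act_coweight w x) \<mu>"
    by (subst pairing_def) (simp add: act_coweight_def mult.commute)
  finally show ?thesis by simp
qed

lemma pairing_act_act:
  "w \<in> weyl_group \<Longrightarrow> pairing (act_coweight w x) (w \<mu>) = pairing x \<mu>"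
  by (simp add: pairing_act_coweight)

lemma act_coweight_comp:
  "u \<in> weyl_group \<Longrightarrow> v \<in> weyl_group \<Longrightarrow> act_coweight (u \<circ> v) x = act_coweight u (act_coweight v x)"
  by (rule pairing_eqI) (simp add: pairing_act_coweight weyl_comp weyl_inv_comp)

lemma act_coweight_id [simp]: "act_coweight id x = x" for x :: "'i coweight"
  by (rule pairing_eqI) (simp add: pairing_act_coweight[OF weyl_group.one])

lemma act_coweight_add:
  "w \<in> weyl_group \<Longrightarrow> act_coweight w (x + y) = act_coweight w x + act_coweight w y"
  by (rule pairing_eqI) (simp add: pairing_act_coweight pairing_add_left)

lemma act_coweight_scale: "w \<in> weyl_group \<Longrightarrow> act_coweight w (k *s x) = k *s act_coweight w x"
  by (rule pairing_eqI) (simp add: pairing_act_coweight pairing_scale_left)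

lemma act_coweight_minus: "w \<in> weyl_group \<Longrightarrow> act_coweight w (- x) = - act_coweight w x"
  by (rule pairing_eqI) (simp add: pairing_act_coweight pairing_minus_left)

lemma act_coweight_diff:
  "w \<in> weyl_group \<Longrightarrow> act_coweight w (x - y) = act_coweight w x - act_coweight w y"
  by (rule pairing_eqI) (simp add: pairing_act_coweight pairing_diff_left)

lemma act_coweight_inv [simp]:
  "w \<in> weyl_group \<Longrightarrow> act_coweight (inv w) (act_coweight w x) = x"
  "w \<in> weyl_group \<Longrightarrow> act_coweight w (act_coweight (inv w) x) = x"
  by (simp_all add: act_coweight_comp[symmetric] weyl_inv weyl_comp_inv)

subsection \<open>Roots and coroots\<close>

lemma rootI: "w \<in> weyl_group \<Longrightarrow> w (simple_root i) \<in> roots"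
  by (auto simp: roots_def)

lemma weyl_root: "w \<in> weyl_group \<Longrightarrow> \<alpha> \<in> roots \<Longrightarrow> w \<alpha> \<in> roots"
proof -
  assume w: "w \<in> weyl_group" and "\<alpha> \<in> roots"
  then obtain u i where "u \<in> weyl_group" "\<alpha> = u (simple_root i)" by (auto simp: roots_def)
  then show ?thesis using rootI[OF weyl_comp[OF w, of u], of i] by simp
qed

lemma simple_root_root: "simple_root i \<in> roots"
  using rootI[OF weyl_group.one] by simp

lemma simple_reflection_simple: "simple_reflection i (simple_root i) = - simple_root i"
  by (simp add: simple_reflection_eq simple_root_nth diagonal vec_eq_iff)

lemma root_minus: "\<alpha> \<in> roots \<Longrightarrow> - \<alpha> \<in> roots"
proof -
  assume "\<alpha> \<in> roots"
  then obtain u i where u: "u \<in> weyl_group" "\<alpha> = u (simple_root i)" by (auto simp: roots_def)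
  then have "- \<alpha> = u (simple_reflection i (simple_root i))"
    by (simp add: simple_reflection_simple weyl_minus)
  then show ?thesis using u(1) weyl_root weyl_simple simple_root_root by metis
qed

lemma simple_root_nonzero: "simple_root i \<noteq> 0"
  using diagonal[of i] by (metis simple_root_nth zero_index zero_neq_numeral)

lemma root_nonzero: "\<alpha> \<in> roots \<Longrightarrow> \<alpha> \<noteq> 0"
  unfolding roots_def using simple_root_nonzero weyl_zero weyl_inv weyl_inv_apply by (auto, metis)

lemma form_root_pos: "\<alpha> \<in> roots \<Longrightarrow> form \<alpha> \<alpha> > 0"
  using form_pos root_nonzero by blast

text \<open>The right-hand side depends only on the root \<open>w (simple_root i)\<close>, not on
  the way it is written. This makes the description in \<open>coroot\<close> well defined.\<close>

lemma pairing_coroot_aux: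
  assumes "w \<in> weyl_group"
  shows "pairing (act_coweight w (simple_coroot i)) \<mu> =
    2 * form (w (simple_root i)) \<mu> / form (w (simple_root i)) (w (simple_root i))"
proof -
  have "form (w (simple_root i)) \<mu> = form (simple_root i) (inv w \<mu>)"
    using form_weyl[OF assms, of "simple_root i" "inv w \<mu>"] assms by simp
  then show ?thesis
    using symmetrizer_pos[of i] assms
    by (simp add: pairing_act_coweight form_weyl form_simple_root simple_root_nth diagonal)
qed

lemma coroot_weyl_simple:
  assumes "w \<in> weyl_group"
  shows "coroot (w (simple_root i)) = act_coweight w (simple_coroot i)"
  unfolding coroot_def
proof (rule the_equality)
  fix h assume "\<exists>u\<in>weyl_group. \<exists>k. w (simple_root i) = u (simple_root k) \<and> h = act_coweight u (simple_coroot k)"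
  then obtain u k where u: "u \<in> weyl_group" "w (simple_root i) = u (simple_root k)"
    "h = act_coweight u (simple_coroot k)" by blast
  have "real_of_int (pairing h \<mu>) = real_of_int (pairing (act_coweight w (simple_coroot i)) \<mu>)" for \<mu>
    using pairing_coroot_aux[OF u(1), of k] pairing_coroot_aux[OF assms, of i] u by simp
  then show "h = act_coweight w (simple_coroot i)" by (intro pairing_eqI) simp
qed (use assms in blast)

lemma pairing_coroot:
  assumes "\<alpha> \<in> roots" shows "pairing (coroot \<alpha>) \<mu> = 2 * form \<alpha> \<mu> / form \<alpha> \<alpha>"
  using assms pairing_coroot_aux coroot_weyl_simple by (auto simp: roots_def)

lemma coroot_simple_root: "coroot (simple_root i) = simple_coroot i"
  using coroot_weyl_simple[OF weyl_group.one] by simp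

lemma coroot_weyl:
  assumes "w \<in> weyl_group" "\<alpha> \<in> roots" shows "coroot (w \<alpha>) = act_coweight w (coroot \<alpha>)"
proof -
  obtain u i where u: "u \<in> weyl_group" "\<alpha> = u (simple_root i)" using assms by (auto simp: roots_def)
  have "coroot ((w \<circ> u) (simple_root i)) = act_coweight (w \<circ> u) (simple_coroot i)"
    using assms u weyl_comp coroot_weyl_simple by blast
  then show ?thesis using u assms by (simp add: act_coweight_comp coroot_weyl_simple)
qed

lemma coroot_minus: "\<alpha> \<in> roots \<Longrightarrow> coroot (- \<alpha>) = - coroot \<alpha>"
proof (rule pairing_eqI)
  fix \<mu> assume a: "\<alpha> \<in> roots"
  have "real_of_int (pairing (coroot (- \<alpha>)) \<mu>) = real_of_int (pairing (- coroot \<alpha>) \<mu>)"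
    using pairing_coroot[OF a] pairing_coroot[OF root_minus[OF a]]
    by (simp add: form_minus_left form_minus_right pairing_minus_left)
  then show "pairing (coroot (- \<alpha>)) \<mu> = pairing (- coroot \<alpha>) \<mu>" by simp
qed

lemma pairing_coroot_self: "\<alpha> \<in> roots \<Longrightarrow> pairing (coroot \<alpha>) \<alpha> = 2"
  using pairing_coroot[of \<alpha> \<alpha>] form_root_pos[of \<alpha>] by simp

lemma pairing_coroot_weyl:
  "w \<in> weyl_group \<Longrightarrow> \<alpha> \<in> roots \<Longrightarrow> pairing (coroot (w \<alpha>)) (w \<mu>) = pairing (coroot \<alpha>) \<mu>"
  by (simp add: coroot_weyl pairing_act_act)

lemma reflection_simple_root: "reflection (simple_root i) = simple_reflection i"
  by (rule ext) (simp add: reflection_def simple_reflection_def coroot_simple_root)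

lemma reflection_weyl:
  assumes "w \<in> weyl_group" "\<alpha> \<in> roots"
  shows "reflection (w \<alpha>) \<circ> w = w \<circ> reflection \<alpha>"
  using assms by (simp add: fun_eq_iff reflection_def pairing_coroot_weyl weyl_diff weyl_scale)

lemma reflection_in_weyl: "\<alpha> \<in> roots \<Longrightarrow> reflection \<alpha> \<in> weyl_group"
proof -
  assume "\<alpha> \<in> roots"
  then obtain u i where u: "u \<in> weyl_group" "\<alpha> = u (simple_root i)" by (auto simp: roots_def)
  then have "reflection \<alpha> \<circ> u \<circ> inv u = u \<circ> simple_reflection i \<circ> inv u"
    using reflection_weyl[OF u(1) simple_root_root] by (simp add: reflection_simple_root)
  then have "reflection \<alpha> = u \<circ> simple_reflection i \<circ> inv u"
    using u(1) by (simp add: comp_assoc weyl_comp_inv)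
  then show ?thesis using u weyl_comp weyl_inv weyl_simple by metis
qed

lemma reflection_minus: "\<alpha> \<in> roots \<Longrightarrow> reflection (- \<alpha>) = reflection \<alpha>"
  by (rule ext) (simp add: reflection_def coroot_minus pairing_minus_left vec_eq_iff)

lemma reflection_self: "\<alpha> \<in> roots \<Longrightarrow> reflection \<alpha> \<alpha> = - \<alpha>"
  by (simp add: reflection_def pairing_coroot_self vec_eq_iff)

lemma reflection_involution: "\<alpha> \<in> roots \<Longrightarrow> reflection \<alpha> (reflection \<alpha> \<mu>) = \<mu>"
  by (simp add: reflection_def pairing_diff_right pairing_scale_right pairing_coroot_self vec_eq_iff
      algebra_simps)

lemma inv_reflection: "\<alpha> \<in> roots \<Longrightarrow> inv (reflection \<alpha>) = reflection \<alpha>"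
  by (rule inv_unique_comp) (auto simp: reflection_involution)

lemma act_coweight_reflection:
  "\<alpha> \<in> roots \<Longrightarrow> act_coweight (reflection \<alpha>) x = x - pairing x \<alpha> *s coroot \<alpha>"
  by (rule pairing_eqI)
    (simp add: pairing_act_coweight reflection_in_weyl inv_reflection reflection_def
      pairing_diff_right pairing_diff_left pairing_scale_left pairing_scale_right)

definition root_lattice :: "'i weight set" where
  "root_lattice = {\<Sum>j\<in>UNIV. c j *s simple_root j |c. True}"

lemma root_latticeI: "(\<Sum>j\<in>UNIV. c j *s simple_root j) \<in> root_lattice"
  by (auto simp: root_lattice_def)

lemma root_lattice_simple_reflection:
  assumes "\<mu> \<in> root_lattice" shows "simple_reflection i \<mu> \<in> root_lattice"
proof -
  obtain c where c: "\<mu> = (\<Sum>j\<in>UNIV. c j *s simple_root j)" using assms by (auto simp: root_lattice_def)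
  have "simple_reflection i \<mu> =
      (\<Sum>j\<in>UNIV. (c j - (if j = i then \<mu> $ i else 0)) *s simple_root j)"
    by (simp add: simple_reflection_eq c vec_eq_iff left_diff_distrib sum_subtractf mult_delta_left mult_delta_right
        cong: if_cong)
  then show ?thesis using root_latticeI by metis
qed

lemma simple_root_lattice: "simple_root i \<in> root_lattice"
proof -
  have "simple_root i = (\<Sum>j\<in>UNIV. (if j = i then 1 else 0) *s simple_root j)"
    by (simp add: vec_eq_iff mult_delta_left mult_delta_right cong: if_cong)
  then show ?thesis using root_latticeI by metis
qed

lemma root_in_lattice: "\<alpha> \<in> roots \<Longrightarrow> \<alpha> \<in> root_lattice"
proof -
  have "w (simple_root i) \<in> root_lattice" if "w \<in> weyl_group" for w i
    using that by (induction) (auto simp: simple_root_lattice root_lattice_simple_reflection)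
  then show "\<alpha> \<in> roots \<Longrightarrow> \<alpha> \<in> root_lattice" by (auto simp: roots_def)
qed

lemma nonneg_iff:
  assumes "\<mu> \<in> root_lattice"
  shows "\<mu> \<in> nonneg_root_combinations \<longleftrightarrow> (\<forall>j. root_coords \<mu> $ j \<ge> 0)"
proof
  assume "\<mu> \<in> nonneg_root_combinations"
  then show "\<forall>j. root_coords \<mu> $ j \<ge> 0"
    by (auto simp: nonneg_root_combinations_def root_coords_combination)
next
  assume *: "\<forall>j. root_coords \<mu> $ j \<ge> 0"
  obtain c where c: "\<mu> = (\<Sum>j\<in>UNIV. c j *s simple_root j)" using assms by (auto simp: root_lattice_def)
  have "c j \<ge> 0" for j using spec[OF *, of j] unfolding c root_coords_combination by simp
  then have "\<mu> = (\<Sum>j\<in>UNIV. int (nat (c j)) *s simple_root j)" using c by simp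
  moreover have "(\<Sum>j\<in>UNIV. int (nat (c j)) *s simple_root j) \<in> nonneg_root_combinations"
    unfolding nonneg_root_combinations_def by (rule CollectI) (rule exI[of _ "\<lambda>j. nat (c j)"], simp)
  ultimately show "\<mu> \<in> nonneg_root_combinations" by simp
qed

lemma nonneg_in_lattice: "\<mu> \<in> nonneg_root_combinations \<Longrightarrow> \<mu> \<in> root_lattice"
  by (auto simp: nonneg_root_combinations_def root_lattice_def)

lemma lattice_coords_int: "\<mu> \<in> root_lattice \<Longrightarrow> root_coords \<mu> $ j \<in> \<int>"
  by (auto simp: root_lattice_def root_coords_combination)

text \<open>A simple root is its symmetrizer times its simple coroot, and the root in question has
  norm twice \<open>symmetrizer i\<close>. Comparing coefficients gives the formula; its value lies
  in the left-hand side being an integer multiple of \<open>symmetrizer i\<close>.\<close>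

lemma coroot_nth:
  assumes "w \<in> weyl_group"
  shows "symmetrizer i * coroot (w (simple_root i)) $ k = root_coords (w (simple_root i)) $ k * symmetrizer k"
proof -
  let ?a = "w (simple_root i)"
  have "form ?a (fundamental_weight k) = root_coords ?a $ k * symmetrizer k"
    by (simp add: form_def fundamental_weight_def axis_def if_distrib mult_delta_right cong: if_cong)
  moreover have "form ?a ?a = 2 * symmetrizer i" using assms by (simp add: form_weyl form_simple_simple)
  moreover have "?a \<in> roots" using assms weyl_root simple_root_root by blast
  ultimately show ?thesis
    using pairing_coroot[of ?a "fundamental_weight k"] symmetrizer_pos[of i] by simp
qed

text \<open>Write a root \<open>\<beta> = w \<alpha>\<^sub>i\<close> as \<open>\<beta>\<^sub>+ - \<beta>\<^sub>-\<close> with disjoint supports.  In units of \<open>d\<^sub>i\<close> the norms of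
  \<open>\<beta>\<^sub>+\<close> and \<open>\<beta>\<^sub>-\<close> are even integers because the coroot of \<open>\<beta>\<close> is integral, \<open>(\<beta>\<^sub>+, \<beta>\<^sub>-) \<le> 0\<close>, and \<open>\<beta>\<close> has
  norm \<open>2\<close>; so one of the two vanishes.\<close>

lemma root_pos_or_neg:
  assumes "\<alpha> \<in> roots"
  shows "\<alpha> \<in> nonneg_root_combinations \<or> - \<alpha> \<in> nonneg_root_combinations"
proof (rule ccontr)
  assume neither: "\<not> ?thesis"
  obtain w i where w: "w \<in> weyl_group" "\<alpha> = w (simple_root i)" using assms by (auto simp: roots_def)
  obtain c where c: "\<alpha> = (\<Sum>j\<in>UNIV. c j *s simple_root j)"
    using root_in_lattice[OF assms] by (auto simp: root_lattice_def)
  have rc: "root_coords \<alpha> $ j = c j" for j using c root_coords_combination by simp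
  have rcm: "root_coords (- \<alpha>) $ j = - c j" for j by (simp add: root_coords_minus rc)
  obtain p where p: "c p > 0"
    using neither nonneg_iff[OF root_in_lattice[OF root_minus[OF assms]]] rcm by (auto simp: not_le)
  obtain n where n: "c n < 0"
    using neither nonneg_iff[OF root_in_lattice[OF assms]] rc by (auto simp: not_le)
  define h where "h j = coroot \<alpha> $ j" for j
  have hc: "symmetrizer i * h j = c j * symmetrizer j" for j
    using coroot_nth[OF w(1), of i j] w(2) rc by (simp add: h_def)
  have di: "symmetrizer i > 0" by (rule symmetrizer_pos)
  have hpos: "h j > 0 \<longleftrightarrow> c j > 0" for j
  proof -
    have "symmetrizer i * h j > 0 \<longleftrightarrow> c j * symmetrizer j > 0" by (simp add: hc)
    then show ?thesis using di symmetrizer_pos[of j] by (simp add: zero_less_mult_iff not_less[symmetric])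
  qed
  \<comment> \<open>The scalar product of the j-th and k-th simple root components of the root,
    divided by \<open>symmetrizer i\<close>. Written with the coroot coordinate \<open>h j\<close>
    it is visibly an integer.\<close>
  define t where "t j k = h j * c k * C j k" for j k
  have t: "symmetrizer i * t j k = symmetrizer j * C j k * c j * c k" for j k
    unfolding t_def by (simp add: mult.assoc[symmetric] hc)
  have tsym: "t j k = t k j" for j k
  proof -
    have "symmetrizer i * real_of_int (t j k) = symmetrizer i * t k j"
      unfolding t using symmetrizer_sym[of j k] by (simp add: algebra_simps)
    then show ?thesis using di by simp
  qed
  have teven: "even (t j j)" for j by (simp add: t_def diagonal)
  have part: "(\<Sum>j\<in>X. \<Sum>k\<in>X. t j k) \<ge> 2" if X: "x \<in> X" "c x \<noteq> 0" for X x
  proof -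
    let ?f = "\<lambda>j. if j \<in> X then real_of_int (c j) else 0"
    have "0 < (\<Sum>j\<in>UNIV. \<Sum>k\<in>UNIV. symmetrizer j * C j k * ?f j * ?f k)"
      by (rule symmetrizer_posdef[of _ x]) (use X in auto)
    also have "\<dots> = (\<Sum>j\<in>UNIV. if j \<in> X then (\<Sum>k\<in>UNIV. if k \<in> X then symmetrizer j * C j k * c j * c k else 0) else 0)"
      by (intro sum.cong) (auto intro!: sum.cong)
    also have "\<dots> = (\<Sum>j\<in>X. \<Sum>k\<in>X. symmetrizer j * C j k * c j * c k)"
      by (simp add: sum.If_cases)
    also have "\<dots> = symmetrizer i * (\<Sum>j\<in>X. \<Sum>k\<in>X. t j k)"
      by (simp add: t[symmetric] sum_distrib_left)
    finally have "0 < real_of_int (\<Sum>j\<in>X. \<Sum>k\<in>X. t j k)"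
      using di by (simp add: zero_less_mult_iff del: of_int_sum)
    then have "0 < (\<Sum>j\<in>X. \<Sum>k\<in>X. t j k)" by (simp del: of_int_sum)
    moreover have "even (\<Sum>j\<in>X. \<Sum>k\<in>X. t j k)" by (rule even_symmetric_sum[OF _ tsym teven]) simp
    ultimately show ?thesis by presburger
  qed
  define P where "P = {j. c j > 0}"
  define N where "N = - P"
  have "(\<Sum>j\<in>UNIV. \<Sum>k\<in>UNIV. t j k) = 2"
  proof -
    have "symmetrizer i * (\<Sum>j\<in>UNIV. \<Sum>k\<in>UNIV. t j k) =
        (\<Sum>j\<in>UNIV. \<Sum>k\<in>UNIV. symmetrizer j * C j k * c j * c k)"
      by (simp add: t[symmetric] sum_distrib_left)
    also have "\<dots> = form \<alpha> \<alpha>"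
      by (simp add: form_def weight_nth rc sum_distrib_left algebra_simps)
    also have "\<dots> = symmetrizer i * 2" using w by (simp add: form_weyl form_simple_simple)
    finally have "real_of_int (\<Sum>j\<in>UNIV. \<Sum>k\<in>UNIV. t j k) = 2" using di by simp
    then show ?thesis by linarith
  qed
  moreover have split: "(\<Sum>j\<in>UNIV. f j) = (\<Sum>j\<in>P. f j) + (\<Sum>j\<in>N. f j)" for f :: "'i \<Rightarrow> int"
    using sum.union_disjoint[of P N f] by (simp add: N_def)
  have "(\<Sum>j\<in>UNIV. \<Sum>k\<in>UNIV. t j k) = (\<Sum>j\<in>P. \<Sum>k\<in>P. t j k) + (\<Sum>j\<in>N. \<Sum>k\<in>N. t j k) +
      (\<Sum>j\<in>P. \<Sum>k\<in>N. t j k) + (\<Sum>j\<in>N. \<Sum>k\<in>P. t j k)"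
    by (simp add: split sum.distrib)
  moreover have "(\<Sum>j\<in>P. \<Sum>k\<in>P. t j k) \<ge> 2" using part[of p P] p by (simp add: P_def)
  moreover have "(\<Sum>j\<in>N. \<Sum>k\<in>N. t j k) \<ge> 2" using part[of n N] n by (simp add: P_def N_def)
  moreover have tpn: "t j k \<ge> 0" if "j \<in> P" "k \<in> N" for j k
  proof -
    have "j \<noteq> k" using that by (auto simp: N_def)
    then have "C j k \<le> 0" by (rule off_diagonal)
    moreover have "c k \<le> 0" "h j > 0" using that hpos by (auto simp: N_def P_def)
    ultimately show ?thesis by (simp add: t_def mult_nonneg_nonpos mult_nonpos_nonpos)
  qed
  moreover have "(\<Sum>j\<in>P. \<Sum>k\<in>N. t j k) \<ge> 0" by (intro sum_nonneg tpn)
  moreover have "(\<Sum>j\<in>N. \<Sum>k\<in>P. t j k) \<ge> 0"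
    using tpn tsym by (intro sum_nonneg) metis
  ultimately show False by linarith
qed

end


context root_datum
begin

section \<open>Positive roots and finiteness\<close>

lemma rootE:
  assumes "\<alpha> \<in> roots" obtains w i where "w \<in> weyl_group" "\<alpha> = w (simple_root i)"
  using assms unfolding roots_def by blast

lemma positive_root_iff: "\<alpha> \<in> roots \<Longrightarrow> \<alpha> \<in> positive_roots \<longleftrightarrow> (\<forall>j. root_coords \<alpha> $ j \<ge> 0)"
  by (simp add: positive_roots_def nonneg_iff root_in_lattice)

lemma positive_is_root: "\<alpha> \<in> positive_roots \<Longrightarrow> \<alpha> \<in> roots"
  by (simp add: positive_roots_def)

lemma uminus_positive_root_iff:
  assumes "\<alpha> \<in> roots" shows "- \<alpha> \<in> positive_roots \<longleftrightarrow> \<alpha> \<notin> positive_roots"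
proof
  assume "- \<alpha> \<in> positive_roots"
  then have 1: "root_coords \<alpha> $ j \<le> 0" for j
    using positive_root_iff[OF root_minus[OF assms]] by (simp add: root_coords_minus)
  show "\<alpha> \<notin> positive_roots"
  proof
    assume "\<alpha> \<in> positive_roots"
    then have "root_coords \<alpha> = root_coords 0"
      using positive_root_iff[OF assms] 1 by (auto simp: vec_eq_iff intro: order_antisym)
    then show False using root_coords_eqI root_nonzero[OF assms] by blast
  qed
next
  assume "\<alpha> \<notin> positive_roots"
  then show "- \<alpha> \<in> positive_roots"
    using root_pos_or_neg[OF assms] assms root_minus by (auto simp: positive_roots_def)
qed

lemma simple_root_positive: "simple_root i \<in> positive_roots"
  using positive_root_iff[OF simple_root_root] by (simp add: root_coords_simple_root axis_def)

text \<open>The root system is reduced: if a root is \<open>c\<close> times a simple root,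
  integrality of its coroot yields an integer \<open>h\<close> with
  \<open>c * h = 1\<close>.\<close>

lemma positive_multiple_simple_root:
  assumes "\<alpha> \<in> positive_roots" "\<And>j. j \<noteq> i \<Longrightarrow> root_coords \<alpha> $ j = 0"
  shows "\<alpha> = simple_root i"
proof -
  have r: "\<alpha> \<in> roots" using assms positive_is_root by blast
  obtain w k where w: "w \<in> weyl_group" "\<alpha> = w (simple_root k)" using r by (auto simp: roots_def)
  obtain c where c: "root_coords \<alpha> $ i = real_of_int c"
    using lattice_coords_int[OF root_in_lattice[OF r], of i] by (auto elim: Ints_cases)
  define h where "h = coroot \<alpha> $ i"
  have 1: "symmetrizer k * h = c * symmetrizer i" using coroot_nth[OF w(1), of k i] w(2) c h_def by simp
  have eq: "\<alpha> = c *s simple_root i"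
    by (rule root_coords_eqI)
      (use assms(2) c in \<open>auto simp: vec_eq_iff root_coords_scale root_coords_simple_root axis_def\<close>)
  then have "form \<alpha> \<alpha> = c * c * (2 * symmetrizer i)"
    by (simp add: form_scale_left form_scale_right form_simple_simple)
  moreover have "form \<alpha> \<alpha> = 2 * symmetrizer k" using w by (simp add: form_weyl form_simple_simple)
  ultimately have "symmetrizer k = c * (symmetrizer k * h)" using 1 by simp
  then have "real_of_int (c * h) = 1" using symmetrizer_pos[of k] by (simp add: field_simps)
  then have "c * h = 1" by linarith
  moreover have "c \<ge> 0" using c positive_root_iff[OF r] assms(1) by (metis of_int_0_le_iff)
  ultimately have "c = 1" using zmult_eq_1_iff[of c h] by simp
  then show ?thesis using eq by simp
qed

text \<open>The reflection changes only the coordinate \<open>i\<close>. Some other coordinate is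
  positive and stays so, and a root cannot have coordinates of both signs.\<close>

lemma simple_reflection_positive:
  assumes "\<alpha> \<in> positive_roots" "\<alpha> \<noteq> simple_root i"
  shows "simple_reflection i \<alpha> \<in> positive_roots"
proof -
  have r: "\<alpha> \<in> roots" using assms positive_is_root by blast
  obtain j where j: "j \<noteq> i" "root_coords \<alpha> $ j \<noteq> 0"
    using positive_multiple_simple_root assms by blast
  have "root_coords \<alpha> $ j > 0" using positive_root_iff[OF r] assms(1) j(2) by (metis order_le_less)
  then have pos: "root_coords (simple_reflection i \<alpha>) $ j > 0"
    using j(1) by (simp add: simple_reflection_eq root_coords_diff root_coords_scale
        root_coords_simple_root axis_def)
  have r': "simple_reflection i \<alpha> \<in> roots" using weyl_root[OF weyl_simple r] .
  show ?thesis
  proof (rule ccontr)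
    assume "\<not> ?thesis"
    then have "- simple_reflection i \<alpha> \<in> positive_roots" using uminus_positive_root_iff[OF r'] by blast
    then show False
      using positive_root_iff[OF root_minus[OF r']] pos by (metis minus_zero neg_le_iff_le not_le root_coords_minus uminus_vec_def vector_uminus_component)
  qed
qed

text \<open>The vector \<open>?g\<close> is twice the component of \<beta> orthogonal to \<alpha>;
  the factor 2 keeps it in the integral lattice. The inequality says that its norm is
  nonnegative.\<close>

lemma form_cauchy_schwarz:
  assumes "\<alpha> \<in> roots" "\<beta> \<in> roots"
  shows "(pairing (coroot \<alpha>) \<beta>)\<^sup>2 * form \<alpha> \<alpha> \<le> 4 * form \<beta> \<beta>"
    and "(pairing (coroot \<alpha>) \<beta>)\<^sup>2 * form \<alpha> \<alpha> = 4 * form \<beta> \<beta> \<Longrightarrow> 2 *s \<beta> = pairing (coroot \<alpha>) \<beta> *s \<alpha>"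
proof -
  let ?a = "pairing (coroot \<alpha>) \<beta>"
  let ?g = "2 *s \<beta> - ?a *s \<alpha>"
  have ab: "?a * form \<alpha> \<alpha> = 2 * form \<alpha> \<beta>"
    using pairing_coroot[OF assms(1), of \<beta>] form_root_pos[OF assms(1)] by simp
  have "form ?g ?g = 4 * form \<beta> \<beta> - 4 * ?a * form \<alpha> \<beta> + ?a * (?a * form \<alpha> \<alpha>)"
    by (simp add: form_diff_left form_diff_right form_scale_left form_scale_right form_sym[of \<beta> \<alpha>]
        algebra_simps)
  also have "\<dots> = 4 * form \<beta> \<beta> - ?a\<^sup>2 * form \<alpha> \<alpha>"
    by (simp add: ab power2_eq_square mult.assoc)
  finally have g: "form ?g ?g = 4 * form \<beta> \<beta> - ?a\<^sup>2 * form \<alpha> \<alpha>" .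
  show "?a\<^sup>2 * form \<alpha> \<alpha> \<le> 4 * form \<beta> \<beta>" using g form_nonneg[of ?g] by simp
  show "2 *s \<beta> = ?a *s \<alpha>" if "?a\<^sup>2 * form \<alpha> \<alpha> = 4 * form \<beta> \<beta>"
    using g that form_pos[of ?g] by (cases "?g = 0") auto
qed

lemma pairing_coroot_products:
  assumes "\<alpha> \<in> roots" "\<beta> \<in> roots"
  defines "a \<equiv> pairing (coroot \<alpha>) \<beta>" and "b \<equiv> pairing (coroot \<beta>) \<alpha>"
  shows "a * b \<le> 4" and "a > 0 \<longleftrightarrow> b > 0" and "a = 2 \<Longrightarrow> b = 2 \<Longrightarrow> \<alpha> = \<beta>" and "a = 0 \<longleftrightarrow> b = 0"
proof -
  have pa: "form \<alpha> \<alpha> > 0" and pb: "form \<beta> \<beta> > 0" using assms form_root_pos by auto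
  have ab: "a * form \<alpha> \<alpha> = b * form \<beta> \<beta>"
    using pairing_coroot[OF assms(1), of \<beta>] pairing_coroot[OF assms(2), of \<alpha>] pa pb
    by (simp add: a_def b_def form_sym[of \<beta> \<alpha>])
  have aab: "a\<^sup>2 * form \<alpha> \<alpha> = a * b * form \<beta> \<beta>" using ab by (simp add: power2_eq_square mult.assoc)
  have "real_of_int (a * b) * form \<beta> \<beta> \<le> 4 * form \<beta> \<beta>"
    using form_cauchy_schwarz(1)[OF assms(1,2)] aab by (simp add: a_def)
  then have "real_of_int (a * b) \<le> 4" using pb by (simp only: mult_le_cancel_right)
  then show "a * b \<le> 4" by linarith
  have "real_of_int a * form \<alpha> \<alpha> > 0 \<longleftrightarrow> real_of_int b * form \<beta> \<beta> > 0" using ab by simp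
  then show "a > 0 \<longleftrightarrow> b > 0" using pa pb by (simp add: zero_less_mult_iff not_less[symmetric])
  show "a = 0 \<longleftrightarrow> b = 0" using ab pa pb by auto
  assume "a = 2" "b = 2"
  then have "2 *s \<beta> = 2 *s \<alpha>"
    using form_cauchy_schwarz(2)[OF assms(1,2)] aab by (simp add: a_def)
  then show "\<alpha> = \<beta>" by (simp add: vec_eq_iff)
qed

text \<open>The pairing and its transpose have the same sign and product at most 4. This is the
  origin of the margin 4 that one coroot costs in \<open>deep_add_coroot\<close>.\<close>

lemma pairing_coroot_bound:
  assumes "\<alpha> \<in> roots" "\<beta> \<in> roots" shows "pairing (coroot \<alpha>) \<beta> \<le> 4"
proof (cases "pairing (coroot \<alpha>) \<beta> > 0")
  case True
  let ?b = "pairing (coroot \<beta>) \<alpha>"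
  have "?b \<ge> 1" using True pairing_coroot_products(2)[OF assms] by simp
  then have "pairing (coroot \<alpha>) \<beta> * 1 \<le> pairing (coroot \<alpha>) \<beta> * ?b"
    using True by (intro mult_left_mono) auto
  then show ?thesis using pairing_coroot_products(1)[OF assms] by linarith
qed simp

text \<open>Roots have only finitely many norms, namely those of the simple roots. Cauchy-Schwarz
  against the simple coroots therefore bounds all their coordinates.\<close>

lemma finite_roots: "finite roots"
proof -
  define M where "M = \<lceil>\<Sum>i\<in>UNIV. \<Sum>j\<in>UNIV. 4 * symmetrizer i / symmetrizer j\<rceil>"
  have "\<bar>\<alpha> $ j\<bar> \<le> M" if \<alpha>: "\<alpha> \<in> roots" for \<alpha> j
  proof -
    obtain w i where w: "w \<in> weyl_group" "\<alpha> = w (simple_root i)" using rootE[OF \<alpha>] .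
    have "(\<alpha> $ j)\<^sup>2 * (2 * symmetrizer j) \<le> 4 * (2 * symmetrizer i)"
      using form_cauchy_schwarz(1)[OF simple_root_root \<alpha>, of j] w
      by (simp add: coroot_simple_root form_simple_simple form_weyl)
    then have "real_of_int ((\<alpha> $ j)\<^sup>2) \<le> 4 * symmetrizer i / symmetrizer j"
      using symmetrizer_pos[of j] by (simp add: field_simps)
    also have "\<dots> \<le> (\<Sum>j\<in>UNIV. 4 * symmetrizer i / symmetrizer j)"
      using symmetrizer_pos by (intro member_le_sum) (auto simp: less_imp_le)
    also have "\<dots> \<le> (\<Sum>i\<in>UNIV. \<Sum>j\<in>UNIV. 4 * symmetrizer i / symmetrizer j)"
      using symmetrizer_pos
      by (intro member_le_sum[of i UNIV "\<lambda>i. \<Sum>j\<in>UNIV. 4 * symmetrizer i / symmetrizer j"])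
        (auto simp: less_imp_le intro!: sum_nonneg)
    finally have "(\<alpha> $ j)\<^sup>2 \<le> M" by (simp add: M_def le_ceiling_iff)
    moreover have "\<bar>\<alpha> $ j\<bar> \<le> (\<alpha> $ j)\<^sup>2"
      using mult_left_mono[of 1 "\<bar>\<alpha> $ j\<bar>" "\<bar>\<alpha> $ j\<bar>"]
      by (cases "\<alpha> $ j = 0") (auto simp: power2_eq_square abs_mult[symmetric])
    ultimately show ?thesis by linarith
  qed
  then have "roots \<subseteq> {x. \<forall>j. \<bar>x $ j\<bar> \<le> M}" by blast
  then show ?thesis using finite_bounded_int_vectors finite_subset by blast
qed

lemma finite_positive_roots: "finite positive_roots"
  using finite_roots by (simp add: positive_roots_def)

lemma finite_weyl_group: "finite weyl_group"
proof -
  let ?f = "\<lambda>w :: 'i weyl. \<lambda>i. w (simple_root i)"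
  have "?f ` weyl_group \<subseteq> PiE UNIV (\<lambda>_. roots)" by (auto intro: rootI)
  then have "finite (?f ` weyl_group)"
    by (rule finite_subset) (intro finite_PiE, auto simp: finite_roots)
  moreover have "inj_on ?f weyl_group" by (rule inj_onI) (metis weyl_eqI)
  ultimately show ?thesis using finite_imageD by blast
qed

lemma weyl_word: "w \<in> weyl_group \<Longrightarrow> \<exists>ks. w = word_prod id (\<circ>) simple_reflection ks"
proof (induction rule: weyl_group.induct)
  case one
  then show ?case by (intro exI[of _ "[]"]) (simp add: word_prod_def)
next
  case (mult w i)
  then obtain ks where "w = word_prod id (\<circ>) simple_reflection ks" by blast
  then show ?case by (intro exI[of _ "i # ks"]) (simp only: word_prod_Cons)
qed

lemma word_reflection_system_weyl:
  "word_reflection_system weyl_group id (\<circ>) simple_reflection (\<lambda>w. w) roots positive_roots uminus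
     simple_root reflection"
proof
  show "reflection \<alpha> \<circ> reflection \<alpha> = id" if "\<alpha> \<in> roots" for \<alpha>
    using that by (auto simp: reflection_involution)
  show "w \<circ> reflection \<alpha> = reflection (w \<alpha>) \<circ> w" if "w \<in> weyl_group" "\<alpha> \<in> roots" for w \<alpha>
    using reflection_weyl that by simp
  show "finite {a \<in> positive_roots. x a \<notin> positive_roots}" for x
    using finite_positive_roots by simp
qed (auto simp: weyl_comp weyl_group.one weyl_simple fun_eq_iff simple_reflection_involution weyl_root
    positive_is_root root_minus uminus_positive_root_iff weyl_minus simple_root_positive
    simple_reflection_simple simple_reflection_positive reflection_in_weyl
    reflection_simple_root reflection_minus reflection_self)

lemma weyl_simple_positive_imp_id:
  assumes "w \<in> weyl_group" "\<And>i. w (simple_root i) \<in> positive_roots" shows "w = id"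
proof -
  interpret word_reflection_system weyl_group id "(\<circ>)" simple_reflection "\<lambda>w. w" roots positive_roots
    uminus simple_root reflection by (rule word_reflection_system_weyl)
  show ?thesis using weyl_word[OF assms(1)] word_simple_Pos_imp_e assms(2) by metis
qed

sublocale fin: reflection_system weyl_group id "(\<circ>)" simple_reflection "\<lambda>w. w" roots positive_roots
  uminus simple_root reflection
  by (rule reflection_system.intro[OF word_reflection_system_weyl reflection_system_axioms.intro])
    (rule weyl_simple_positive_imp_id)

lemma weyl_length_eq_card: "w \<in> weyl_group \<Longrightarrow> weyl_length w = card {\<alpha> \<in> positive_roots. w \<alpha> \<notin> positive_roots}"
  using fin.len_eq_card by (simp add: weyl_length_def fin.inversions_def)

lemma weyl_length_reflection_less_iff:
  "w \<in> weyl_group \<Longrightarrow> \<alpha> \<in> positive_roots \<Longrightarrow>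
    weyl_length (w \<circ> reflection \<alpha>) < weyl_length w \<longleftrightarrow> w \<alpha> \<notin> positive_roots"
  using fin.len_refl_less_iff by (simp add: weyl_length_def)

lemma weyl_not_id_descent:
  assumes "w \<in> weyl_group" "w \<noteq> id" obtains i where "w (simple_root i) \<notin> positive_roots"
  using weyl_simple_positive_imp_id assms by blast

lemma nonneg_combination:
  assumes "\<mu> \<in> nonneg_root_combinations"
  obtains c :: "'i \<Rightarrow> nat" where "\<mu> = (\<Sum>i\<in>UNIV. int (c i) *s simple_root i)"
  using assms by (auto simp: nonneg_root_combinations_def)

text \<open>A positive root is a nonempty sum of simple roots with multiplicities, so at least one
  term contributes the full bound and no term is positive.\<close>

lemma pairing_positive_root_le:
  assumes "\<alpha> \<in> positive_roots" "\<And>i. pairing x (simple_root i) \<le> - n" "n \<ge> 0"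
  shows "pairing x \<alpha> \<le> - n"
proof -
  obtain c where c: "\<alpha> = (\<Sum>i\<in>UNIV. int (c i) *s simple_root i)"
    using assms(1) nonneg_combination by (auto simp: positive_roots_def)
  have "\<exists>i. c i \<noteq> 0"
  proof (rule ccontr)
    assume "\<not> ?thesis"
    then have "\<alpha> = 0" using c by simp
    then show False using root_nonzero positive_is_root assms(1) by blast
  qed
  then obtain i where i: "c i \<noteq> 0" by blast
  have "pairing x \<alpha> = (\<Sum>j\<in>UNIV. int (c j) * pairing x (simple_root j))"
    by (simp add: c pairing_sum_right pairing_scale_right)
  also have "\<dots> \<le> (\<Sum>j\<in>UNIV. if j = i then - n else 0)"
  proof (rule sum_mono)
    fix j
    have "int (c j) * pairing x (simple_root j) \<le> int (c j) * (- n)"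
      using assms(2) by (intro mult_left_mono) auto
    also have "\<dots> \<le> (if j = i then 1 else 0) * (- n)"
      using i assms(3) by (intro mult_right_mono_neg) auto
    finally show "int (c j) * pairing x (simple_root j) \<le> (if j = i then - n else 0)"
      by (simp split: if_splits)
  qed
  finally show ?thesis by simp
qed

lemma antidominant_pairing: "antidominant x \<Longrightarrow> \<alpha> \<in> positive_roots \<Longrightarrow> pairing x \<alpha> \<le> 0"
  using pairing_positive_root_le[of \<alpha> x 0] by (simp add: antidominant_def)

lemma coroot_nonneg:
  assumes "\<alpha> \<in> positive_roots" shows "coroot \<alpha> $ k \<ge> 0"
proof -
  obtain w i where w: "w \<in> weyl_group" "\<alpha> = w (simple_root i)"
    using rootE[OF positive_is_root[OF assms]] .
  have "symmetrizer i * coroot \<alpha> $ k \<ge> 0"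
    using coroot_nth[OF w(1), of i k] w assms positive_root_iff[OF positive_is_root[OF assms]]
      symmetrizer_pos[of k] by simp
  then show ?thesis using symmetrizer_pos[of i] by (simp add: zero_le_mult_iff)
qed

text \<open>Each simple reflection permutes the positive roots other than its own and negates that
  one. It thus lowers the sum by two simple roots, which forces every coordinate to be 2.\<close>

lemma sum_positive_roots: "\<Sum>positive_roots = 2 *s rho"
proof -
  have "(\<Sum>positive_roots) $ i = 2" for i
  proof -
    let ?P = "positive_roots - {simple_root i}"
    have s: "\<Sum>positive_roots = simple_root i + \<Sum>?P"
      using finite_positive_roots simple_root_positive by (rule sum.remove)
    have "bij_betw (simple_reflection i) ?P ?P"
    proof (rule bij_betw_byWitness[where f' = "simple_reflection i"])
      have "simple_reflection i \<alpha> \<in> ?P" if "\<alpha> \<in> ?P" for \<alpha>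
      proof -
        have "simple_reflection i \<alpha> \<noteq> simple_root i"
        proof
          assume "simple_reflection i \<alpha> = simple_root i"
          then have "\<alpha> = - simple_root i"
            using simple_reflection_involution[of i \<alpha>] simple_reflection_simple[of i] by metis
          then show False
            using that uminus_positive_root_iff[OF simple_root_root] simple_root_positive by blast
        qed
        then show ?thesis using that simple_reflection_positive by auto
      qed
      then show sub: "simple_reflection i ` ?P \<subseteq> ?P" by (rule image_subsetI)
      show "simple_reflection i ` ?P \<subseteq> ?P" by (rule sub)
    qed (simp_all add: simple_reflection_involution)
    then have "simple_reflection i (\<Sum>?P) = \<Sum>?P"
      unfolding weyl_sum[OF weyl_simple] by (rule sum.reindex_bij_betw)
    then have "simple_reflection i (\<Sum>positive_roots) = \<Sum>positive_roots - 2 *s simple_root i"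
      unfolding s weyl_add[OF weyl_simple] by (simp add: simple_reflection_simple vec_eq_iff)
    then have "(\<Sum>positive_roots) $ i *s simple_root i = 2 *s simple_root i"
      by (simp add: simple_reflection_eq)
    then have "(\<Sum>positive_roots) $ i * simple_root i $ i = 2 * simple_root i $ i"
      by (metis vector_smult_component)
    then show ?thesis by (simp add: simple_root_nth diagonal)
  qed
  then show ?thesis by (simp add: vec_eq_iff rho_def fundamental_weight_def axis_def)
qed

subsection \<open>The highest root\<close>

definition height :: "'i weight \<Rightarrow> real" where
  "height \<mu> = (\<Sum>j\<in>UNIV. root_coords \<mu> $ j)"

lemma height_diff: "height (\<mu> - \<nu>) = height \<mu> - height \<nu>"
  by (simp add: height_def root_coords_diff sum_subtractf)

lemma height_minus: "height (- \<mu>) = - height \<mu>"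
  by (simp add: height_def root_coords_minus sum_negf)

lemma height_simple_reflection: "height (simple_reflection i \<mu>) = height \<mu> - \<mu> $ i"
  by (simp add: simple_reflection_eq height_diff)
    (simp add: height_def root_coords_scale root_coords_simple_root axis_def mult_delta_right cong: if_cong)

lemma height_positive: "\<alpha> \<in> positive_roots \<Longrightarrow> height \<alpha> > 0"
proof -
  assume a: "\<alpha> \<in> positive_roots"
  have ge: "root_coords \<alpha> $ j \<ge> 0" for j using positive_root_iff[OF positive_is_root[OF a]] a by simp
  have "root_coords \<alpha> \<noteq> root_coords 0"
    using root_coords_eqI[of \<alpha> 0] root_nonzero[OF positive_is_root[OF a]] by blast
  then obtain j where "root_coords \<alpha> $ j \<noteq> 0" by (auto simp: vec_eq_iff)
  then show ?thesis unfolding height_def using ge by (intro sum_pos2[of _ j]) (auto simp: less_le)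
qed

text \<open>The point where indecomposability enters. If some coordinates vanished, a node outside
  the support would be joined to the support, and the weight coordinate there would be negative
  because only off-diagonal Cartan entries contribute.\<close>

lemma dominant_full_support:
  assumes "\<alpha> \<in> positive_roots" "\<And>i. \<alpha> $ i \<ge> 0" shows "root_coords \<alpha> $ j > 0"
proof (rule ccontr)
  assume not: "\<not> ?thesis"
  have ge: "root_coords \<alpha> $ j \<ge> 0" for j
    using positive_root_iff[OF positive_is_root[OF assms(1)]] assms(1) by simp
  define J where "J = {j. root_coords \<alpha> $ j = 0}"
  have "j \<in> J" using not ge[of j] by (simp add: J_def)
  moreover have "J \<noteq> UNIV"
  proof
    assume "J = UNIV"
    then have "root_coords \<alpha> = root_coords 0" by (auto simp: J_def vec_eq_iff)
    then show False using root_coords_eqI root_nonzero[OF positive_is_root[OF assms(1)]] by blast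
  qed
  ultimately obtain i k where ik: "i \<in> J" "k \<in> - J" "C i k \<noteq> 0" using indecomposable[of J] by auto
  have le0: "C i l * root_coords \<alpha> $ l \<le> 0" for l
  proof (cases "l = i")
    case True
    then show ?thesis using ik by (simp add: J_def)
  next
    case False
    then show ?thesis using off_diagonal[of i l] ge[of l] by (simp add: mult_nonpos_nonneg)
  qed
  have "C i k < 0" using ik off_diagonal[of i k] by (cases "i = k") auto
  then have "C i k * root_coords \<alpha> $ k < 0"
    using ik(2) ge[of k] by (intro mult_neg_pos) (auto simp: J_def less_le)
  then have "(\<Sum>l\<in>UNIV. C i l * root_coords \<alpha> $ l) < (\<Sum>l\<in>(UNIV::'i set). 0)"
    using le0 by (intro sum_strict_mono_ex1) auto
  then have "real_of_int (\<alpha> $ i) < 0" by (simp add: weight_nth)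
  then show False using assms(2)[of i] by simp
qed

lemma nonneg_trans:
  assumes "\<alpha> - \<beta> \<in> nonneg_root_combinations" "\<beta> - \<gamma> \<in> nonneg_root_combinations"
  shows "\<alpha> - \<gamma> \<in> nonneg_root_combinations"
proof -
  obtain c d where "\<alpha> - \<beta> = (\<Sum>i\<in>UNIV. int (c i) *s simple_root i)"
    "\<beta> - \<gamma> = (\<Sum>i\<in>UNIV. int (d i) *s simple_root i)"
    using assms nonneg_combination by metis
  then have "(\<alpha> - \<beta>) + (\<beta> - \<gamma>) = (\<Sum>i\<in>UNIV. int (c i + d i) *s simple_root i)"
    by (simp only: of_nat_add vector_sadd_rdistrib sum.distrib)
  then have "\<alpha> - \<gamma> = (\<Sum>i\<in>UNIV. int (c i + d i) *s simple_root i)" by simp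
  then show ?thesis unfolding nonneg_root_combinations_def
    by (intro CollectI exI[of _ "\<lambda>i. c i + d i"]) simp
qed

lemma nonneg_simple_multiple: "k \<ge> 0 \<Longrightarrow> k *s simple_root i \<in> nonneg_root_combinations"
proof -
  assume k: "k \<ge> 0"
  have "k *s simple_root i = (\<Sum>j\<in>UNIV. int (if j = i then nat k else 0) *s simple_root j)"
    using k by (simp add: vec_eq_iff if_distrib[of int] mult_delta_left cong: if_cong)
  then show ?thesis unfolding nonneg_root_combinations_def
    by (intro CollectI exI[of _ "\<lambda>j. if j = i then nat k else 0"]) simp
qed

lemma nonneg_zero: "0 \<in> nonneg_root_combinations"
  using nonneg_simple_multiple[of 0 undefined] by simp

lemma maximal_dominant:
  assumes \<beta>: "\<beta> \<in> roots" "\<beta> - \<alpha> \<in> nonneg_root_combinations"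
    and max: "\<And>\<gamma>. \<gamma> \<in> roots \<Longrightarrow> \<gamma> - \<alpha> \<in> nonneg_root_combinations \<Longrightarrow> height \<gamma> \<le> height \<beta>"
  shows "\<beta> $ i \<ge> 0"
proof (rule ccontr)
  assume neg: "\<not> ?thesis"
  let ?g = "simple_reflection i \<beta>"
  have "?g - \<beta> = (- \<beta> $ i) *s simple_root i" by (simp add: simple_reflection_eq vec_eq_iff)
  then have "?g - \<beta> \<in> nonneg_root_combinations" using neg nonneg_simple_multiple[of "- \<beta> $ i"] by simp
  then have "?g - \<alpha> \<in> nonneg_root_combinations" using \<beta>(2) nonneg_trans by blast
  then have "height ?g \<le> height \<beta>" using max[OF weyl_root[OF weyl_simple \<beta>(1)]] by blast
  then show False using neg by (simp add: height_simple_reflection)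
qed

lemma maximal_height:
  assumes "finite X" "X \<noteq> {}" obtains x where "x \<in> X" "\<And>y. y \<in> X \<Longrightarrow> height y \<le> height x"
proof -
  have "Max (height ` X) \<in> height ` X" using assms by (intro Max_in) auto
  then obtain x where "x \<in> X" "height x = Max (height ` X)" by auto
  then show ?thesis using that assms(1) by simp
qed

text \<open>Let \<theta> have maximal height, and let \<beta> have maximal height among the roots
  above \<alpha>. Both are dominant, and \<theta> has full support, so their scalar product is
  positive. Unless they coincide, their difference is then a root, which contradicts one of the two
  maximalities.\<close>

lemma highest_root_exists: "\<exists>\<theta>. \<theta> \<in> roots \<and> (\<forall>\<alpha>\<in>roots. \<theta> - \<alpha> \<in> nonneg_root_combinations)"
proof -
  have ne: "roots \<noteq> {}" using simple_root_root by blast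
  obtain \<theta> where \<theta>: "\<theta> \<in> roots" and \<theta>max: "\<And>\<alpha>. \<alpha> \<in> roots \<Longrightarrow> height \<alpha> \<le> height \<theta>"
    using maximal_height[OF finite_roots ne] by blast
  have dom: "\<theta> $ i \<ge> 0" for i
    by (rule maximal_dominant[OF \<theta>, of \<theta>]) (use \<theta>max nonneg_zero in auto)
  have "height \<theta> \<ge> height (- \<theta>)" using \<theta>max root_minus[OF \<theta>] by blast
  then have \<theta>pos: "\<theta> \<in> positive_roots"
    using uminus_positive_root_iff[OF \<theta>] height_positive[of "- \<theta>"] by (auto simp: height_minus)
  have "\<theta> - \<alpha> \<in> nonneg_root_combinations" if \<alpha>: "\<alpha> \<in> roots" for \<alpha>
  proof -
    define X where "X = {\<beta> \<in> roots. \<beta> - \<alpha> \<in> nonneg_root_combinations}"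
    have "finite X" "X \<noteq> {}" using finite_roots \<alpha> nonneg_zero by (auto simp: X_def)
    then obtain \<beta> where \<beta>: "\<beta> \<in> X" and \<beta>max: "\<And>\<gamma>. \<gamma> \<in> X \<Longrightarrow> height \<gamma> \<le> height \<beta>"
      using maximal_height[of X] by blast
    have \<beta>r: "\<beta> \<in> roots" and \<beta>\<alpha>: "\<beta> - \<alpha> \<in> nonneg_root_combinations" using \<beta> by (auto simp: X_def)
    have \<beta>dom: "\<beta> $ i \<ge> 0" for i
      by (rule maximal_dominant[OF \<beta>r \<beta>\<alpha>]) (use \<beta>max in \<open>auto simp: X_def\<close>)
    obtain k where k: "\<beta> $ k \<noteq> 0" using root_nonzero[OF \<beta>r] by (auto simp: vec_eq_iff)
    have "form \<theta> \<beta> > 0" unfolding form_def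
      using dominant_full_support[OF \<theta>pos dom] symmetrizer_pos \<beta>dom k
      by (intro sum_pos2[of _ k]) (auto simp: less_le[of 0 "\<beta> $ k"] less_imp_le)
    then have a: "pairing (coroot \<theta>) \<beta> > 0"
      using pairing_coroot[OF \<theta>, of \<beta>] form_root_pos[OF \<theta>] by (metis of_int_0_less_iff zero_less_divide_iff zero_less_mult_iff zero_less_numeral)
    then have b: "pairing (coroot \<beta>) \<theta> > 0" using pairing_coroot_products(2)[OF \<theta> \<beta>r] by blast
    \<comment> \<open>Either sign of this root is impossible: a positive one makes \<beta> higher
      than \<theta>, a negative one puts \<theta> among the candidates above \<alpha> and higher
      than \<beta>.\<close>
    have bound: "\<beta> = \<theta>" if d: "\<beta> - \<theta> \<in> roots"
    proof (cases "\<beta> - \<theta> \<in> positive_roots")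
      case True
      then show ?thesis using height_positive[OF True] \<theta>max[OF \<beta>r] by (simp add: height_diff)
    next
      case False
      then have p: "\<theta> - \<beta> \<in> positive_roots" using uminus_positive_root_iff[OF d] by simp
      then have "\<theta> - \<alpha> \<in> nonneg_root_combinations"
        using nonneg_trans \<beta>\<alpha> by (auto simp: positive_roots_def)
      then have "\<theta> \<in> X" using \<theta> by (simp add: X_def)
      then show ?thesis using \<beta>max height_positive[OF p] by (fastforce simp: height_diff)
    qed
    \<comment> \<open>Two positive integers with product at most 4 either include a 1, when a
      reflection yields the difference as a root, or are both 2, the equality case of
      Cauchy-Schwarz.\<close>
    have "\<beta> = \<theta>"
    proof (cases "pairing (coroot \<theta>) \<beta> = 1 \<or> pairing (coroot \<beta>) \<theta> = 1")
      case True
      then show ?thesis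
      proof
        assume "pairing (coroot \<theta>) \<beta> = 1"
        then have "reflection \<theta> \<beta> = \<beta> - \<theta>" by (simp add: reflection_def)
        then show ?thesis using bound weyl_root[OF reflection_in_weyl[OF \<theta>] \<beta>r] by simp
      next
        assume "pairing (coroot \<beta>) \<theta> = 1"
        then have "reflection \<beta> \<theta> = \<theta> - \<beta>" by (simp add: reflection_def)
        then have "\<theta> - \<beta> \<in> roots" using weyl_root[OF reflection_in_weyl[OF \<beta>r] \<theta>] by simp
        then show ?thesis using bound root_minus[of "\<theta> - \<beta>"] by simp
      qed
    next
      case False
      then have ge: "pairing (coroot \<theta>) \<beta> \<ge> 2" "pairing (coroot \<beta>) \<theta> \<ge> 2" using a b by auto
      have le: "pairing (coroot \<theta>) \<beta> * pairing (coroot \<beta>) \<theta> \<le> 4"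
        using pairing_coroot_products(1)[OF \<theta> \<beta>r] by blast
      have "pairing (coroot \<theta>) \<beta> = 2" "pairing (coroot \<beta>) \<theta> = 2"
        using ge le mult_left_mono[OF ge(2), of "pairing (coroot \<theta>) \<beta>"]
          mult_right_mono[OF ge(1), of "pairing (coroot \<beta>) \<theta>"] by linarith+
      then show ?thesis using pairing_coroot_products(3)[OF \<theta> \<beta>r] by simp
    qed
    then show ?thesis using \<beta>\<alpha> by simp
  qed
  then show ?thesis using \<theta> by blast
qed

lemma
  shows highest_root_root: "highest_root \<in> roots"
    and highest_root_ge: "\<alpha> \<in> roots \<Longrightarrow> highest_root - \<alpha> \<in> nonneg_root_combinations"
proof -
  let ?Q = "\<lambda>\<theta>. \<theta> \<in> roots \<and> (\<forall>\<alpha>\<in>roots. \<theta> - \<alpha> \<in> nonneg_root_combinations)"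
  have "\<theta> = \<theta>'" if "?Q \<theta>" "?Q \<theta>'" for \<theta> \<theta>'
  proof -
    have 1: "\<theta> - \<theta>' \<in> nonneg_root_combinations" "\<theta>' - \<theta> \<in> nonneg_root_combinations" using that by auto
    have "root_coords \<theta> $ j = root_coords \<theta>' $ j" for j
      using 1 nonneg_iff[OF nonneg_in_lattice[OF 1(1)]] nonneg_iff[OF nonneg_in_lattice[OF 1(2)]]
      by (simp add: root_coords_diff order_antisym)
    then show ?thesis by (intro root_coords_eqI) (simp add: vec_eq_iff)
  qed
  then have "\<exists>!\<theta>. ?Q \<theta>" using highest_root_exists by metis
  then have "?Q highest_root" unfolding highest_root_def by (rule theI')
  then show "highest_root \<in> roots" "\<alpha> \<in> roots \<Longrightarrow> highest_root - \<alpha> \<in> nonneg_root_combinations" by auto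
qed

lemma root_coords_le_highest: "\<alpha> \<in> roots \<Longrightarrow> root_coords \<alpha> $ j \<le> root_coords highest_root $ j"
  using highest_root_ge[of \<alpha>] nonneg_iff[OF nonneg_in_lattice[OF highest_root_ge[of \<alpha>]]]
  by (simp add: root_coords_diff)

lemma highest_root_positive: "highest_root \<in> positive_roots"
proof -
  have "root_coords highest_root $ j \<ge> 0" for j
    using root_coords_le_highest[OF root_minus[OF highest_root_root], of j] by (simp add: root_coords_minus)
  then show ?thesis using positive_root_iff[OF highest_root_root] by blast
qed

text \<open>Otherwise reflecting \<theta> in \<alpha> would add a positive multiple of \<alpha> and
  produce a root that is not below \<theta>.\<close>

lemma pairing_highest_coroot_nonneg:
  assumes "\<alpha> \<in> positive_roots" shows "pairing (coroot highest_root) \<alpha> \<ge> 0"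
proof (rule ccontr)
  let ?\<theta> = highest_root
  assume neg: "\<not> ?thesis"
  have \<alpha>: "\<alpha> \<in> roots" using assms positive_is_root by blast
  have b: "pairing (coroot \<alpha>) ?\<theta> < 0"
    using neg pairing_coroot_products(2,4)[OF highest_root_root \<alpha>] by linarith
  have "\<exists>j. root_coords \<alpha> $ j > 0"
  proof (rule ccontr)
    assume "\<not> ?thesis"
    then have "height \<alpha> \<le> 0" unfolding height_def by (intro sum_nonpos) (auto simp: not_less)
    then show False using height_positive[OF assms] by simp
  qed
  then obtain j where j: "root_coords \<alpha> $ j > 0" by blast
  have "root_coords (reflection \<alpha> ?\<theta>) $ j \<le> root_coords ?\<theta> $ j"
    using root_coords_le_highest[OF weyl_root[OF reflection_in_weyl[OF \<alpha>] highest_root_root]] .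
  then have "pairing (coroot \<alpha>) ?\<theta> * root_coords \<alpha> $ j \<ge> 0"
    by (simp add: reflection_def root_coords_diff root_coords_scale)
  then show False using b j by (simp add: zero_le_mult_iff)
qed

text \<open>With a pairing of at least 2, the negative of the reflected root lies above 2\<theta> -
  \<alpha>. It is still below \<theta>, and so is \<alpha>; this forces \<alpha> = \<theta>.\<close>

lemma pairing_highest_coroot_le_1:
  assumes "\<alpha> \<in> roots" "\<alpha> \<noteq> highest_root" shows "pairing (coroot highest_root) \<alpha> \<le> 1"
proof (rule ccontr)
  let ?\<theta> = highest_root
  let ?k = "pairing (coroot ?\<theta>) \<alpha>"
  assume k: "\<not> ?thesis"
  have "- reflection ?\<theta> \<alpha> \<in> roots"
    using root_minus[OF weyl_root[OF reflection_in_weyl[OF highest_root_root] assms(1)]] .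
  then have 1: "?k * root_coords ?\<theta> $ j - root_coords \<alpha> $ j \<le> root_coords ?\<theta> $ j" for j
    using root_coords_le_highest[of "- reflection ?\<theta> \<alpha>" j]
    by (simp add: reflection_def root_coords_diff root_coords_scale root_coords_minus)
  have "root_coords \<alpha> $ j = root_coords ?\<theta> $ j" for j
  proof -
    have "root_coords ?\<theta> $ j \<ge> 0"
      using highest_root_positive positive_root_iff[OF highest_root_root] by blast
    then have "2 * root_coords ?\<theta> $ j \<le> ?k * root_coords ?\<theta> $ j" using k by (intro mult_right_mono) auto
    then show ?thesis using 1[of j] root_coords_le_highest[OF assms(1), of j] by linarith
  qed
  then have "\<alpha> = ?\<theta>" by (intro root_coords_eqI) (simp add: vec_eq_iff)
  then show False using assms(2) by blast
qed

end


section \<open>The affine Weyl group\<close>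

context root_datum
begin

text \<open>The pair \<open>(\<alpha>, n)\<close> stands for the real affine root \<open>\<alpha> + n\<delta>\<close>.\<close>

definition affine_action :: "'i waf \<Rightarrow> 'i weight \<times> int \<Rightarrow> 'i weight \<times> int" where
  "affine_action x a = (fst x (fst a), snd a - pairing (snd x) (fst a))"

definition affine_roots :: "('i weight \<times> int) set" where
  "affine_roots = roots \<times> UNIV"

definition positive_affine_roots :: "('i weight \<times> int) set" where
  "positive_affine_roots = {(\<alpha>, n). \<alpha> \<in> roots \<and> (n > 0 \<or> n = 0 \<and> \<alpha> \<in> positive_roots)}"

definition affine_simple_root :: "'i option \<Rightarrow> 'i weight \<times> int" where
  "affine_simple_root k = (case k of Some i \<Rightarrow> (simple_root i, 0) | None \<Rightarrow> (- highest_root, 1))"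

definition root_reflection :: "'i weight \<times> int \<Rightarrow> 'i waf" where
  "root_reflection a = affine_reflection (fst a) (snd a)"

lemma waf_closed: "x \<in> affine_weyl_group \<longleftrightarrow> fst x \<in> weyl_group"
  by (cases x) (simp add: affine_weyl_group_def)

lemma pairing_act_inv: "w \<in> weyl_group \<Longrightarrow> pairing (act_coweight (inv w) x) \<mu> = pairing x (w \<mu>)"
  by (simp add: pairing_act_coweight weyl_inv weyl_inv_inv)

lemma waf_mult_assoc:
  "x \<in> affine_weyl_group \<Longrightarrow> y \<in> affine_weyl_group \<Longrightarrow> z \<in> affine_weyl_group \<Longrightarrow>
    waf_mult (waf_mult x y) z = waf_mult x (waf_mult y z)"
  by (simp add: waf_mult_def waf_closed comp_assoc weyl_inv_comp act_coweight_comp act_coweight_add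
      weyl_inv add.assoc)

lemma neg_affine_root_iff:
  "\<alpha> \<in> roots \<Longrightarrow> (- \<alpha>, - n) \<in> positive_affine_roots \<longleftrightarrow> (\<alpha>, n) \<notin> positive_affine_roots"
  by (auto simp: positive_affine_roots_def root_minus uminus_positive_root_iff)

text \<open>For the node 0 the reflection shifts the \<delta>-coefficient by \<open>p\<close>, the
  pairing of the highest coroot with \<alpha>. Away from \<theta> and -\<theta> this is -1, 0 or 1.
  So only a resulting coefficient 0 needs care, where the finite part must turn out
  positive.\<close>

lemma affine_simple_reflection_positive:
  assumes "a \<in> positive_affine_roots" "a \<noteq> affine_simple_root k"
  shows "affine_action (affine_generator k) a \<in> positive_affine_roots"
proof (cases k)
  case (Some i)
  obtain \<alpha> n where a: "a = (\<alpha>, n)" by (cases a)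
  have "\<alpha> \<in> roots" "n > 0 \<or> n = 0 \<and> \<alpha> \<in> positive_roots"
    using assms(1) a by (auto simp: positive_affine_roots_def)
  then show ?thesis
    using assms(2) Some a weyl_root[OF weyl_simple] simple_reflection_positive[of \<alpha> i]
    by (auto simp: positive_affine_roots_def affine_action_def affine_generator_def affine_simple_root_def)
next
  case None
  let ?\<theta> = highest_root
  obtain \<alpha> n where a: "a = (\<alpha>, n)" by (cases a)
  have r: "\<alpha> \<in> roots" and n: "n > 0 \<or> n = 0 \<and> \<alpha> \<in> positive_roots"
    using assms(1) a by (auto simp: positive_affine_roots_def)
  define p where "p = pairing (coroot ?\<theta>) \<alpha>"
  have r': "reflection ?\<theta> \<alpha> \<in> roots" using weyl_root[OF reflection_in_weyl[OF highest_root_root] r] .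
  have act: "affine_action (affine_generator k) a = (reflection ?\<theta> \<alpha>, n + p)"
    by (simp add: a None affine_action_def affine_generator_def pairing_minus_left p_def)
  have refl: "reflection ?\<theta> \<alpha> = \<alpha> - p *s ?\<theta>" by (simp add: reflection_def p_def)
  consider "\<alpha> = ?\<theta>" | "- \<alpha> = ?\<theta>" | "\<alpha> \<noteq> ?\<theta>" "- \<alpha> \<noteq> ?\<theta>" by blast
  then show ?thesis
  proof cases
    case 1
    then have "p = 2" by (simp add: p_def pairing_coroot_self highest_root_root)
    then show ?thesis unfolding act using r' n by (auto simp: positive_affine_roots_def)
  next
    case 2
    then have 2: "\<alpha> = - ?\<theta>" by (metis minus_minus)
    then have p: "p = - 2" by (simp add: p_def pairing_coroot_self highest_root_root pairing_minus_right)
    have "n > 0" using n 2 uminus_positive_root_iff[OF highest_root_root] highest_root_positive by auto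
    moreover have "n \<noteq> 1" using assms(2) a None 2 by (simp add: affine_simple_root_def)
    moreover have "reflection ?\<theta> \<alpha> = ?\<theta>" by (subst refl) (simp add: p 2 vec_eq_iff)
    ultimately show ?thesis unfolding act using r' p highest_root_positive
      by (auto simp: positive_affine_roots_def)
  next
    case 3
    have p: "p \<le> 1" "p \<ge> - 1"
      using pairing_highest_coroot_le_1[OF r 3(1)] pairing_highest_coroot_le_1[OF root_minus[OF r] 3(2)]
      by (auto simp: p_def pairing_minus_right)
    show ?thesis
    proof (cases "n + p > 0")
      case True
      then show ?thesis unfolding act using r' by (simp add: positive_affine_roots_def)
    next
      case False
      have "p \<ge> 0" if "n = 0"
        using that n pairing_highest_coroot_nonneg by (auto simp: p_def)
      then have z: "n + p = 0" and *: "p = 0 \<and> n = 0 \<or> p = - 1" using False p n by linarith+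
      have "reflection ?\<theta> \<alpha> \<in> positive_roots" using *
      proof
        assume "p = 0 \<and> n = 0"
        then show ?thesis using n refl by simp
      next
        assume "p = - 1"
        then have e: "reflection ?\<theta> \<alpha> = \<alpha> + ?\<theta>" unfolding refl by (simp add: vec_eq_iff)
        have "root_coords (\<alpha> + ?\<theta>) $ j \<ge> 0" for j
          using root_coords_le_highest[OF root_minus[OF r], of j]
          by (simp add: root_coords_add root_coords_minus)
        then show ?thesis using positive_root_iff[OF r'] e by simp
      qed
      then show ?thesis unfolding act using r' z by (simp add: positive_affine_roots_def)
    qed
  qed
qed

lemma finite_affine_inversions:
  "finite {a \<in> positive_affine_roots. affine_action x a \<notin> positive_affine_roots}"
  if "x \<in> affine_weyl_group"
proof (rule finite_subset)
  show "{a \<in> positive_affine_roots. affine_action x a \<notin> positive_affine_roots} \<subseteq>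
      Sigma roots (\<lambda>\<alpha>. {0..pairing (snd x) \<alpha>})"
    using that weyl_root
    by (auto simp: positive_affine_roots_def affine_action_def waf_closed not_less)
  show "finite (Sigma roots (\<lambda>\<alpha>. {0..pairing (snd x) \<alpha>}))"
    using finite_roots by (intro finite_SigmaI) auto
qed

section \<open>Trivial stabilizer of the fundamental alcove\<close>

lemma pairing_simple_root: "pairing x (simple_root j) = (\<Sum>k\<in>UNIV. x $ k * C k j)"
  by (simp add: pairing_def simple_root_nth)

text \<open>Positive definiteness transferred to coweights: the products in question, weighted by
  inverse symmetrizers, have a positive sum.\<close>

lemma coweight_positive_coordinate:
  assumes "x \<noteq> 0" shows "\<exists>j. x $ j * pairing x (simple_root j) > 0"
proof (rule ccontr)
  assume not: "\<not> ?thesis"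
  obtain i where i: "x $ i \<noteq> 0" using assms by (auto simp: vec_eq_iff)
  \<comment> \<open>A simple coroot is the simple root divided by its symmetrizer, so these are the
    coordinates of \<open>x\<close> with respect to simple roots.\<close>
  let ?y = "\<lambda>j. x $ j / symmetrizer j"
  have "0 < (\<Sum>j\<in>UNIV. \<Sum>k\<in>UNIV. symmetrizer j * C j k * ?y j * ?y k)"
    using i symmetrizer_pos[of i] by (intro symmetrizer_posdef[of _ i]) simp
  also have "\<dots> = (\<Sum>k\<in>UNIV. \<Sum>j\<in>UNIV. symmetrizer j * C j k * ?y j * ?y k)" by (rule sum.swap)
  also have "\<dots> = (\<Sum>k\<in>UNIV. (x $ k * pairing x (simple_root k)) / symmetrizer k)"
    using symmetrizer_pos
    by (simp add: pairing_simple_root sum_distrib_left sum_divide_distrib less_imp_neq[symmetric] algebra_simps)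
  also have "\<dots> \<le> 0"
  proof (rule sum_nonpos)
    fix k
    have "x $ k * pairing x (simple_root k) \<le> 0" using not by (simp add: not_less)
    then have "real_of_int (x $ k * pairing x (simple_root k)) \<le> 0" by linarith
    then show "real_of_int (x $ k * pairing x (simple_root k)) / symmetrizer k \<le> 0"
      using symmetrizer_pos[of k] by (simp add: divide_le_0_iff)
  qed
  finally show False by simp
qed

text \<open>Reflecting in a simple root with \<open>x\<^sub>j\<langle>x, \<alpha>\<^sub>j\<rangle> > 0\<close> decreases \<open>\<Sum>\<bar>x\<^sub>j\<bar>\<close>.  So the coroot lattice contains
  no nonzero minuscule coweight.\<close>

lemma no_minuscule_coweight:
  assumes "\<And>\<alpha>. \<alpha> \<in> roots \<Longrightarrow> \<bar>pairing x \<alpha>\<bar> \<le> 1" shows "x = 0"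
  using assms
proof (induction "nat (\<Sum>j\<in>UNIV. \<bar>x $ j\<bar>)" arbitrary: x rule: less_induct)
  case less
  show ?case
  proof (rule ccontr)
    assume "x \<noteq> 0"
    then obtain j where j: "x $ j * pairing x (simple_root j) > 0" using coweight_positive_coordinate by blast
    let ?p = "pairing x (simple_root j)"
    let ?y = "act_coweight (simple_reflection j) x"
    have y: "?y = x - ?p *s simple_coroot j"
      using act_coweight_reflection[OF simple_root_root, of j x]
      by (simp add: reflection_simple_root coroot_simple_root)
    have "\<bar>?p\<bar> \<le> 1" using less.prems simple_root_root by blast
    moreover have "?p \<noteq> 0" "x $ j \<noteq> 0" using j by auto
    ultimately have p: "?p = 1 \<and> x $ j > 0 \<or> ?p = - 1 \<and> x $ j < 0" using j by (auto simp: zero_less_mult_iff)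
    have "(\<Sum>k\<in>UNIV. \<bar>?y $ k\<bar>) < (\<Sum>k\<in>UNIV. \<bar>x $ k\<bar>)"
    proof (rule sum_strict_mono_ex1)
      show "\<forall>k\<in>UNIV. \<bar>?y $ k\<bar> \<le> \<bar>x $ k\<bar>"
        using p by (auto simp: y simple_coroot_def axis_def)
      show "\<exists>k\<in>UNIV. \<bar>?y $ k\<bar> < \<bar>x $ k\<bar>"
        using p by (intro bexI[of _ j]) (auto simp: y simple_coroot_def axis_def)
    qed simp
    moreover have "0 \<le> (\<Sum>k\<in>UNIV. \<bar>?y $ k\<bar>)" by (intro sum_nonneg) simp
    ultimately have "nat (\<Sum>k\<in>UNIV. \<bar>?y $ k\<bar>) < nat (\<Sum>k\<in>UNIV. \<bar>x $ k\<bar>)" by linarith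
    moreover have "\<bar>pairing ?y \<alpha>\<bar> \<le> 1" if "\<alpha> \<in> roots" for \<alpha>
      using less.prems[OF weyl_root[OF weyl_inv[OF weyl_simple] that]]
      by (simp add: pairing_act_coweight weyl_simple)
    ultimately have "?y = 0" using less.hyps by blast
    moreover have "x = act_coweight (inv (simple_reflection j)) ?y" by (simp add: weyl_simple)
    ultimately have "x = 0"
      using act_coweight_scale[OF weyl_inv[OF weyl_simple[of j]], of 0 0] by simp
    then show False using \<open>x \<noteq> 0\<close> by blast
  qed
qed

text \<open>Positivity on the affine simple roots confines the pairings of the translation part with
  positive roots to -1 and 0. Such a coweight is minuscule, hence zero because translations come
  from the coroot lattice. What remains is the corresponding fact for the finite group.\<close>

lemma affine_simple_positive_imp_one:
  assumes "x \<in> affine_weyl_group"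
    "\<And>k. affine_action x (affine_simple_root k) \<in> positive_affine_roots"
  shows "x = waf_one"
proof -
  obtain w l where x: "x = (w, l)" by (cases x)
  then have w: "w \<in> weyl_group" using assms(1) by (simp add: waf_closed)
  have simple: "pairing l (simple_root i) < 0 \<or> pairing l (simple_root i) = 0 \<and> w (simple_root i) \<in> positive_roots" for i
    using assms(2)[of "Some i"] x
    by (auto simp: affine_action_def affine_simple_root_def positive_affine_roots_def)
  then have le: "pairing l \<alpha> \<le> 0" if "\<alpha> \<in> positive_roots" for \<alpha>
    using simple by (intro antidominant_pairing that) (metis antidominant_def order_le_less)
  have hi: "pairing l highest_root \<ge> - 1"
    using assms(2)[of None] x
    by (auto simp: affine_action_def affine_simple_root_def positive_affine_roots_def pairing_minus_right)
  have ge: "pairing l \<alpha> \<ge> - 1" if \<alpha>: "\<alpha> \<in> positive_roots" for \<alpha>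
  proof -
    obtain c where "highest_root - \<alpha> = (\<Sum>i\<in>UNIV. int (c i) *s simple_root i)"
      using nonneg_combination[OF highest_root_ge[OF positive_is_root[OF \<alpha>]]] .
    then have "pairing l (highest_root - \<alpha>) = (\<Sum>i\<in>UNIV. int (c i) * pairing l (simple_root i))"
      by (simp add: pairing_sum_right pairing_scale_right)
    also have "\<dots> \<le> 0"
      using le[OF simple_root_positive] by (intro sum_nonpos) (simp add: mult_nonneg_nonpos)
    finally show ?thesis using hi by (simp add: pairing_diff_right)
  qed
  have "\<bar>pairing l \<alpha>\<bar> \<le> 1" if "\<alpha> \<in> roots" for \<alpha>
  proof (cases "\<alpha> \<in> positive_roots")
    case True
    then show ?thesis using le[of \<alpha>] ge[of \<alpha>] by simp
  next
    case False
    then have "- \<alpha> \<in> positive_roots" using uminus_positive_root_iff that by blast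
    then show ?thesis using le[of "- \<alpha>"] ge[of "- \<alpha>"] by (simp add: pairing_minus_right)
  qed
  then have l: "l = 0" by (rule no_minuscule_coweight)
  then have "w = id" using simple weyl_simple_positive_imp_id[OF w] by simp
  then show ?thesis using x l by (simp add: waf_one_def)
qed

lemma reflection_system_affine:
  "reflection_system affine_weyl_group waf_one waf_mult affine_generator affine_action affine_roots
     positive_affine_roots uminus affine_simple_root root_reflection"
proof
  show "waf_mult x y \<in> affine_weyl_group" if "x \<in> affine_weyl_group" "y \<in> affine_weyl_group" for x y
    using that by (simp add: waf_closed waf_mult_def weyl_comp)
  show "waf_one \<in> affine_weyl_group" by (simp add: waf_closed waf_one_def weyl_group.one)
  show "waf_mult waf_one x = x" if "x \<in> affine_weyl_group" for x
    using that act_coweight_scale[OF weyl_inv, of "fst x" 0 0]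
    by (simp add: waf_closed waf_mult_def waf_one_def)
  show "waf_mult x waf_one = x" if "x \<in> affine_weyl_group" for x
    by (simp add: waf_mult_def waf_one_def)
  show gG: "affine_generator k \<in> affine_weyl_group" for k
    by (auto simp: waf_closed affine_generator_def weyl_simple reflection_in_weyl highest_root_root
        split: option.split)
  have rr: "waf_mult (root_reflection a) (root_reflection a) = waf_one" if a: "a \<in> affine_roots" for a
  proof -
    have r: "fst a \<in> roots" using a by (auto simp: affine_roots_def)
    have "act_coweight (reflection (fst a)) (coroot (fst a)) = - coroot (fst a)"
      using r by (simp add: act_coweight_reflection pairing_coroot_self vec_eq_iff)
    then show ?thesis using r
      by (simp add: waf_mult_def root_reflection_def affine_reflection_def waf_one_def inv_reflection
          act_coweight_scale reflection_in_weyl fun_eq_iff reflection_involution vec_eq_iff)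
  qed
  then show "waf_mult (root_reflection a) (root_reflection a) = waf_one" if "a \<in> affine_roots" for a
    using that .
  show rs: "root_reflection (affine_simple_root k) = affine_generator k" for k
    by (simp add: root_reflection_def affine_reflection_def affine_simple_root_def affine_generator_def
        reflection_simple_root reflection_minus coroot_minus highest_root_root split: option.split)
  have sR: "affine_simple_root k \<in> affine_roots" for k
    by (auto simp: affine_roots_def affine_simple_root_def simple_root_root root_minus highest_root_root
        split: option.split)
  then show "waf_mult (affine_generator k) (affine_generator k) = waf_one" for k
    using rr rs by metis
  show "affine_action (waf_mult x y) a = affine_action x (affine_action y a)"
    if "x \<in> affine_weyl_group" "y \<in> affine_weyl_group" "a \<in> affine_roots" for x y a
    using that by (simp add: affine_action_def waf_mult_def waf_closed pairing_add_left pairing_act_inv)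
  show "affine_action waf_one a = a" if "a \<in> affine_roots" for a
    by (simp add: affine_action_def waf_one_def)
  show "affine_action x a \<in> affine_roots" if "x \<in> affine_weyl_group" "a \<in> affine_roots" for x a
    using that weyl_root by (auto simp: affine_action_def affine_roots_def waf_closed)
  show "positive_affine_roots \<subseteq> affine_roots"
    by (auto simp: positive_affine_roots_def affine_roots_def)
  show "- a \<in> positive_affine_roots \<longleftrightarrow> a \<notin> positive_affine_roots" if "a \<in> affine_roots" for a
    using that neg_affine_root_iff[of "fst a" "snd a"] by (auto simp: affine_roots_def uminus_prod_def)
  show "affine_action x (- a) = - affine_action x a"
    if "x \<in> affine_weyl_group" "a \<in> affine_roots" for x a
    using that by (simp add: affine_action_def waf_closed uminus_prod_def weyl_minus pairing_minus_right)
  show "affine_simple_root k \<in> positive_affine_roots" for k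
    by (auto simp: positive_affine_roots_def affine_simple_root_def simple_root_root root_minus
        highest_root_root simple_root_positive split: option.split)
  show self: "affine_action (root_reflection a) a = - a" if "a \<in> affine_roots" for a
    using that by (auto simp: affine_action_def root_reflection_def affine_reflection_def
        affine_roots_def uminus_prod_def reflection_self pairing_scale_left pairing_coroot_self)
  then show "affine_action (affine_generator k) (affine_simple_root k) = - affine_simple_root k" for k
    using rs sR by metis
  show "root_reflection a \<in> affine_weyl_group" if "a \<in> affine_roots" for a
    using that by (auto simp: waf_closed root_reflection_def affine_reflection_def affine_roots_def
        reflection_in_weyl)
  show "waf_mult x (root_reflection a) = waf_mult (root_reflection (affine_action x a)) x"
    if x: "x \<in> affine_weyl_group" and a: "a \<in> affine_roots" for x a
  proof -
    have w: "fst x \<in> weyl_group" and r: "fst a \<in> roots" using x a by (auto simp: waf_closed affine_roots_def)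
    show ?thesis using w r reflection_weyl[OF w r]
      by (simp add: waf_mult_def root_reflection_def affine_reflection_def affine_action_def
          inv_reflection act_coweight_reflection coroot_weyl act_coweight_scale act_coweight_diff weyl_inv
          vec_eq_iff algebra_simps)
  qed
  show "root_reflection (- a) = root_reflection a" if "a \<in> affine_roots" for a
    using that by (auto simp: root_reflection_def affine_reflection_def affine_roots_def
        reflection_minus coroot_minus vec_eq_iff)
qed (fact waf_mult_assoc affine_simple_reflection_positive finite_affine_inversions
    affine_simple_positive_imp_one | simp)+

sublocale aff: reflection_system affine_weyl_group waf_one waf_mult affine_generator affine_action
  affine_roots positive_affine_roots uminus affine_simple_root root_reflection
  by (rule reflection_system_affine)

lemma affine_length_eq_card: "x \<in> affine_weyl_group \<Longrightarrow> affine_length x = card (aff.inversions x)"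
  using aff.len_eq_card by (simp add: affine_length_def)

subsection \<open>Lengths and cocovers of regular elements\<close>

text \<open>\<open>chamber_element v u \<lambda>\<close> is \<open>u v\<inverse> t\<^sub>v\<^sub>\<lambda>\<close>.\<close>

definition chamber_element :: "'i weyl \<Rightarrow> 'i weyl \<Rightarrow> 'i coweight \<Rightarrow> 'i waf" where
  "chamber_element v u lam = (u \<circ> inv v, act_coweight v lam)"

text \<open>Antidominance with a margin. Unlike superregularity it can be weakened gradually, so the
  loss under each added coroot or exponent can be budgeted.\<close>

definition deep :: "int \<Rightarrow> 'i coweight \<Rightarrow> bool" where
  "deep n lam \<longleftrightarrow> (\<forall>\<alpha>\<in>positive_roots. pairing lam \<alpha> < - n)"

text \<open>The least \<delta>-coefficient with which the root \<alpha> becomes a positive affine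
  root.\<close>

definition sign_bit :: "'i weight \<Rightarrow> int" where
  "sign_bit \<alpha> = (if \<alpha> \<in> positive_roots then 0 else 1)"

lemma deep_add_coroot:
  assumes "deep (n + 4) lam" "\<alpha> \<in> roots" "n \<ge> 0" "k \<in> {0, 1}"
  shows "deep n (lam + k *s coroot \<alpha>)"
  unfolding deep_def
proof
  fix \<beta> assume b: "\<beta> \<in> positive_roots"
  have "pairing lam \<beta> < - n - 4" using assms(1) b by (auto simp: deep_def)
  moreover have "pairing (coroot \<alpha>) \<beta> \<le> 4" using pairing_coroot_bound assms(2) positive_is_root[OF b] .
  ultimately show "pairing (lam + k *s coroot \<alpha>) \<beta> < - n"
    using assms(4) by (auto simp: pairing_add_left pairing_scale_left)
qed

lemma deep_mono: "deep n lam \<Longrightarrow> k \<le> n \<Longrightarrow> deep k lam"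
  by (fastforce simp: deep_def)

lemma chamber_element_closed:
  "v \<in> weyl_group \<Longrightarrow> u \<in> weyl_group \<Longrightarrow> chamber_element v u lam \<in> affine_weyl_group"
  by (simp add: chamber_element_def waf_closed weyl_comp weyl_inv)

lemma chamber_element_action:
  "v \<in> weyl_group \<Longrightarrow> affine_action (chamber_element v u lam) (v \<alpha>, n) = (u \<alpha>, n - pairing lam \<alpha>)"
  by (simp add: affine_action_def chamber_element_def pairing_act_act)

lemma chamber_element_action_neg:
  "v \<in> weyl_group \<Longrightarrow> u \<in> weyl_group \<Longrightarrow>
    affine_action (chamber_element v u lam) (- v \<alpha>, n) = (- u \<alpha>, n + pairing lam \<alpha>)"
  using chamber_element_action[of v u lam "- \<alpha>" n] by (simp add: weyl_minus pairing_minus_right)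

lemma neg_root_affine_positive:
  "\<alpha> \<in> roots \<Longrightarrow> (- \<alpha>, n) \<in> positive_affine_roots \<longleftrightarrow> n \<ge> 1 - sign_bit \<alpha>"
  by (auto simp: positive_affine_roots_def sign_bit_def root_minus uminus_positive_root_iff)

lemma root_affine_positive:
  "\<alpha> \<in> roots \<Longrightarrow> (\<alpha>, n) \<in> positive_affine_roots \<longleftrightarrow> n \<ge> sign_bit \<alpha>"
  by (auto simp: positive_affine_roots_def sign_bit_def)

text \<open>On each line of affine roots with finite part -v\<alpha>, \<alpha> positive, the
  inversions form an interval: its lower end is where the root becomes positive, its upper end where
  the image stops being negative. The lines with finite part v\<alpha> contribute nothing because
  \<lambda> is negative on \<alpha>.\<close>

lemma chamber_element_inversions:
  assumes v: "v \<in> weyl_group" and u: "u \<in> weyl_group" and lam: "deep 0 lam"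
  shows "aff.inversions (chamber_element v u lam) =
    (\<lambda>(\<alpha>, n). (- v \<alpha>, n)) ` (SIGMA \<alpha>:positive_roots. {1 - sign_bit (v \<alpha>)..- pairing lam \<alpha> - sign_bit (u \<alpha>)})"
    (is "?L = ?f ` ?R")
proof (intro equalityI subsetI)
  fix a assume a: "a \<in> ?L"
  obtain \<beta> n where an: "a = (\<beta>, n)" by (cases a)
  have pos: "a \<in> positive_affine_roots" and
    neg: "affine_action (chamber_element v u lam) a \<notin> positive_affine_roots"
    using a by (auto simp: aff.inversions_def)
  have \<beta>: "\<beta> \<in> roots" using pos an by (auto simp: positive_affine_roots_def)
  define \<alpha> where "\<alpha> = - inv v \<beta>"
  have \<alpha>: "\<alpha> \<in> roots" using weyl_root[OF weyl_inv[OF v] \<beta>] root_minus by (simp add: \<alpha>_def)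
  have \<beta>\<alpha>: "\<beta> = - v \<alpha>" using v by (simp add: \<alpha>_def weyl_minus)
  have vr: "v \<alpha> \<in> roots" and ur: "u \<alpha> \<in> roots" using weyl_root u v \<alpha> by auto
  have "\<alpha> \<in> positive_roots"
  proof (rule ccontr)
    assume "\<alpha> \<notin> positive_roots"
    then have "pairing lam (- \<alpha>) < 0" using lam uminus_positive_root_iff[OF \<alpha>] by (auto simp: deep_def)
    moreover have "n \<ge> 0" using pos an by (auto simp: positive_affine_roots_def)
    ultimately show False using neg u v root_minus[OF ur]
      by (simp add: an \<beta>\<alpha> chamber_element_action_neg pairing_minus_right positive_affine_roots_def)
  qed
  moreover have "n \<ge> 1 - sign_bit (v \<alpha>)" using pos an \<beta>\<alpha> neg_root_affine_positive[OF vr] by simp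
  moreover have "n \<le> - pairing lam \<alpha> - sign_bit (u \<alpha>)"
    using neg an \<beta>\<alpha> neg_root_affine_positive[OF ur] u v by (simp add: chamber_element_action_neg)
  ultimately show "a \<in> ?f ` ?R" using an \<beta>\<alpha> by force
next
  fix a assume "a \<in> ?f ` ?R"
  then obtain \<alpha> n where \<alpha>: "\<alpha> \<in> positive_roots" and n: "1 - sign_bit (v \<alpha>) \<le> n"
    "n \<le> - pairing lam \<alpha> - sign_bit (u \<alpha>)" and a: "a = (- v \<alpha>, n)" by auto
  have vr: "v \<alpha> \<in> roots" and ur: "u \<alpha> \<in> roots" using weyl_root u v positive_is_root[OF \<alpha>] by auto
  show "a \<in> ?L" unfolding aff.inversions_def
    using a n u v by (auto simp: neg_root_affine_positive[OF vr] neg_root_affine_positive[OF ur] chamber_element_action_neg)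
qed

lemma sum_sign_bit: "w \<in> weyl_group \<Longrightarrow> (\<Sum>\<alpha>\<in>positive_roots. sign_bit (w \<alpha>)) = int (weyl_length w)"
proof -
  assume "w \<in> weyl_group"
  have "(\<Sum>\<alpha>\<in>positive_roots. sign_bit (w \<alpha>)) = (\<Sum>\<alpha>\<in>positive_roots. if w \<alpha> \<in> positive_roots then 0 else 1)"
    by (simp add: sign_bit_def)
  also have "\<dots> = int (card {\<alpha> \<in> positive_roots. w \<alpha> \<notin> positive_roots})"
    using finite_positive_roots by (simp add: sum.If_cases Int_def)
  finally show ?thesis using weyl_length_eq_card[OF \<open>w \<in> weyl_group\<close>] by simp
qed

text \<open>The interval lengths add up: the pairings give 2\<rho>, the two sign bits give finite
  lengths. \<open>deep 0\<close> is what keeps each interval length from being truncated. The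
  opposite signs of \<open>u\<close> and \<open>v\<close> are responsible for the opposite
  directions of near and far edges.\<close>

lemma affine_length_chamber_element:
  assumes v: "v \<in> weyl_group" and u: "u \<in> weyl_group" and lam: "deep 0 lam"
  shows "int (affine_length (chamber_element v u lam)) =
    - pairing lam (2 *s rho) - int (weyl_length u) + int (weyl_length v)"
proof -
  let ?R = "SIGMA \<alpha>:positive_roots. {1 - sign_bit (v \<alpha>)..- pairing lam \<alpha> - sign_bit (u \<alpha>)}"
  let ?f = "\<lambda>(\<alpha>, n :: int). (- v \<alpha>, n)"
  have "inj_on ?f ?R"
    by (rule inj_onI) (auto, metis v weyl_inv_apply)
  then have "affine_length (chamber_element v u lam) = card ?R"
    by (simp add: affine_length_eq_card chamber_element_closed u v chamber_element_inversions[OF v u lam] card_image)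
  also have "card ?R = (\<Sum>\<alpha>\<in>positive_roots. card {1 - sign_bit (v \<alpha>)..- pairing lam \<alpha> - sign_bit (u \<alpha>)})"
    using finite_positive_roots by (intro card_SigmaI) auto
  finally have "int (affine_length (chamber_element v u lam)) =
      (\<Sum>\<alpha>\<in>positive_roots. int (card {1 - sign_bit (v \<alpha>)..- pairing lam \<alpha> - sign_bit (u \<alpha>)}))"
    by (simp only: of_nat_sum)
  also have "\<dots> = (\<Sum>\<alpha>\<in>positive_roots. - pairing lam \<alpha> - sign_bit (u \<alpha>) + sign_bit (v \<alpha>))"
  proof (rule sum.cong[OF refl])
    fix \<alpha> assume "\<alpha> \<in> positive_roots"
    then have "pairing lam \<alpha> < 0" using lam by (auto simp: deep_def)
    moreover have "sign_bit (u \<alpha>) \<le> 1" "sign_bit (v \<alpha>) \<ge> 0" by (auto simp: sign_bit_def)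
    ultimately show "int (card {1 - sign_bit (v \<alpha>)..- pairing lam \<alpha> - sign_bit (u \<alpha>)}) =
        - pairing lam \<alpha> - sign_bit (u \<alpha>) + sign_bit (v \<alpha>)" by simp
  qed
  also have "\<dots> = - pairing lam (\<Sum>positive_roots) - int (weyl_length u) + int (weyl_length v)"
    by (simp add: sum.distrib sum_subtractf sum_negf pairing_sum_right sum_sign_bit u v)
  finally show ?thesis by (simp add: sum_positive_roots)
qed

text \<open>One reflected element, two readings: in the chamber \<open>v\<close> with
  \<open>u\<close> changed, or in the chamber \<open>v \<circ> reflection \<alpha>\<close> with
  \<open>u\<close> kept. The identities hold for all \<open>n\<close>. The first leaves the coweight
  deep for \<open>n\<close> close to \<open>- pairing lam \<alpha>\<close>, the second for
  \<open>n\<close> close to 0.\<close>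

lemma chamber_element_reflect:
  assumes v: "v \<in> weyl_group" and \<alpha>: "\<alpha> \<in> roots"
  shows "waf_mult (chamber_element v u lam) (root_reflection (- v \<alpha>, n)) =
      chamber_element v (u \<circ> reflection \<alpha>) (lam - (pairing lam \<alpha> + n) *s coroot \<alpha>)"
    and "waf_mult (chamber_element v u lam) (root_reflection (- v \<alpha>, n)) =
      chamber_element (v \<circ> reflection \<alpha>) u (lam + n *s coroot \<alpha>)"
proof -
  have vr: "v \<alpha> \<in> roots" using weyl_root v \<alpha> .
  have rG: "reflection \<alpha> \<in> weyl_group" using reflection_in_weyl \<alpha> .
  have "reflection (v \<alpha>) \<circ> v \<circ> inv v = v \<circ> reflection \<alpha> \<circ> inv v" using reflection_weyl[OF v \<alpha>] by simp
  then have r: "reflection (v \<alpha>) = v \<circ> reflection \<alpha> \<circ> inv v" using v by (simp add: comp_assoc weyl_comp_inv)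
  then have 1: "u \<circ> inv v \<circ> reflection (v \<alpha>) = u \<circ> reflection \<alpha> \<circ> inv v"
    using v by (simp add: fun_eq_iff)
  have "act_coweight (reflection (v \<alpha>)) (act_coweight v lam) + n *s coroot (- v \<alpha>) =
      act_coweight v (act_coweight (reflection \<alpha>) lam - n *s coroot \<alpha>)"
    using v rG vr unfolding diff_conv_add_uminus act_coweight_add[OF v] act_coweight_minus[OF v]
      act_coweight_scale[OF v]
    by (simp add: r act_coweight_comp weyl_comp weyl_inv coroot_minus coroot_weyl \<alpha> vec_eq_iff)
  then have 2: "waf_mult (chamber_element v u lam) (root_reflection (- v \<alpha>, n)) =
      (u \<circ> reflection \<alpha> \<circ> inv v, act_coweight v (act_coweight (reflection \<alpha>) lam - n *s coroot \<alpha>))"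
    using 1 vr by (simp add: waf_mult_def chamber_element_def root_reflection_def affine_reflection_def
        reflection_minus inv_reflection)
  have e1: "act_coweight (reflection \<alpha>) lam - n *s coroot \<alpha> = lam - (pairing lam \<alpha> + n) *s coroot \<alpha>"
    using \<alpha> by (simp add: act_coweight_reflection vec_eq_iff algebra_simps)
  show "waf_mult (chamber_element v u lam) (root_reflection (- v \<alpha>, n)) =
      chamber_element v (u \<circ> reflection \<alpha>) (lam - (pairing lam \<alpha> + n) *s coroot \<alpha>)"
    unfolding 2 e1 by (simp add: chamber_element_def)
  have "act_coweight (reflection \<alpha>) lam - n *s coroot \<alpha> = act_coweight (reflection \<alpha>) (lam + n *s coroot \<alpha>)"
    using \<alpha> by (simp add: act_coweight_reflection pairing_add_left pairing_scale_left pairing_coroot_self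
        vec_eq_iff algebra_simps)
  moreover have "inv (v \<circ> reflection \<alpha>) = reflection \<alpha> \<circ> inv v"
    using v rG \<alpha> by (simp add: weyl_inv_comp inv_reflection)
  ultimately show "waf_mult (chamber_element v u lam) (root_reflection (- v \<alpha>, n)) =
      chamber_element (v \<circ> reflection \<alpha>) u (lam + n *s coroot \<alpha>)"
    unfolding 2 using v rG by (simp add: chamber_element_def act_coweight_comp comp_assoc)
qed

text \<open>The edges \<open>u \<rightarrow> u r\<^sub>\<alpha>\<close> of the quantum Bruhat graph: \<open>k = 0\<close> for the Bruhat covers and \<open>k = 1\<close> for the edges
  with weight \<open>q\<close>.\<close>

definition quantum_edge :: "'i weyl \<Rightarrow> 'i weight \<Rightarrow> int \<Rightarrow> bool" where
  "quantum_edge u \<alpha> k \<longleftrightarrow> int (weyl_length (u \<circ> reflection \<alpha>)) =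
     int (weyl_length u) + 1 - k * pairing (coroot \<alpha>) (2 *s rho)"

text \<open>Only the two extreme reflections among those in the roots \<open>-v\<alpha> + n\<delta>\<close> that \<open>x\<close> inverts can give a
  cocover: for the others the length drops by at least \<open>3\<close>, because \<open>r\<^sub>n = r\<^sub>q r\<^sub>p r\<^sub>n\<^sub>-\<^sub>q\<^sub>+\<^sub>p\<close>, where \<open>p\<close> and \<open>q\<close>
  are the extreme values of \<open>n\<close>, is a descending chain below \<open>x\<close>.\<close>

lemma interior_not_cocover:
  assumes v: "v \<in> weyl_group" and u: "u \<in> weyl_group" and lam: "deep 4 lam"
    and \<alpha>: "\<alpha> \<in> positive_roots"
    and p: "p = 1 - sign_bit (v \<alpha>)" and q: "q = - pairing lam \<alpha> - sign_bit (u \<alpha>)"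
    and n: "p < n" "n < q"
  shows "(- v \<alpha>, n) \<notin> aff.cocover_roots (chamber_element v u lam)"
proof -
  let ?x = "chamber_element v u lam"
  let ?r = "\<lambda>n. root_reflection (- v \<alpha>, n)"
  have r: "\<alpha> \<in> roots" using positive_is_root \<alpha> .
  have vr: "v \<alpha> \<in> roots" and ur: "u \<alpha> \<in> roots" using weyl_root u v r by auto
  have mvr: "- v \<alpha> \<in> roots" using root_minus vr .
  have rR: "(- v \<alpha>, k) \<in> affine_roots" for k using mvr by (simp add: affine_roots_def)
  have xG: "?x \<in> affine_weyl_group" using chamber_element_closed[OF v u] .
  have rG: "?r k \<in> affine_weyl_group" for k using aff.refl_closed rR .
  have m: "pairing lam \<alpha> < - 4" using lam \<alpha> by (auto simp: deep_def)
  have bits: "0 \<le> sign_bit (u \<alpha>)" "sign_bit (u \<alpha>) \<le> 1" "0 \<le> sign_bit (v \<alpha>)" "sign_bit (v \<alpha>) \<le> 1"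
    by (auto simp: sign_bit_def)
  have act1: "affine_action (?r k) (- v \<alpha>, l) = (v \<alpha>, l - 2 * k)" for k l
    using vr by (simp add: affine_action_def root_reflection_def affine_reflection_def reflection_minus
        coroot_minus pairing_minus_left pairing_minus_right pairing_scale_left pairing_coroot_self
        weyl_minus reflection_in_weyl reflection_self)
  have act2: "affine_action (?r k) (v \<alpha>, l) = (- v \<alpha>, l + 2 * k)" for k l
    using vr by (simp add: affine_action_def root_reflection_def affine_reflection_def reflection_minus
        coroot_minus pairing_minus_left pairing_minus_right pairing_scale_left pairing_coroot_self
        weyl_minus reflection_in_weyl reflection_self)
  define c where "c = n - q + p"
  have rrr: "waf_mult (waf_mult (waf_mult ?x (?r q)) (?r p)) (?r c) = waf_mult ?x (?r n)"
  proof -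
    have e: "u \<circ> reflection \<alpha> \<circ> reflection \<alpha> = u" using r by (simp add: fun_eq_iff reflection_involution)
    show ?thesis unfolding chamber_element_reflect(1)[OF v r] e
      by (rule arg_cong2[of _ _ _ _ "chamber_element v", OF HOL.refl],
          simp only: pairing_diff_left pairing_scale_left pairing_coroot_self[OF r])
        (simp add: vec_eq_iff c_def algebra_simps)
  qed
  have qp: "q \<ge> 1 - sign_bit (v \<alpha>)" "p \<ge> 1 - sign_bit (v \<alpha>)" using m bits p q by linarith+
  let ?x1 = "waf_mult ?x (?r q)" and ?x2 = "waf_mult (waf_mult ?x (?r q)) (?r p)"
  have x1G: "?x1 \<in> affine_weyl_group" and x2G: "?x2 \<in> affine_weyl_group"
    using xG rG by (auto intro: aff.mult_closed)
  have "affine_length ?x1 < affine_length ?x"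
    unfolding affine_length_def
    by (rule aff.len_refl_less[OF xG])
      (use u v qp q in \<open>auto simp: neg_root_affine_positive vr ur chamber_element_action_neg\<close>)
  moreover have "affine_length ?x2 < affine_length ?x1"
    unfolding affine_length_def
  proof (rule aff.len_refl_less[OF x1G])
    show "(- v \<alpha>, p) \<in> positive_affine_roots" using qp by (simp add: neg_root_affine_positive vr)
    have "affine_action ?x1 (- v \<alpha>, p) = (u \<alpha>, p - 2 * q - pairing lam \<alpha>)"
      using v by (simp add: aff.act_mult xG rG rR act1 chamber_element_action)
    then show "affine_action ?x1 (- v \<alpha>, p) \<notin> positive_affine_roots"
      using m bits p q by (simp add: root_affine_positive ur)
  qed
  \<comment> \<open>Since \<open>n < q\<close>, the index \<open>c\<close> is less than
    \<open>p\<close>, so the root with index \<open>c\<close> is negative. The descent is tested on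
    its negative, which defines the same reflection.\<close>
  moreover have "affine_length (waf_mult ?x2 (?r c)) < affine_length ?x2"
  proof -
    have vR: "(v \<alpha>, k) \<in> affine_roots" for k using vr by (simp add: affine_roots_def)
    have "affine_action ?x2 (v \<alpha>, - c) = (u \<alpha>, - c + 2 * p - 2 * q - pairing lam \<alpha>)"
      using v by (simp add: aff.act_mult x1G xG rG rR vR act1 act2 chamber_element_action)
    then have "affine_action ?x2 (v \<alpha>, - c) \<notin> positive_affine_roots"
      using n p q by (simp add: root_affine_positive ur c_def)
    moreover have "(v \<alpha>, - c) \<in> positive_affine_roots"
      using n p by (simp add: root_affine_positive vr c_def)
    moreover have "?r c = root_reflection (v \<alpha>, - c)"
      using aff.refl_neg[OF vR[of "- c"]] by (simp add: uminus_prod_def)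
    ultimately show ?thesis unfolding affine_length_def using aff.len_refl_less[OF x2G] by metis
  qed
  ultimately show ?thesis
    by (auto simp: aff.cocover_roots_def rrr affine_length_def)
qed

section \<open>Cocovers as edges of the quantum Bruhat graph\<close>

lemma near_cocover_root_iff:
  assumes v: "v \<in> weyl_group" and u: "u \<in> weyl_group" and lam: "deep 4 lam"
    and \<alpha>: "\<alpha> \<in> positive_roots" and k: "k \<in> {0, 1}"
  shows "(- v \<alpha>, - pairing lam \<alpha> - k) \<in> aff.cocover_roots (chamber_element v u lam) \<longleftrightarrow> quantum_edge u \<alpha> k"
proof -
  have r: "\<alpha> \<in> roots" using positive_is_root \<alpha> .
  have vr: "v \<alpha> \<in> roots" using weyl_root v r .
  have u': "u \<circ> reflection \<alpha> \<in> weyl_group" using weyl_comp u reflection_in_weyl r by blast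
  have d0: "deep 0 lam" using lam deep_mono[of 4] by simp
  have "pairing lam \<alpha> < - 4" using lam \<alpha> by (auto simp: deep_def)
  then have "(- v \<alpha>, - pairing lam \<alpha> - k) \<in> positive_affine_roots"
    using k by (auto simp: neg_root_affine_positive vr sign_bit_def)
  moreover have "deep 0 (lam + k *s coroot \<alpha>)" using deep_add_coroot[of 0 lam \<alpha> k] lam r k by simp
  moreover have "waf_mult (chamber_element v u lam) (root_reflection (- v \<alpha>, - pairing lam \<alpha> - k)) =
      chamber_element v (u \<circ> reflection \<alpha>) (lam + k *s coroot \<alpha>)"
  proof -
    have "lam - (pairing lam \<alpha> + (- pairing lam \<alpha> - k)) *s coroot \<alpha> = lam + k *s coroot \<alpha>"
      by (simp add: vec_eq_iff)
    then show ?thesis by (simp only: chamber_element_reflect(1)[OF v r])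
  qed
  ultimately show ?thesis
    using affine_length_chamber_element[OF v u d0] affine_length_chamber_element[OF v u', of "lam + k *s coroot \<alpha>"]
    by (auto simp: aff.cocover_roots_def quantum_edge_def
        affine_length_def[symmetric] pairing_add_left pairing_scale_left)
qed

text \<open>In the length formula \<open>v\<close> occurs with the sign opposite to that of
  \<open>u\<close>. A drop of the affine length by 1 is therefore an edge that ends at
  \<open>v\<close> and starts at \<open>v \<circ> reflection \<alpha>\<close>.\<close>

lemma far_cocover_root_iff:
  assumes v: "v \<in> weyl_group" and u: "u \<in> weyl_group" and lam: "deep 4 lam"
    and \<alpha>: "\<alpha> \<in> positive_roots" and k: "k \<in> {0, 1}"
  shows "(- v \<alpha>, k) \<in> aff.cocover_roots (chamber_element v u lam) \<longleftrightarrow> quantum_edge (v \<circ> reflection \<alpha>) \<alpha> k"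
proof -
  have r: "\<alpha> \<in> roots" using positive_is_root \<alpha> .
  have vr: "v \<alpha> \<in> roots" using weyl_root v r .
  have v': "v \<circ> reflection \<alpha> \<in> weyl_group" using weyl_comp v reflection_in_weyl r by blast
  have d0: "deep 0 lam" using lam deep_mono[of 4] by simp
  have e: "v \<circ> reflection \<alpha> \<circ> reflection \<alpha> = v" using r by (simp add: fun_eq_iff reflection_involution)
  have "(- v \<alpha>, k) \<in> positive_affine_roots" if q: "quantum_edge (v \<circ> reflection \<alpha>) \<alpha> k"
  \<comment> \<open>For \<open>k = 0\<close> positivity of the affine root is not automatic: it
    holds because the edge makes \<open>v\<close> longer than
    \<open>v \<circ> reflection \<alpha>\<close>, so \<open>v\<close> sends \<alpha> to a negative
    root.\<close>
  proof (cases "k = 0")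
    case True
    then have "v \<alpha> \<notin> positive_roots"
      using q weyl_length_reflection_less_iff[OF v \<alpha>] by (simp add: quantum_edge_def e)
    then show ?thesis using True by (simp add: neg_root_affine_positive vr sign_bit_def)
  next
    case False
    then show ?thesis using k by (simp add: neg_root_affine_positive vr sign_bit_def)
  qed
  moreover have "deep 0 (lam + k *s coroot \<alpha>)" using deep_add_coroot[of 0 lam \<alpha> k] lam r k by simp
  ultimately show ?thesis
    using affine_length_chamber_element[OF v u d0] affine_length_chamber_element[OF v' u, of "lam + k *s coroot \<alpha>"]
    by (auto simp: aff.cocover_roots_def chamber_element_reflect(2)[OF v r] quantum_edge_def e
        affine_length_def[symmetric] pairing_add_left pairing_scale_left)
qed

text \<open>Cocover roots are inversions, and only the ends of the inversion intervals survive
  \<open>interior_not_cocover\<close>. The upper end is a near root with \<open>k\<close> equal to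
  the sign bit of \<open>u \<alpha>\<close>, the lower end a far root.\<close>

lemma cocover_roots_chamber_element:
  assumes v: "v \<in> weyl_group" and u: "u \<in> weyl_group" and lam: "deep 4 lam"
  shows "aff.cocover_roots (chamber_element v u lam) =
    (\<lambda>(\<alpha>, k). (- v \<alpha>, - pairing lam \<alpha> - k)) ` {(\<alpha>, k). \<alpha> \<in> positive_roots \<and> k \<in> {0, 1} \<and> quantum_edge u \<alpha> k} \<union>
    (\<lambda>(\<alpha>, k). (- v \<alpha>, k)) ` {(\<alpha>, k). \<alpha> \<in> positive_roots \<and> k \<in> {0, 1} \<and> quantum_edge (v \<circ> reflection \<alpha>) \<alpha> k}"
    (is "?L = ?N \<union> ?F")
proof (intro equalityI subsetI)
  fix a assume "a \<in> ?N \<union> ?F"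
  then show "a \<in> ?L"
    using near_cocover_root_iff[OF assms] far_cocover_root_iff[OF assms] by auto
next
  fix a assume a: "a \<in> ?L"
  then have "a \<in> aff.inversions (chamber_element v u lam)"
    using aff.cocover_roots_subset chamber_element_closed u v by blast
  then obtain \<alpha> n where \<alpha>: "\<alpha> \<in> positive_roots" and n: "1 - sign_bit (v \<alpha>) \<le> n"
    "n \<le> - pairing lam \<alpha> - sign_bit (u \<alpha>)" and an: "a = (- v \<alpha>, n)"
    using chamber_element_inversions[OF v u deep_mono[OF lam]] by auto
  have "n = 1 - sign_bit (v \<alpha>) \<or> n = - pairing lam \<alpha> - sign_bit (u \<alpha>)"
    using interior_not_cocover[OF v u lam \<alpha> refl refl, of n] a an n by force
  then show "a \<in> ?N \<union> ?F"
  proof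
    assume n: "n = 1 - sign_bit (v \<alpha>)"
    then have k: "n \<in> {0, 1}" by (simp add: sign_bit_def)
    then have "quantum_edge (v \<circ> reflection \<alpha>) \<alpha> n"
      using far_cocover_root_iff[OF assms \<alpha> k] a an by simp
    then have "a \<in> ?F" using \<alpha> k an by (intro image_eqI[of _ _ "(\<alpha>, n)"]) auto
    then show ?thesis by blast
  next
    let ?k = "sign_bit (u \<alpha>)"
    assume n: "n = - pairing lam \<alpha> - ?k"
    have k: "?k \<in> {0, 1}" by (simp add: sign_bit_def)
    then have "quantum_edge u \<alpha> ?k"
      using near_cocover_root_iff[OF assms \<alpha> k] a an n by simp
    then have "a \<in> ?N" using \<alpha> k an n by (intro image_eqI[of _ _ "(\<alpha>, ?k)"]) auto
    then show ?thesis by blast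
  qed
qed

abbreviation edge_sum :: "('i weight \<Rightarrow> int \<Rightarrow> bool) \<Rightarrow> ('i weight \<Rightarrow> int \<Rightarrow> 'b::comm_monoid_add) \<Rightarrow> 'b" where
  "edge_sum P f \<equiv> \<Sum>\<alpha>\<in>positive_roots. \<Sum>k\<in>{0, 1}. if P \<alpha> k then f \<alpha> k else 0"

lemma sum_cocover_roots:
  fixes f :: "'i weight \<times> int \<Rightarrow> 'b::ab_group_add"
  assumes v: "v \<in> weyl_group" and u: "u \<in> weyl_group" and lam: "deep 4 lam"
  shows "(\<Sum>a\<in>aff.cocover_roots (chamber_element v u lam). f a) =
    edge_sum (quantum_edge u) (\<lambda>\<alpha> k. f (- v \<alpha>, - pairing lam \<alpha> - k)) +
    edge_sum (\<lambda>\<alpha>. quantum_edge (v \<circ> reflection \<alpha>) \<alpha>) (\<lambda>\<alpha> k.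
        f (- v \<alpha>, k))"
proof -
  let ?N = "{(\<alpha>, k). \<alpha> \<in> positive_roots \<and> k \<in> {0, 1} \<and> quantum_edge u \<alpha> k}"
  let ?F = "{(\<alpha>, k). \<alpha> \<in> positive_roots \<and> k \<in> {0, 1} \<and> quantum_edge (v \<circ> reflection \<alpha>) \<alpha> k}"
  let ?n = "\<lambda>(\<alpha>, k). (- v \<alpha>, - pairing lam \<alpha> - k)" and ?f = "\<lambda>(\<alpha>, k :: int). (- v \<alpha>, k)"
  have inj: "v \<alpha> = v \<beta> \<longleftrightarrow> \<alpha> = \<beta>" for \<alpha> \<beta> using v weyl_inv_apply by metis
  have fin: "finite (positive_roots \<times> {0 :: int, 1})" using finite_positive_roots by simp
  have m: "pairing lam \<alpha> < - 4" if "\<alpha> \<in> positive_roots" for \<alpha> using lam that by (auto simp: deep_def)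
  have finN: "finite ?N" and finF: "finite ?F" by (rule finite_subset[OF _ fin], auto)+
  \<comment> \<open>By depth the near indices are at least 4, whereas the far ones are 0 or
    1.\<close>
  have "?n ` ?N \<inter> ?f ` ?F = {}" using m by (force simp: inj)
  then have "(\<Sum>a\<in>aff.cocover_roots (chamber_element v u lam). f a) = sum f (?n ` ?N) + sum f (?f ` ?F)"
    unfolding cocover_roots_chamber_element[OF assms] using finN finF by (intro sum.union_disjoint) auto
  also have "sum f (?n ` ?N) = (\<Sum>x\<in>?N. f (?n x))"
    by (subst sum.reindex) (auto simp: inj_on_def inj)
  also have "\<dots> = (\<Sum>x\<in>positive_roots \<times> {0, 1}. if quantum_edge u (fst x) (snd x) then f (?n x) else 0)"
    by (rule sum.mono_neutral_cong_left[OF fin]) auto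
  also have "\<dots> = edge_sum (quantum_edge u) (\<lambda>\<alpha> k. f (- v \<alpha>, - pairing lam \<alpha> - k))"
    by (subst sum.cartesian_product) (auto intro: sum.cong)
  also have "sum f (?f ` ?F) = (\<Sum>x\<in>?F. f (?f x))"
    by (subst sum.reindex) (auto simp: inj_on_def inj)
  also have "\<dots> = (\<Sum>x\<in>positive_roots \<times> {0, 1}. if quantum_edge (v \<circ> reflection (fst x)) (fst x) (snd x) then f (?f x) else 0)"
    by (rule sum.mono_neutral_cong_left[OF fin]) auto
  also have "\<dots> = edge_sum (\<lambda>\<alpha>. quantum_edge (v \<circ> reflection \<alpha>) \<alpha>) (\<lambda>\<alpha> k.
        f (- v \<alpha>, k))"
    by (subst sum.cartesian_product) (auto intro: sum.cong)
  finally show ?thesis .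
qed

end


section \<open>Sums over finitely supported functions\<close>

text \<open>Additive extension of a map given on single terms. The near operators,
  \<open>Upsilon\<close>, \<open>evaluate\<close> and the chamber dictionary are brought into this
  form, so additivity is proved once.\<close>

definition support_sum :: "('x \<Rightarrow> 'b::zero \<Rightarrow> 'c::comm_monoid_add) \<Rightarrow> ('x \<Rightarrow>\<^sub>0 'b) \<Rightarrow> 'c" where
  "support_sum g p = (\<Sum>x\<in>Poly_Mapping.keys p. g x (Poly_Mapping.lookup p x))"

lemma support_sum_superset:
  assumes "finite X" "Poly_Mapping.keys p \<subseteq> X" "\<And>x. g x 0 = 0"
  shows "support_sum g p = (\<Sum>x\<in>X. g x (Poly_Mapping.lookup p x))"
  unfolding support_sum_def using assms by (intro sum.mono_neutral_left) (auto simp: in_keys_iff)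

lemma support_sum_add:
  fixes p q :: "'x \<Rightarrow>\<^sub>0 'b::monoid_add"
  assumes "\<And>x. g x 0 = 0" "\<And>x a b. g x (a + b) = g x a + g x b"
  shows "support_sum g (p + q) = support_sum g p + support_sum g q"
proof -
  let ?X = "Poly_Mapping.keys p \<union> Poly_Mapping.keys q"
  have X: "finite ?X" by simp
  have "Poly_Mapping.keys (p + q) \<subseteq> ?X" by (rule keys_add)
  then show ?thesis
    using support_sum_superset[OF X, of "p + q" g] support_sum_superset[OF X, of p g]
      support_sum_superset[OF X, of q g] assms by (simp add: lookup_add sum.distrib)
qed

lemma support_sum_zero [simp]: "support_sum g 0 = 0"
  by (simp add: support_sum_def)

lemma support_sum_sum:
  fixes p :: "'y \<Rightarrow> 'x \<Rightarrow>\<^sub>0 'b::comm_monoid_add"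
  assumes "\<And>x. g x 0 = 0" "\<And>x a b. g x (a + b) = g x a + g x b"
  shows "support_sum g (\<Sum>y\<in>Y. p y) = (\<Sum>y\<in>Y. support_sum g (p y))"
  by (induction Y rule: infinite_finite_induct) (simp_all add: support_sum_add assms)

lemma support_sum_single: "g x 0 = 0 \<Longrightarrow> support_sum g (Poly_Mapping.single x a) = g x a"
  by (cases "a = 0") (simp_all add: support_sum_def)

lemma support_sum_singles: "support_sum (\<lambda>x c. Poly_Mapping.single x c) p = p"
proof (rule poly_mapping_eqI)
  fix k
  show "Poly_Mapping.lookup (support_sum (\<lambda>x c. Poly_Mapping.single x c) p) k = Poly_Mapping.lookup p k"
    by (simp add: support_sum_def lookup_sum lookup_single when_def sum.delta in_keys_iff)
qed

lemma sum_closed: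
  assumes "P 0" "\<And>x y. P x \<Longrightarrow> P y \<Longrightarrow> P (x + y)" "\<And>x. x \<in> X \<Longrightarrow> P (f x)"
  shows "P (\<Sum>x\<in>X. f x)"
  using assms(3) by (induction X rule: infinite_finite_induct) (auto intro: assms(1,2))

abbreviation scale_poly :: "'b::semiring_0 \<Rightarrow> ('x \<Rightarrow>\<^sub>0 'b) \<Rightarrow> ('x \<Rightarrow>\<^sub>0 'b)" where
  "scale_poly c \<equiv> Poly_Mapping.map ((*) c)"

lemma lookup_scale_poly: "Poly_Mapping.lookup (scale_poly c p) k = c * Poly_Mapping.lookup p k"
  by (simp add: Poly_Mapping.map.rep_eq when_def)

lemma scale_poly_add: "scale_poly c (p + q) = scale_poly c p + scale_poly c q"
  by (rule poly_mapping_eqI) (simp add: lookup_scale_poly lookup_add algebra_simps)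

lemma scale_poly_add_left: "scale_poly (c + c') p = scale_poly c p + scale_poly c' p"
  by (rule poly_mapping_eqI) (simp add: lookup_scale_poly lookup_add algebra_simps)

lemma scale_poly_zero_left: "scale_poly 0 p = 0"
  by (rule poly_mapping_eqI) (simp add: lookup_scale_poly)

lemma scale_poly_zero: "scale_poly c 0 = 0"
  by (rule poly_mapping_eqI) (simp add: lookup_scale_poly)

lemma scale_poly_sum: "scale_poly c (\<Sum>y\<in>Y. p y) = (\<Sum>y\<in>Y. scale_poly c (p y))"
  by (induction Y rule: infinite_finite_induct) (simp_all add: scale_poly_add scale_poly_zero)

lemma scale_poly_single: "scale_poly c (Poly_Mapping.single x a) = Poly_Mapping.single x (c * a)"
  by (rule poly_mapping_eqI) (simp add: lookup_scale_poly lookup_single when_def)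

lemma var_poly_power:
  "var_poly i ^ n = (Poly_Mapping.single (Poly_Mapping.single i n) 1 :: _ \<Rightarrow>\<^sub>0 'r::comm_ring_1)"
  by (induction n) (simp_all add: var_poly_def mult_single single_add[symmetric])

lemma prod_var_poly:
  "(\<Prod>i\<in>X. var_poly i ^ f i) =
    (Poly_Mapping.single (\<Sum>i\<in>X. Poly_Mapping.single i (f i)) 1 :: _ \<Rightarrow>\<^sub>0 'r::comm_ring_1)"
  by (induction X rule: infinite_finite_induct) (simp_all add: var_poly_power mult_single)

lemma sum_single_lookup:
  "(\<Sum>i\<in>UNIV. Poly_Mapping.single i (Poly_Mapping.lookup m i)) = m" for m :: "'i::finite \<Rightarrow>\<^sub>0 nat"
  by (rule poly_mapping_eqI) (simp add: lookup_sum lookup_single when_def)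

lemma single_eq_const_mult: "Poly_Mapping.single m c = of_int c * Poly_Mapping.single m 1"
  for m :: "'i \<Rightarrow>\<^sub>0 nat"
proof -
  have "of_int c = Poly_Mapping.single (0 :: 'i \<Rightarrow>\<^sub>0 nat) c" by (simp flip: single_of_int)
  then show ?thesis by (simp add: mult_single)
qed

lemma is_ring_hom_simps:
  assumes "is_ring_hom \<phi>"
  shows "\<phi> 1 = 1" "\<phi> (x + y) = \<phi> x + \<phi> y" "\<phi> (x * y) = \<phi> x * \<phi> y" "\<phi> 0 = 0" "\<phi> (- x) = - \<phi> x"
    "\<phi> (x - y) = \<phi> x - \<phi> y" "\<phi> (of_int n) = of_int n" "\<phi> (\<Sum>i\<in>X. f i) = (\<Sum>i\<in>X. \<phi> (f i))"
proof -
  show 1: "\<phi> 1 = 1" and add: "\<phi> (x + y) = \<phi> x + \<phi> y" and "\<phi> (x * y) = \<phi> x * \<phi> y" for x y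
    using assms by (auto simp: is_ring_hom_def)
  show zero: "\<phi> 0 = 0" using add[of 0 0] by simp
  show min: "\<phi> (- x) = - \<phi> x" for x using add[of x "- x"] zero by (simp add: eq_neg_iff_add_eq_0 add.commute)
  show "\<phi> (x - y) = \<phi> x - \<phi> y" using add[of x "- y"] min by simp
  have nat: "\<phi> (of_nat k) = of_nat k" for k by (induction k) (simp_all add: zero 1 add)
  show "\<phi> (of_int n) = of_int n"
    by (cases n) (simp_all only: of_int_minus of_int_of_nat_eq min nat)
  show "\<phi> (\<Sum>i\<in>X. f i) = (\<Sum>i\<in>X. \<phi> (f i))"
    by (induction X rule: infinite_finite_induct) (simp_all add: zero add)
qed

lemma is_ring_hom_const_poly: "is_ring_hom const_poly"
  by (simp add: is_ring_hom_def const_poly_def single_add mult_single)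

lemma weight_in_S_add: "weight_in_S (\<mu> + \<nu>) = weight_in_S \<mu> + weight_in_S \<nu>"
  by (simp add: weight_in_S_def algebra_simps sum.distrib)

lemma weight_in_S_diff: "weight_in_S (\<mu> - \<nu>) = weight_in_S \<mu> - weight_in_S \<nu>"
  by (simp add: weight_in_S_def algebra_simps sum_subtractf)

lemma weight_in_S_scale: "weight_in_S (k *s \<mu>) = of_int k * weight_in_S \<mu>"
  by (simp add: weight_in_S_def sum_distrib_left mult.assoc)

lemma weight_in_S_sum: "weight_in_S (\<Sum>i\<in>X. f i) = (\<Sum>i\<in>X. weight_in_S (f i))"
  by (induction X rule: infinite_finite_induct) (simp_all add: weight_in_S_add, simp_all add: weight_in_S_def)

lemma weight_in_S_fundamental: "weight_in_S (fundamental_weight i) = var_poly i"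
proof -
  have "of_int (fundamental_weight i $ k) * (var_poly k :: 'a S) = (if k = i then var_poly i else 0)" for k
    by (simp add: fundamental_weight_def axis_def)
  then show ?thesis by (simp add: weight_in_S_def)
qed

section \<open>The affine nilHecke ring\<close>

context nil_hecke_ring
begin

lemmas scalar_simps = is_ring_hom_simps[OF scalars]

abbreviation AA :: "'i waf \<Rightarrow> 'a" where "AA \<equiv> A_elem A"

text \<open>The choice of a reduced word in \<open>A_elem\<close> is harmless, since the axiom
  \<open>braid\<close> is exactly the hypothesis of the word theorem.\<close>

lemma AA_reduced:
  assumes "aff.reduced ks" shows "AA (affine_word_prod ks) = prod_list (map A ks)"
proof -
  let ?x = "affine_word_prod ks"
  have "reduced_word ?x ks" using assms by (simp add: reduced_word_def aff.reduced_def affine_length_def)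
  then have "reduced_word ?x (SOME ks. reduced_word ?x ks)" by (rule someI)
  then have "aff.reduced (SOME ks. reduced_word ?x ks)" "affine_word_prod (SOME ks. reduced_word ?x ks) = ?x"
    by (simp_all add: reduced_word_def aff.reduced_def affine_length_def)
  then show ?thesis unfolding A_elem_def
    using assms aff.reduced_words_unique[of A, OF braid] by blast
qed

lemma AA_one: "AA waf_one = 1"
  using AA_reduced[of "[]"] by (simp add: aff.reduced_def aff.len_e)

lemma AA_gen_up:
  assumes x: "x \<in> affine_weyl_group"
    and up: "affine_length (waf_mult (affine_generator k) x) = Suc (affine_length x)"
  shows "AA (waf_mult (affine_generator k) x) = A k * AA x"
proof -
  obtain ks where ks: "affine_word_prod ks = x" "length ks = affine_length x"
    using aff.exists_reduced[OF x] unfolding affine_length_def by blast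
  then have "aff.reduced ks" "aff.reduced (k # ks)"
    using up by (simp_all add: aff.reduced_def affine_length_def)
  then show ?thesis using AA_reduced[of ks] AA_reduced[of "k # ks"] ks by simp
qed

lemma AA_up_gen:
  assumes x: "x \<in> affine_weyl_group"
    and up: "affine_length (waf_mult x (affine_generator k)) = Suc (affine_length x)"
  shows "AA (waf_mult x (affine_generator k)) = AA x * A k"
proof -
  obtain ks where ks: "affine_word_prod ks = x" "length ks = affine_length x"
    using aff.exists_reduced[OF x] unfolding affine_length_def by blast
  then have "aff.reduced ks" "aff.reduced (ks @ [k])"
    using up by (simp_all add: aff.reduced_def affine_length_def aff.prd_snoc)
  then show ?thesis using AA_reduced[of ks] AA_reduced[of "ks @ [k]"] ks by (simp add: aff.prd_snoc)
qed

lemma A_mult_AA: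
  assumes x: "x \<in> affine_weyl_group"
  shows "A k * AA x = (if affine_length (waf_mult (affine_generator k) x) = Suc (affine_length x)
    then AA (waf_mult (affine_generator k) x) else 0)"
proof (cases "affine_length (waf_mult (affine_generator k) x) = Suc (affine_length x)")
  case True
  then show ?thesis using AA_gen_up[OF x] by simp
next
  case False
  let ?y = "waf_mult (affine_generator k) x"
  have y: "?y \<in> affine_weyl_group" using aff.mult_closed aff.gen_closed x by blast
  have "affine_length x = Suc (affine_length ?y)" using aff.len_gen[OF x, of k] False by (auto simp: affine_length_def)
  then have "AA x = A k * AA ?y" using AA_gen_up[OF y, of k] aff.gen_cancel[OF x, of k] by simp
  then have "A k * AA x = A k * A k * AA ?y" by (simp add: mult.assoc)
  then show ?thesis using False nilpotent by simp
qed

lemma affine_simple_coroot_eq: "affine_simple_coroot k = coroot (fst (affine_simple_root k))"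
  by (simp add: affine_simple_coroot_def affine_simple_root_def coroot_simple_root coroot_minus
      highest_root_root split: option.split)

text \<open>Induction on length, peeling off the first letter \<open>k\<close> of a reduced word of
  \<open>x\<close> and writing \<open>y\<close> for the rest. The terms produced match the recursion
  for cocover roots.\<close>

lemma AA_commutation:
  assumes "x \<in> affine_weyl_group"
  shows "AA x * \<iota> (weight_in_S \<mu>) = \<iota> (weight_in_S (fst x \<mu>)) * AA x +
    (\<Sum>a\<in>aff.cocover_roots x. of_int (pairing (coroot (fst a)) \<mu>) * AA (waf_mult x (root_reflection a)))"
  using assms
proof (induction "affine_length x" arbitrary: x)
  case 0
  obtain ks where "affine_word_prod ks = x" "length ks = affine_length x"
    using aff.exists_reduced[OF 0(2)] unfolding affine_length_def by blast
  then have x: "x = waf_one" using 0 by simp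
  have "aff.cocover_roots x = {}" using 0(1) by (auto simp: aff.cocover_roots_def affine_length_def)
  then show ?case using AA_one x by (simp add: waf_one_def)
next
  case (Suc n)
  obtain ks' where ks': "affine_word_prod ks' = x" "length ks' = affine_length x"
    using aff.exists_reduced[OF Suc.prems] unfolding affine_length_def by blast
  then obtain k ks where ks: "ks' = k # ks" using Suc.hyps(2) by (cases ks') auto
  define y where "y = affine_word_prod ks"
  have y: "y \<in> affine_weyl_group" by (simp add: y_def)
  have x: "x = waf_mult (affine_generator k) y" using ks ks' by (simp add: y_def)
  have "aff.reduced ks" using aff.reduced_suffix[of "[k]" ks] ks ks' by (simp add: aff.reduced_def affine_length_def)
  then have ly: "affine_length y = n" using ks ks' Suc.hyps(2) by (simp add: y_def aff.reduced_def affine_length_def)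
  have up: "affine_length (waf_mult (affine_generator k) y) = Suc (affine_length y)" using x ly Suc.hyps(2) by simp
  have lenx: "word_length waf_one waf_mult affine_generator (waf_mult (affine_generator k) y) =
      Suc (word_length waf_one waf_mult affine_generator y)" using up by (simp add: affine_length_def)
  obtain a where a: "a \<in> positive_affine_roots" "affine_action y a = affine_simple_root k"
    "waf_mult (waf_mult (affine_generator k) y) (root_reflection a) = y"
    "aff.cocover_roots (waf_mult (affine_generator k) y) = insert a {c \<in> aff.cocover_roots y.
      word_length waf_one waf_mult affine_generator (waf_mult (affine_generator k) (waf_mult y (root_reflection c))) =
      Suc (word_length waf_one waf_mult affine_generator (waf_mult y (root_reflection c)))}"
    "a \<notin> aff.cocover_roots y"
    using aff.cocover_roots_gen[OF y lenx] .
  let ?Y = "aff.cocover_roots y"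
  let ?P = "\<lambda>c. affine_length (waf_mult (affine_generator k) (waf_mult y (root_reflection c))) =
      Suc (affine_length (waf_mult y (root_reflection c)))"
  let ?t = "\<lambda>c. of_int (pairing (coroot (fst c)) \<mu>) :: 'a"
  have cov: "aff.cocover_roots x = insert a {c \<in> ?Y. ?P c}" using a(4) by (simp add: x affine_length_def)
  have fin: "finite ?Y" using aff.finite_cocover_roots y by blast
  have wy: "fst y \<in> weyl_group" using y waf_closed by blast
  have ra: "fst a \<in> roots" using a(1) by (auto simp: positive_affine_roots_def)
  have "fst (affine_simple_root k) = fst y (fst a)" using a(2) by (simp add: affine_action_def prod_eq_iff)
  then have ta: "pairing (affine_simple_coroot k) (fst y \<mu>) = pairing (coroot (fst a)) \<mu>"
    using pairing_coroot_weyl[OF wy ra] by (simp add: affine_simple_coroot_eq)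
  \<comment> \<open>Lifts of cocovers of \<open>y\<close> that do not get longer vanish by
    nilpotency; these are the ones that \<open>cocover_roots_gen\<close> discards.\<close>
  have step: "A k * AA (waf_mult y (root_reflection c)) =
      (if ?P c then AA (waf_mult x (root_reflection c)) else 0)" if "c \<in> ?Y" for c
  proof -
    have c: "c \<in> affine_roots" using that aff.Pos_root by (auto simp: aff.cocover_roots_def)
    have "waf_mult y (root_reflection c) \<in> affine_weyl_group"
      using aff.mult_closed[OF y aff.refl_closed[OF c]] .
    moreover have "waf_mult x (root_reflection c) = waf_mult (affine_generator k) (waf_mult y (root_reflection c))"
      unfolding x using waf_mult_assoc[OF aff.gen_closed y aff.refl_closed[OF c]] .
    ultimately show ?thesis using A_mult_AA by simp
  qed
  have com: "A k * (?t c * z) = ?t c * (A k * z)" for c z by (metis mult.assoc mult_of_int_commute)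
  have "AA x * \<iota> (weight_in_S \<mu>) = A k * (AA y * \<iota> (weight_in_S \<mu>))"
    using AA_gen_up[OF y up] x by (simp add: mult.assoc)
  also have "AA y * \<iota> (weight_in_S \<mu>) = \<iota> (weight_in_S (fst y \<mu>)) * AA y +
      (\<Sum>c\<in>?Y. ?t c * AA (waf_mult y (root_reflection c)))"
    using Suc.hyps(1)[OF _ y] ly by simp
  also have "A k * \<dots> = A k * \<iota> (weight_in_S (fst y \<mu>)) * AA y +
      (\<Sum>c\<in>?Y. ?t c * (A k * AA (waf_mult y (root_reflection c))))"
    by (simp add: distrib_left sum_distrib_left com mult.assoc)
  \<comment> \<open>The inhomogeneous part of the commutation relation supplies the one new cocover
    \<open>y\<close> of \<open>x\<close>; its coefficient is the pairing with the coroot of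
    \<open>a\<close> by \<open>ta\<close>.\<close>
  also have "A k * \<iota> (weight_in_S (fst y \<mu>)) * AA y =
      \<iota> (weight_in_S (fst x \<mu>)) * AA x + ?t a * AA (waf_mult x (root_reflection a))"
    using a(3) AA_gen_up[OF y up]
    by (simp add: commutation distrib_right ta x waf_mult_def[of "affine_generator k" y] mult.assoc)
  also have "(\<Sum>c\<in>?Y. ?t c * (A k * AA (waf_mult y (root_reflection c)))) =
      (\<Sum>c\<in>?Y. if ?P c then ?t c * AA (waf_mult x (root_reflection c)) else 0)"
    by (intro sum.cong) (auto simp: step)
  also have "\<dots> = (\<Sum>c\<in>{c \<in> ?Y. ?P c}. ?t c * AA (waf_mult x (root_reflection c)))"
    using fin by (simp add: sum.inter_filter)
  also have "\<iota> (weight_in_S (fst x \<mu>)) * AA x + ?t a * AA (waf_mult x (root_reflection a)) + \<dots> =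
      \<iota> (weight_in_S (fst x \<mu>)) * AA x + (\<Sum>c\<in>aff.cocover_roots x. ?t c * AA (waf_mult x (root_reflection c)))"
    unfolding cov using a(5) fin by (simp add: add.assoc)
  finally show ?case .
qed

text \<open>All cocover roots of a chamber element have finite part -v\<alpha>, so both sums appear
  with a minus sign. Pulling the weight back by \<open>v\<close> makes the coefficients those of the
  quantum Chevalley rule.\<close>

lemma AA_chamber_commutation:
  fixes \<nu> :: "'i weight"
  assumes v: "v \<in> weyl_group" and u: "u \<in> weyl_group" and lam: "deep 4 lam"
  defines "\<mu> \<equiv> inv v \<nu>"
  shows "AA (chamber_element v u lam) * \<iota> (weight_in_S \<nu>) =
    \<iota> (weight_in_S (u \<mu>)) * AA (chamber_element v u lam) -
    edge_sum (quantum_edge u) (\<lambda>\<alpha> k.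
        of_int (pairing (coroot \<alpha>) \<mu>) * AA (chamber_element v (u \<circ> reflection \<alpha>) (lam + k *s coroot \<alpha>))) -
    edge_sum (\<lambda>\<alpha>. quantum_edge (v \<circ> reflection \<alpha>) \<alpha>) (\<lambda>\<alpha> k.
        of_int (pairing (coroot \<alpha>) \<mu>) * AA (chamber_element (v \<circ> reflection \<alpha>) u (lam + k *s coroot \<alpha>)))"
proof -
  let ?x = "chamber_element v u lam"
  have fx: "fst ?x \<nu> = u \<mu>" by (simp add: chamber_element_def \<mu>_def)
  have p: "pairing (coroot (- v \<alpha>)) \<nu> = - pairing (coroot \<alpha>) \<mu>" if "\<alpha> \<in> positive_roots" for \<alpha>
  proof -
    have r: "\<alpha> \<in> roots" using positive_is_root that .
    then have "pairing (coroot (v \<alpha>)) (v \<mu>) = pairing (coroot \<alpha>) \<mu>" using pairing_coroot_weyl v by blast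
    then show ?thesis using v coroot_minus[OF weyl_root[OF v r]] by (simp add: \<mu>_def pairing_minus_left)
  qed
  have near: "waf_mult ?x (root_reflection (- v \<alpha>, - pairing lam \<alpha> - k)) =
      chamber_element v (u \<circ> reflection \<alpha>) (lam + k *s coroot \<alpha>)" if "\<alpha> \<in> positive_roots" for \<alpha> k
  proof -
    have "lam - (pairing lam \<alpha> + (- pairing lam \<alpha> - k)) *s coroot \<alpha> = lam + k *s coroot \<alpha>"
      by (simp add: vec_eq_iff)
    then show ?thesis by (simp only: chamber_element_reflect(1)[OF v positive_is_root[OF that]])
  qed
  have far: "waf_mult ?x (root_reflection (- v \<alpha>, k)) =
      chamber_element (v \<circ> reflection \<alpha>) u (lam + k *s coroot \<alpha>)" if "\<alpha> \<in> positive_roots" for \<alpha> k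
    using chamber_element_reflect(2)[OF v positive_is_root[OF that]] .
  define f where "f a = of_int (pairing (coroot (fst a)) \<nu>) * AA (waf_mult ?x (root_reflection a))" for a
  have near_sum: "edge_sum (quantum_edge u) (\<lambda>\<alpha> k. f (- v \<alpha>, - pairing lam \<alpha> - k)) =
    - edge_sum (quantum_edge u) (\<lambda>\<alpha> k.
        of_int (pairing (coroot \<alpha>) \<mu>) * AA (chamber_element v (u \<circ> reflection \<alpha>) (lam + k *s coroot \<alpha>)))"
    unfolding sum_negf[symmetric]
    by (intro sum.cong HOL.refl) (simp add: f_def p near del: insert_iff)
  have far_sum: "edge_sum (\<lambda>\<alpha>. quantum_edge (v \<circ> reflection \<alpha>) \<alpha>) (\<lambda>\<alpha> k.
        f (- v \<alpha>, k)) =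
    - edge_sum (\<lambda>\<alpha>. quantum_edge (v \<circ> reflection \<alpha>) \<alpha>) (\<lambda>\<alpha> k.
        of_int (pairing (coroot \<alpha>) \<mu>) * AA (chamber_element (v \<circ> reflection \<alpha>) u (lam + k *s coroot \<alpha>)))"
    unfolding sum_negf[symmetric]
    by (intro sum.cong HOL.refl) (simp add: f_def p far del: insert_iff)
  have "AA ?x * \<iota> (weight_in_S \<nu>) = \<iota> (weight_in_S (u \<mu>)) * AA ?x + (\<Sum>a\<in>aff.cocover_roots ?x. f a)"
    using AA_commutation[OF chamber_element_closed[OF v u], of lam \<nu>] by (simp only: fx f_def)
  moreover have "x + (- y + - z) = x - y - z" for x y z :: 'a by simp
  ultimately show ?thesis
    by (simp only: sum_cocover_roots[OF v u lam] near_sum far_sum)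
qed

lemma centralizerI:
  assumes "\<And>i. a * \<iota> (var_poly i) = \<iota> (var_poly i) * a"
  shows "a \<in> centralizer"
proof -
  have mult: "a * \<iota> (s * t) = \<iota> (s * t) * a" if "a * \<iota> s = \<iota> s * a" "a * \<iota> t = \<iota> t * a" for s t
  proof -
    have "a * (\<iota> s * \<iota> t) = \<iota> s * (a * \<iota> t)" by (simp only: mult.assoc[symmetric] that(1))
    also have "\<dots> = \<iota> s * \<iota> t * a" by (simp only: mult.assoc that(2))
    finally show ?thesis by (simp only: scalar_simps(3))
  qed
  have pow: "a * \<iota> (var_poly i ^ n) = \<iota> (var_poly i ^ n) * a" for i n
  proof (induction n)
    case (Suc n)
    then show ?case using mult[of "var_poly i" "var_poly i ^ n"] assms by simp
  qed (simp add: scalar_simps)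
  have prod: "a * \<iota> (\<Prod>i\<in>X. var_poly i ^ f i) = \<iota> (\<Prod>i\<in>X. var_poly i ^ f i) * a" for X :: "'i set" and f
    by (induction X rule: infinite_finite_induct) (simp_all add: scalar_simps(1) mult pow)
  have "a * \<iota> s = \<iota> s * a" for s
  proof -
    have 1: "Poly_Mapping.single m c = of_int c * (\<Prod>i\<in>UNIV. var_poly i ^ Poly_Mapping.lookup m i)"
      for m :: "'i \<Rightarrow>\<^sub>0 nat" and c :: int
      unfolding prod_var_poly sum_single_lookup by (rule single_eq_const_mult)
    have "a * \<iota> (Poly_Mapping.single m c) = \<iota> (Poly_Mapping.single m c) * a" for m c
      unfolding 1 by (rule mult[OF _ prod]) (simp add: scalar_simps mult_of_int_commute)
    then have "a * \<iota> (support_sum Poly_Mapping.single s) = \<iota> (support_sum Poly_Mapping.single s) * a"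
      by (simp add: support_sum_def scalar_simps sum_distrib_left sum_distrib_right)
    then show ?thesis by (simp add: support_sum_singles)
  qed
  then show ?thesis by (simp add: centralizer_def)
qed

end


section \<open>Superregular elements and near Bruhat operators\<close>

context root_datum
begin

abbreviation regularity :: int where "regularity \<equiv> 2 * int (card weyl_group) + 2"

lemma regularity_ge: "regularity \<ge> 4"
proof -
  have "card weyl_group \<noteq> 0" using finite_weyl_group weyl_group.one by auto
  then show ?thesis by linarith
qed

lemma deep_antidominant: "deep 0 lam \<Longrightarrow> antidominant lam"
  unfolding deep_def antidominant_def using simple_root_positive by (metis minus_zero order_less_imp_le)

lemma translation_eq_chamber_element:
  "v \<in> weyl_group \<Longrightarrow> translation (act_coweight v lam) = chamber_element v v lam"
  by (simp add: translation_def chamber_element_def weyl_comp_inv)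

text \<open>Strict negativity makes \<lambda> regular. A second chamber would differ from
  \<open>v\<close> by a nontrivial element, which sends some simple root to a negative root, and
  \<lambda> is positive there.\<close>

lemma chamber_act_coweight:
  assumes v: "v \<in> weyl_group" and lam: "deep 0 lam"
  shows "chamber (act_coweight v lam) = v" "antidominant_part (act_coweight v lam) = lam"
proof -
  show "chamber (act_coweight v lam) = v" unfolding chamber_def
  proof (rule the_equality)
    show "v \<in> weyl_group \<and> antidominant (act_coweight (inv v) (act_coweight v lam))"
      using v deep_antidominant[OF lam] by simp
    fix w assume w: "w \<in> weyl_group \<and> antidominant (act_coweight (inv w) (act_coweight v lam))"
    let ?u = "inv v \<circ> w"
    have u: "?u \<in> weyl_group" using w v weyl_comp weyl_inv by blast
    have "?u = id"
    proof (rule ccontr)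
      assume "?u \<noteq> id"
      then obtain i where i: "?u (simple_root i) \<notin> positive_roots" using weyl_not_id_descent[OF u] by blast
      have "- ?u (simple_root i) \<in> positive_roots"
        using i uminus_positive_root_iff[OF weyl_root[OF u simple_root_root]] by blast
      then have "pairing lam (- ?u (simple_root i)) < 0" using lam by (auto simp: deep_def)
      moreover have "pairing (act_coweight (inv w) (act_coweight v lam)) (simple_root i) = pairing lam (?u (simple_root i))"
        using w v by (simp add: pairing_act_inv pairing_act_coweight)
      moreover have "pairing (act_coweight (inv w) (act_coweight v lam)) (simple_root i) \<le> 0"
        using w unfolding antidominant_def by blast
      ultimately show False by (simp only: pairing_minus_right)
    qed
    then have "v \<circ> (inv v \<circ> w) = v" by simp
    then show "w = v" using v by (simp add: comp_assoc[symmetric] weyl_comp_inv)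
  qed
  then show "antidominant_part (act_coweight v lam) = lam" using v by (simp add: antidominant_part_def)
qed

lemma deep_imp_superregular:
  assumes v: "v \<in> weyl_group" and u: "u \<in> weyl_group" and lam: "deep regularity lam"
  shows "chamber_element v u lam \<in> superregular_elements"
proof -
  have "\<bar>pairing (act_coweight v lam) \<alpha>\<bar> > regularity" if "\<alpha> \<in> positive_roots" for \<alpha>
  proof -
    let ?b = "inv v \<alpha>"
    have b: "?b \<in> roots" using weyl_root weyl_inv v positive_is_root that by blast
    have "\<bar>pairing lam ?b\<bar> > regularity"
    proof (cases "?b \<in> positive_roots")
      case True
      then have "pairing lam ?b < - regularity" using lam unfolding deep_def by blast
      then show ?thesis by linarith
    next
      case False
      then have "pairing lam (- ?b) < - regularity"
        using lam uminus_positive_root_iff[OF b] unfolding deep_def by blast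
      then show ?thesis by (simp add: pairing_minus_right)
    qed
    then show ?thesis using v by (simp add: pairing_act_coweight)
  qed
  then show ?thesis using chamber_element_closed[OF v u]
    by (simp add: superregular_elements_def superregular_def chamber_element_def)
qed

lemma cocover_iff:
  assumes x: "x \<in> affine_weyl_group" and a: "a \<in> positive_affine_roots"
  shows "cocover (waf_mult x (root_reflection a)) x \<longleftrightarrow> a \<in> aff.cocover_roots x"
proof
  assume "cocover (waf_mult x (root_reflection a)) x"
  then show "a \<in> aff.cocover_roots x"
    using a by (simp add: cocover_def aff.cocover_roots_def affine_length_def)
next
  assume c: "a \<in> aff.cocover_roots x"
  then have l: "affine_length x = Suc (affine_length (waf_mult x (root_reflection a)))"
    by (simp add: aff.cocover_roots_def affine_length_def)
  have "fst a \<in> roots" using a by (auto simp: positive_affine_roots_def)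
  then have "bruhat_step (waf_mult x (root_reflection a)) x"
    using x l unfolding bruhat_step_def root_reflection_def by auto
  then show "cocover (waf_mult x (root_reflection a)) x"
    using l by (simp add: cocover_def bruhat_less_def)
qed

text \<open>Near cocovers are defined by reflections in v\<alpha> + n\<delta> with negative
  \<open>n\<close>. The negative of this root is the positive one that is inverted, and in terms of
  it the cocovers are already classified.\<close>

lemma near_cocover_chamber_element:
  assumes v: "v \<in> weyl_group" and u: "u \<in> weyl_group" and lam: "deep 4 lam" and \<alpha>: "\<alpha> \<in> positive_roots"
  shows "near_cocover (chamber_element v u lam) \<alpha> n \<longleftrightarrow>
    (\<exists>k\<in>{0, 1}. n = pairing lam \<alpha> + k \<and> quantum_edge u \<alpha> k)"
    and "waf_mult (chamber_element v u lam) (affine_reflection (v \<alpha>) (pairing lam \<alpha> + k)) =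
      chamber_element v (u \<circ> reflection \<alpha>) (lam + k *s coroot \<alpha>)"
proof -
  let ?x = "chamber_element v u lam"
  have r: "\<alpha> \<in> roots" using positive_is_root \<alpha> .
  have vr: "v \<alpha> \<in> roots" using weyl_root v r .
  have d0: "deep 0 lam" using lam deep_mono[of 4] by simp
  have xG: "?x \<in> affine_weyl_group" using chamber_element_closed v u by blast
  have refl: "affine_reflection (v \<alpha>) n = root_reflection (- v \<alpha>, - n)" for n
    using vr by (simp add: root_reflection_def affine_reflection_def reflection_minus coroot_minus vec_eq_iff)
  have eq: "waf_mult ?x (affine_reflection (v \<alpha>) (pairing lam \<alpha> + k)) =
      chamber_element v (u \<circ> reflection \<alpha>) (lam + k *s coroot \<alpha>)" for k
  proof -
    have "lam - (pairing lam \<alpha> + - (pairing lam \<alpha> + k)) *s coroot \<alpha> = lam + k *s coroot \<alpha>"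
      by (simp add: vec_eq_iff)
    then show ?thesis by (simp only: refl chamber_element_reflect(1)[OF v r])
  qed
  then show "waf_mult ?x (affine_reflection (v \<alpha>) (pairing lam \<alpha> + k)) =
      chamber_element v (u \<circ> reflection \<alpha>) (lam + k *s coroot \<alpha>)" .
  have fin: "chamber_element v (u \<circ> reflection \<alpha>) l = (fst ?x \<circ> reflection (v \<alpha>), act_coweight v l)" for l
    using v reflection_weyl[OF v r]
    by (simp add: chamber_element_def fun_eq_iff) (metis weyl_apply_inv weyl_inv_apply)
  have ch: "chamber (snd ?x) = v" "antidominant_part (snd ?x) = lam"
    using chamber_act_coweight[OF v d0] by (simp_all add: chamber_element_def)
  have cov: "cocover (waf_mult ?x (affine_reflection (v \<alpha>) (pairing lam \<alpha> + k))) ?x \<longleftrightarrow> quantum_edge u \<alpha> k"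
    if k: "k \<in> {0, 1}" for k
  proof -
    have "(- v \<alpha>, - pairing lam \<alpha> - k) \<in> positive_affine_roots"
      using lam \<alpha> k by (auto simp: deep_def neg_root_affine_positive vr sign_bit_def)
    then show ?thesis
      using cocover_iff[OF xG, of "(- v \<alpha>, - pairing lam \<alpha> - k)"] near_cocover_root_iff[OF v u lam \<alpha> k]
      by (simp add: refl)
  qed
  have eqs: "waf_mult ?x (affine_reflection (v \<alpha>) (pairing lam \<alpha>)) = (fst ?x \<circ> reflection (v \<alpha>), act_coweight v lam)"
    "waf_mult ?x (affine_reflection (v \<alpha>) (pairing lam \<alpha> + 1)) = (fst ?x \<circ> reflection (v \<alpha>), act_coweight v (lam + coroot \<alpha>))"
    using eq[of 0] eq[of 1] fin by simp_all
  show "near_cocover ?x \<alpha> n \<longleftrightarrow> (\<exists>k\<in>{0, 1}. n = pairing lam \<alpha> + k \<and> quantum_edge u \<alpha> k)"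
    unfolding near_cocover_def Let_def ch using eqs cov[of 0] cov[of 1] by auto
qed

lemma near_bruhat_basis_chamber_element:
  assumes v: "v \<in> weyl_group" and u: "u \<in> weyl_group" and lam: "deep 4 lam"
  shows "near_bruhat_basis \<mu> (chamber_element v u lam) =
    Poly_Mapping.single (chamber_element v u lam) (weight_in_S (\<mu> - u \<mu>)) +
    edge_sum (quantum_edge u) (\<lambda>\<alpha> k.
        Poly_Mapping.single (chamber_element v (u \<circ> reflection \<alpha>) (lam + k *s coroot \<alpha>)) (of_int (pairing (coroot \<alpha>) \<mu>)))"
proof -
  let ?x = "chamber_element v u lam"
  have d0: "deep 0 lam" using lam deep_mono[of 4] by simp
  have ch: "chamber (snd ?x) = v" using chamber_act_coweight[OF v d0] by (simp add: chamber_element_def)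
  have w: "fst ?x (v \<mu>) = u \<mu>" using v by (simp add: chamber_element_def)
  have "(\<Sum>n | near_cocover ?x \<alpha> n. g (waf_mult ?x (affine_reflection (v \<alpha>) n))) =
      (\<Sum>k\<in>{0, 1}. if quantum_edge u \<alpha> k then
        g (chamber_element v (u \<circ> reflection \<alpha>) (lam + k *s coroot \<alpha>)) else 0)"
    if \<alpha>: "\<alpha> \<in> positive_roots" for \<alpha> and g :: "'i waf \<Rightarrow> 'i waf \<Rightarrow>\<^sub>0 'i S"
  proof -
    have set: "{n. near_cocover ?x \<alpha> n} = (\<lambda>k. pairing lam \<alpha> + k) ` {k \<in> {0, 1}. quantum_edge u \<alpha> k}"
      unfolding near_cocover_chamber_element(1)[OF v u lam \<alpha>] by blast
    have "(\<Sum>n | near_cocover ?x \<alpha> n. g (waf_mult ?x (affine_reflection (v \<alpha>) n))) =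
        (\<Sum>k\<in>{k \<in> {0, 1}. quantum_edge u \<alpha> k}. g (waf_mult ?x (affine_reflection (v \<alpha>) (pairing lam \<alpha> + k))))"
      unfolding set by (subst sum.reindex) (simp_all only: inj_on_def add_left_cancel o_def simp_thms ball_simps)
    also have "\<dots> = (\<Sum>k\<in>{0, 1}. if quantum_edge u \<alpha> k then
        g (waf_mult ?x (affine_reflection (v \<alpha>) (pairing lam \<alpha> + k))) else 0)"
      by (rule sum.inter_filter) simp
    finally show ?thesis by (simp only: near_cocover_chamber_element(2)[OF v u lam \<alpha>])
  qed
  note 1 = this
  show ?thesis unfolding near_bruhat_basis_def Let_def ch w
  proof (rule arg_cong2[of _ _ _ _ "(+)", OF HOL.refl], rule sum.cong[OF HOL.refl])
    fix \<alpha> assume "\<alpha> \<in> positive_roots"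
    from 1[OF this, of "\<lambda>y. Poly_Mapping.single y (of_int (pairing (coroot \<alpha>) \<mu>) :: 'i S)"]
    show "(\<Sum>n | near_cocover ?x \<alpha> n. Poly_Mapping.single (waf_mult ?x (affine_reflection (v \<alpha>) n))
          (of_int (pairing (coroot \<alpha>) \<mu>) :: 'i S)) =
        (\<Sum>k\<in>{0, 1}. if quantum_edge u \<alpha> k then
          Poly_Mapping.single (chamber_element v (u \<circ> reflection \<alpha>) (lam + k *s coroot \<alpha>))
            (of_int (pairing (coroot \<alpha>) \<mu>) :: 'i S) else 0)" .
  qed
qed

lemma near_bruhat_operator_support_sum:
  "near_bruhat_operator \<mu> f =
    support_sum (\<lambda>x c. if x \<in> superregular_elements then scale_poly c (near_bruhat_basis \<mu> x) else 0) f"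
  unfolding near_bruhat_operator_def support_sum_def by (rule sum.inter_restrict) simp

lemma near_bruhat_operator_add:
  "near_bruhat_operator \<mu> (f + g) = near_bruhat_operator \<mu> f + near_bruhat_operator \<mu> g"
  unfolding near_bruhat_operator_support_sum
  by (rule support_sum_add) (simp_all add: scale_poly_zero_left scale_poly_add_left)

lemma near_bruhat_operator_zero: "near_bruhat_operator \<mu> 0 = 0"
  unfolding near_bruhat_operator_support_sum by simp

lemma near_bruhat_operator_sum:
  "near_bruhat_operator \<mu> (\<Sum>y\<in>Y. f y) = (\<Sum>y\<in>Y. near_bruhat_operator \<mu> (f y))"
  by (induction Y rule: infinite_finite_induct)
    (simp_all add: near_bruhat_operator_add near_bruhat_operator_zero)

text \<open>The depth \<open>regularity\<close> guarantees that the input is superregular, so the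
  convention by which the operator kills other basis elements does not interfere.\<close>

lemma near_bruhat_operator_single:
  assumes v: "v \<in> weyl_group" and u: "u \<in> weyl_group" and lam: "deep regularity lam"
  shows "near_bruhat_operator \<mu> (Poly_Mapping.single (chamber_element v u lam) c) =
    Poly_Mapping.single (chamber_element v u lam) (c * weight_in_S (\<mu> - u \<mu>)) +
    edge_sum (quantum_edge u) (\<lambda>\<alpha> k.
        Poly_Mapping.single (chamber_element v (u \<circ> reflection \<alpha>) (lam + k *s coroot \<alpha>)) (c * of_int (pairing (coroot \<alpha>) \<mu>)))"
proof -
  have 4: "deep 4 lam" using deep_mono[OF lam regularity_ge] .
  have if_scale: "scale_poly c (if P then p else 0) = (if P then scale_poly c p else 0)"
    for P and p :: "'i waf \<Rightarrow>\<^sub>0 'i S" by (simp add: scale_poly_zero)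
  show ?thesis
    unfolding near_bruhat_operator_support_sum
    by (subst support_sum_single)
      (simp_all only: deep_imp_superregular[OF assms] near_bruhat_basis_chamber_element[OF v u 4]
        scale_poly_add scale_poly_sum if_scale scale_poly_single scale_poly_zero_left if_True if_cancel
        mult_zero_left single_zero sum.neutral_const add_0_left)
qed

text \<open>If \<open>m = \<langle>\<lambda>, \<alpha>\<^sub>i\<rangle>\<close> is not very negative, then \<open>r\<^sub>i t\<^sub>\<lambda>\<^sub>+\<^sub>p\<^sub>\<alpha>\<close> with \<open>\<alpha> = \<alpha>\<^sub>i\<^sup>\<or>\<close> and \<open>p = \<lfloor>-m/2\<rfloor>\<close> is not
  superregular, is smaller than \<open>t\<^sub>\<lambda>\<close>, and its length is not much smaller.\<close>

lemma sufficiently_superregular_deep: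
  "\<exists>k>0. \<forall>lam. antidominant lam \<and> sufficiently_superregular_coweight k lam \<longrightarrow> deep n lam"
proof -
  \<comment> \<open>The non-superregular element below is obtained by one reflection in an affine
    root with finite part minus a simple root and index between 0 and \<open>n\<close>. The length
    drop is at most the length of that reflection, so the sum over all of them, plus one for the
    strict inequality, is a bound independent of \<open>lam\<close>.\<close>
  define k where "k = Suc (\<Sum>i\<in>UNIV. \<Sum>j\<in>{0..n}. affine_length (root_reflection (- simple_root i, j)))"
  have "deep n lam" if anti: "antidominant lam" and suff: "sufficiently_superregular_coweight k lam" for lam
  proof -
    let ?x = "chamber_element id id lam"
    have one: "id \<in> weyl_group" by (rule weyl_group.one)
    have xG: "?x \<in> affine_weyl_group" using chamber_element_closed[OF one one] .
    have x: "translation (act_coweight id lam) = ?x" by (rule translation_eq_chamber_element[OF one])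
    have suff_x: "sufficiently_superregular k ?x"
      using suff one x unfolding sufficiently_superregular_coweight_def by metis
    have "superregular lam"
      using suff_x by (simp add: sufficiently_superregular_def superregular_elements_def chamber_element_def)
    then have reg: "pairing lam \<alpha> < - regularity" if "\<alpha> \<in> positive_roots" for \<alpha>
      using antidominant_pairing[OF anti that] that by (force simp: superregular_def)
    then have lam4: "deep 4 lam" using regularity_ge by (force simp: deep_def)
    have d0: "deep 0 lam" using deep_mono[OF lam4] by simp
    have simple: "pairing lam (simple_root i) \<le> - (n + 1)" for i
    proof (rule ccontr)
      assume not: "\<not> ?thesis"
      define p where "p = (- pairing lam (simple_root i)) div 2"
      define j where "j = - pairing lam (simple_root i) - p"
      let ?a = "(- simple_root i, j)"
      let ?y = "waf_mult ?x (root_reflection ?a)"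
      have m: "pairing lam (simple_root i) < - 4" using lam4 simple_root_positive by (auto simp: deep_def)
      have j: "1 \<le> j" "j \<le> - pairing lam (simple_root i)" "j \<le> n" using m not by (auto simp: j_def p_def)
      have "?a \<in> (\<lambda>(\<alpha>, n). (- id \<alpha>, n)) ` (SIGMA \<alpha>:positive_roots. {1 - sign_bit (id \<alpha>)..- pairing lam \<alpha> - sign_bit (id \<alpha>)})"
        using j simple_root_positive by (intro image_eqI[of _ _ "(simple_root i, j)"]) (auto simp: sign_bit_def)
      then have inv: "?a \<in> aff.inversions ?x" using chamber_element_inversions[OF one one d0] by simp
      then have aP: "?a \<in> positive_affine_roots" and neg: "affine_action ?x ?a \<notin> positive_affine_roots"
        by (auto simp: aff.inversions_def)
      have aR: "?a \<in> affine_roots" using aff.Pos_root aP by blast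
      have less: "affine_length ?y < affine_length ?x"
        unfolding affine_length_def by (rule aff.len_refl_less[OF xG aP neg])
      have "bruhat_step ?y ?x" unfolding bruhat_step_def
        using xG less root_minus[OF simple_root_root] by (auto simp: root_reflection_def)
      then have below: "bruhat_less ?y ?x" by (simp add: bruhat_less_def)
      have rG: "root_reflection ?a \<in> affine_weyl_group" using aff.refl_closed[OF aR] .
      have "affine_length (waf_mult ?y (root_reflection ?a)) \<le> affine_length ?y + affine_length (root_reflection ?a)"
        unfolding affine_length_def using aff.len_mult_le[OF aff.mult_closed[OF xG rG] rG] .
      then have "affine_length ?x \<le> affine_length ?y + affine_length (root_reflection ?a)"
        by (simp only: aff.refl_cancel[OF xG aR])
      also have "affine_length (root_reflection ?a) \<le> (\<Sum>j\<in>{0..n}. affine_length (root_reflection (- simple_root i, j)))"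
        using j by (intro member_le_sum) auto
      also have "\<dots> \<le> (\<Sum>i\<in>UNIV. \<Sum>j\<in>{0..n}. affine_length (root_reflection (- simple_root i, j)))"
        by (rule member_le_sum[of i UNIV "\<lambda>i. \<Sum>j\<in>{0..n}. affine_length (root_reflection (- simple_root i, j))"]) auto
      finally have "affine_length ?x - affine_length ?y < k"
        unfolding k_def less_Suc_eq_le le_diff_conv by (simp only: add.commute)
      then have "?y \<in> superregular_elements" using suff_x below unfolding sufficiently_superregular_def by blast
      moreover have "?y = chamber_element id (id \<circ> reflection (simple_root i)) (lam + p *s simple_coroot i)"
      proof -
        have e: "lam - (pairing lam (simple_root i) + j) *s simple_coroot i = lam + p *s simple_coroot i"
          by (simp add: j_def vec_eq_iff)
        show ?thesis
          using chamber_element_reflect(1)[OF one simple_root_root, of id lam i j]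
          by (simp only: coroot_simple_root e id_apply)
      qed
      ultimately have "superregular (lam + p *s simple_coroot i)"
        by (simp add: superregular_elements_def chamber_element_def)
      then have "\<bar>pairing (lam + p *s simple_coroot i) (simple_root i)\<bar> > regularity"
        using simple_root_positive by (simp add: superregular_def)
      moreover have "\<bar>pairing (lam + p *s simple_coroot i) (simple_root i)\<bar> \<le> 1"
        by (simp add: pairing_add_left pairing_scale_left simple_root_nth diagonal p_def)
      ultimately show False using regularity_ge by linarith
    qed
    show ?thesis unfolding deep_def
    proof
      fix \<alpha> assume "\<alpha> \<in> positive_roots"
      show "pairing lam \<alpha> < - n"
      proof (cases "n \<ge> 0")
        case True
        then show ?thesis
          using pairing_positive_root_le[OF \<open>\<alpha> \<in> positive_roots\<close>, of lam "n + 1"] simple by force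
      next
        case False
        then show ?thesis using antidominant_pairing[OF anti \<open>\<alpha> \<in> positive_roots\<close>] by simp
      qed
    qed
  qed
  moreover have "k > 0" by (simp add: k_def)
  ultimately show ?thesis by blast
qed

end

section \<open>Quantum cohomology in coordinates\<close>

definition exponent_coweight :: "('i::finite \<Rightarrow>\<^sub>0 nat) \<Rightarrow> 'i coweight" where
  "exponent_coweight m = (\<chi> i. int (Poly_Mapping.lookup m i))"

definition coweight_exponent :: "('i::finite) coweight \<Rightarrow> ('i \<Rightarrow>\<^sub>0 nat)" where
  "coweight_exponent lam = (\<Sum>i\<in>UNIV. Poly_Mapping.single i (nat (lam $ i)))"

lemma exponent_coweight_add: "exponent_coweight (m + n) = exponent_coweight m + exponent_coweight n"
  by (simp add: exponent_coweight_def vec_eq_iff lookup_add)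

lemma exponent_coweight_zero [simp]: "exponent_coweight 0 = 0"
  by (simp add: exponent_coweight_def vec_eq_iff)

lemma exponent_coweight_exponent:
  "(\<And>i. lam $ i \<ge> 0) \<Longrightarrow> exponent_coweight (coweight_exponent lam) = lam"
  by (simp add: exponent_coweight_def coweight_exponent_def vec_eq_iff lookup_sum lookup_single when_def)

lemma q_monomial_eq: "q_monomial lam = Poly_Mapping.single (coweight_exponent lam) 1"
  by (simp add: q_monomial_def prod_var_poly coweight_exponent_def)

lemma q_monomial_zero [simp]: "q_monomial 0 = 1"
  by (simp add: q_monomial_def)

context quantum_cohomology
begin

lemmas kappa_simps = is_ring_hom_simps[OF quantum_scalars]

definition coord :: "'q \<Rightarrow> 'i weyl \<Rightarrow>\<^sub>0 'i Sq" where
  "coord z = (THE c. Poly_Mapping.keys c \<subseteq> weyl_group \<and> z = support_sum (\<lambda>u p. \<kappa> p * \<sigma> u) c)"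

lemma coord_ex1:
  "\<exists>!c. Poly_Mapping.keys c \<subseteq> weyl_group \<and> z = support_sum (\<lambda>u p. \<kappa> p * \<sigma> u) c"
  using quantum_schubert_basis unfolding is_left_basis_def support_sum_def by blast

lemma coord_keys: "Poly_Mapping.keys (coord z) \<subseteq> weyl_group"
  and coord_sum: "z = support_sum (\<lambda>u p. \<kappa> p * \<sigma> u) (coord z)"
  using theI'[OF coord_ex1, of z, folded coord_def] by auto

lemma coord_eqI:
  "Poly_Mapping.keys c \<subseteq> weyl_group \<Longrightarrow> z = support_sum (\<lambda>u p. \<kappa> p * \<sigma> u) c \<Longrightarrow> coord z = c"
  unfolding coord_def by (rule the1_equality[OF coord_ex1]) blast

lemma coord_add: "coord (y + z) = coord y + coord z"
proof (rule coord_eqI)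
  show "Poly_Mapping.keys (coord y + coord z) \<subseteq> weyl_group"
    by (rule order_trans[OF keys_add]) (simp add: coord_keys)
  show "y + z = support_sum (\<lambda>u p. \<kappa> p * \<sigma> u) (coord y + coord z)"
  proof -
    have "support_sum (\<lambda>u p. \<kappa> p * \<sigma> u) (coord y + coord z) =
        support_sum (\<lambda>u p. \<kappa> p * \<sigma> u) (coord y) + support_sum (\<lambda>u p. \<kappa> p * \<sigma> u) (coord z)"
      by (rule support_sum_add) (simp_all add: kappa_simps distrib_right)
    then show ?thesis by (simp only: coord_sum[symmetric])
  qed
qed

lemma coord_zero [simp]: "coord 0 = 0"
  by (rule coord_eqI) simp_all

lemma coord_term: "u \<in> weyl_group \<Longrightarrow> coord (\<kappa> p * \<sigma> u) = Poly_Mapping.single u p"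
  by (rule coord_eqI) (auto simp: support_sum_single kappa_simps)

text \<open>Induction over the monomials that actually occur in \<open>z\<close>. The restriction
  matters: depth is known only for the coweights coming from these monomials.\<close>

lemma coord_induct [consumes 0, case_names zero add monom]:
  assumes zero: "P 0" and add: "\<And>x y. P x \<Longrightarrow> P y \<Longrightarrow> P (x + y)"
    and monom: "\<And>u m c. u \<in> Poly_Mapping.keys (coord z) \<Longrightarrow> u \<in> weyl_group \<Longrightarrow>
      m \<in> Poly_Mapping.keys (Poly_Mapping.lookup (coord z) u) \<Longrightarrow> P (\<kappa> (Poly_Mapping.single m c) * \<sigma> u)"
  shows "P z"
proof -
  have "P (\<kappa> (Poly_Mapping.lookup (coord z) u) * \<sigma> u)" if u: "u \<in> Poly_Mapping.keys (coord z)" for u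
  proof -
    let ?p = "Poly_Mapping.lookup (coord z) u"
    have uW: "u \<in> weyl_group" using u coord_keys by blast
    have "\<kappa> ?p * \<sigma> u = \<kappa> (support_sum Poly_Mapping.single ?p) * \<sigma> u" by (simp add: support_sum_singles)
    also have "\<dots> = (\<Sum>m\<in>Poly_Mapping.keys ?p. \<kappa> (Poly_Mapping.single m (Poly_Mapping.lookup ?p m)) * \<sigma> u)"
      by (simp add: support_sum_def kappa_simps sum_distrib_right)
    finally have eq: "\<kappa> ?p * \<sigma> u =
        (\<Sum>m\<in>Poly_Mapping.keys ?p. \<kappa> (Poly_Mapping.single m (Poly_Mapping.lookup ?p m)) * \<sigma> u)" .
    show ?thesis unfolding eq
    proof (rule sum_closed[of P])
      show "P (\<kappa> (Poly_Mapping.single m (Poly_Mapping.lookup ?p m)) * \<sigma> u)"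
        if "m \<in> Poly_Mapping.keys ?p" for m
        by (rule monom[OF u uW that])
    qed (fact zero, fact add)
  qed
  then have "P (support_sum (\<lambda>u p. \<kappa> p * \<sigma> u) (coord z))" unfolding support_sum_def
    by (intro sum_closed[of P, OF zero add])
  then show ?thesis using coord_sum[of z] by simp
qed

section \<open>The dictionary between quantum cohomology and a chamber\<close>

definition chamber_lift :: "'i weyl \<Rightarrow> 'i coweight \<Rightarrow> 'q \<Rightarrow> 'i waf \<Rightarrow>\<^sub>0 'i S" where
  "chamber_lift v lam z = support_sum (\<lambda>u p. support_sum (\<lambda>m c.
     Poly_Mapping.single (chamber_element v u (lam + exponent_coweight m)) c) p) (coord z)"

text \<open>All coweights that the dictionary attaches to \<open>z\<close> are deep. This is a
  condition on the reduced Schubert expansion of \<open>z\<close>, so it has to be requested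
  separately for each product.\<close>

definition admissible :: "int \<Rightarrow> 'i coweight \<Rightarrow> 'q \<Rightarrow> bool" where
  "admissible n lam z \<longleftrightarrow> (\<forall>u\<in>Poly_Mapping.keys (coord z).
     \<forall>m\<in>Poly_Mapping.keys (Poly_Mapping.lookup (coord z) u). deep n (lam + exponent_coweight m))"

lemma chamber_lift_add: "chamber_lift v lam (y + z) = chamber_lift v lam y + chamber_lift v lam z"
  unfolding chamber_lift_def coord_add
  by (rule support_sum_add) (simp, rule support_sum_add, simp_all add: single_add)

lemma chamber_lift_zero [simp]: "chamber_lift v lam 0 = 0"
  by (simp add: chamber_lift_def)

lemma chamber_lift_sum: "chamber_lift v lam (\<Sum>y\<in>Y. f y) = (\<Sum>y\<in>Y. chamber_lift v lam (f y))"
  by (induction Y rule: infinite_finite_induct) (simp_all add: chamber_lift_add)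

lemma chamber_lift_term:
  "u \<in> weyl_group \<Longrightarrow> chamber_lift v lam (\<kappa> (Poly_Mapping.single m c) * \<sigma> u) =
    Poly_Mapping.single (chamber_element v u (lam + exponent_coweight m)) c"
  by (simp add: chamber_lift_def coord_term support_sum_single)

lemma chamber_lift_sigma:
  "u \<in> weyl_group \<Longrightarrow> chamber_lift v lam (\<sigma> u) = Poly_Mapping.single (chamber_element v u lam) 1"
  using chamber_lift_term[of u v lam 0 1] by (simp add: kappa_simps)

lemma chamber_lift_scalar: "chamber_lift v lam (\<kappa> (const_poly s) * z) = scale_poly s (chamber_lift v lam z)"
proof (rule coord_induct[of _ z])
  show "chamber_lift v lam (\<kappa> (const_poly s) * (x + y)) = scale_poly s (chamber_lift v lam (x + y))"
    if "chamber_lift v lam (\<kappa> (const_poly s) * x) = scale_poly s (chamber_lift v lam x)"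
      "chamber_lift v lam (\<kappa> (const_poly s) * y) = scale_poly s (chamber_lift v lam y)" for x y
    by (simp add: distrib_left chamber_lift_add that scale_poly_add)
  fix u m c assume u: "u \<in> weyl_group"
  have "\<kappa> (const_poly s) * (\<kappa> (Poly_Mapping.single m c) * \<sigma> u) = \<kappa> (Poly_Mapping.single m (s * c)) * \<sigma> u"
    by (simp add: mult.assoc[symmetric] kappa_simps(3)[symmetric] const_poly_def mult_single)
  then show "chamber_lift v lam (\<kappa> (const_poly s) * (\<kappa> (Poly_Mapping.single m c) * \<sigma> u)) =
      scale_poly s (chamber_lift v lam (\<kappa> (Poly_Mapping.single m c) * \<sigma> u))"
    by (simp add: chamber_lift_term[OF u] scale_poly_single)
qed (simp add: scale_poly_zero)

text \<open>Quantum parameters act by translating \<lambda>. This is how the shifted base points of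
  \<open>b\<close> arise from the q-monomials of the polynomial.\<close>

lemma chamber_lift_q:
  assumes "\<And>i. d $ i \<ge> 0"
  shows "chamber_lift v lam (\<kappa> (q_monomial d) * z) = chamber_lift v (lam + d) z"
proof (rule coord_induct[of _ z])
  show "chamber_lift v lam (\<kappa> (q_monomial d) * (x + y)) = chamber_lift v (lam + d) (x + y)"
    if "chamber_lift v lam (\<kappa> (q_monomial d) * x) = chamber_lift v (lam + d) x"
      "chamber_lift v lam (\<kappa> (q_monomial d) * y) = chamber_lift v (lam + d) y" for x y
    by (simp add: distrib_left chamber_lift_add that)
  fix u m c assume u: "u \<in> weyl_group"
  have "\<kappa> (q_monomial d) * (\<kappa> (Poly_Mapping.single m c) * \<sigma> u) =
      \<kappa> (Poly_Mapping.single (coweight_exponent d + m) c) * \<sigma> u"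
    by (simp add: mult.assoc[symmetric] kappa_simps(3)[symmetric] q_monomial_eq mult_single)
  then show "chamber_lift v lam (\<kappa> (q_monomial d) * (\<kappa> (Poly_Mapping.single m c) * \<sigma> u)) =
      chamber_lift v (lam + d) (\<kappa> (Poly_Mapping.single m c) * \<sigma> u)"
    by (simp add: chamber_lift_term[OF u] exponent_coweight_add exponent_coweight_exponent[OF assms] add.assoc)
qed simp

definition exponent_bound :: "'q \<Rightarrow> int" where
  "exponent_bound z = (\<Sum>u\<in>Poly_Mapping.keys (coord z).
     \<Sum>m\<in>Poly_Mapping.keys (Poly_Mapping.lookup (coord z) u).
     \<Sum>\<alpha>\<in>positive_roots. \<bar>pairing (exponent_coweight m) \<alpha>\<bar>)"

lemma deep_imp_admissible:
  assumes "deep (n + exponent_bound z) lam" shows "admissible n lam z"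
  unfolding admissible_def deep_def
proof (intro ballI)
  fix u m \<alpha>
  assume u: "u \<in> Poly_Mapping.keys (coord z)" and m: "m \<in> Poly_Mapping.keys (Poly_Mapping.lookup (coord z) u)"
    and \<alpha>: "\<alpha> \<in> positive_roots"
  have "\<bar>pairing (exponent_coweight m) \<alpha>\<bar> \<le> (\<Sum>\<alpha>\<in>positive_roots. \<bar>pairing (exponent_coweight m) \<alpha>\<bar>)"
    using \<alpha> finite_positive_roots by (intro member_le_sum) auto
  also have "\<dots> \<le> (\<Sum>m\<in>Poly_Mapping.keys (Poly_Mapping.lookup (coord z) u).
     \<Sum>\<alpha>\<in>positive_roots. \<bar>pairing (exponent_coweight m) \<alpha>\<bar>)"
    using m by (intro member_le_sum[of m _ "\<lambda>m. \<Sum>\<alpha>\<in>positive_roots. \<bar>pairing (exponent_coweight m) \<alpha>\<bar>"]) (auto intro!: sum_nonneg)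
  also have "\<dots> \<le> exponent_bound z" unfolding exponent_bound_def
    using u by (intro member_le_sum[of u _ "\<lambda>u. \<Sum>m\<in>Poly_Mapping.keys (Poly_Mapping.lookup (coord z) u).
     \<Sum>\<alpha>\<in>positive_roots. \<bar>pairing (exponent_coweight m) \<alpha>\<bar>"]) (auto intro!: sum_nonneg)
  finally have "pairing (exponent_coweight m) \<alpha> \<le> exponent_bound z" by linarith
  moreover have "pairing lam \<alpha> < - (n + exponent_bound z)" using assms \<alpha> unfolding deep_def by blast
  ultimately show "pairing (lam + exponent_coweight m) \<alpha> < - n" by (simp add: pairing_add_left)
qed

lemma quantum_chevalley_edges:
  assumes u: "u \<in> weyl_group"
  shows "\<sigma> (simple_reflection i) * \<sigma> u =
    \<kappa> (const_poly (weight_in_S (fundamental_weight i - u (fundamental_weight i)))) * \<sigma> u +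
    edge_sum (quantum_edge u) (\<lambda>\<alpha> k.
        of_int (pairing (coroot \<alpha>) (fundamental_weight i)) * \<kappa> (q_monomial (k *s coroot \<alpha>)) * \<sigma> (u \<circ> reflection \<alpha>))"
proof -
  let ?t = "\<lambda>\<alpha> k. of_int (pairing (coroot \<alpha>) (fundamental_weight i)) * \<kappa> (q_monomial (k *s coroot \<alpha>)) * \<sigma> (u \<circ> reflection \<alpha>)"
  have "(\<Sum>\<alpha> | \<alpha> \<in> positive_roots \<and> weyl_length (u \<circ> reflection \<alpha>) = weyl_length u + 1.
      of_int (pairing (coroot \<alpha>) (fundamental_weight i)) * \<sigma> (u \<circ> reflection \<alpha>)) =
      (\<Sum>\<alpha> | \<alpha> \<in> positive_roots \<and> quantum_edge u \<alpha> 0. ?t \<alpha> 0)"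
  proof (rule sum.cong)
    show "{\<alpha> \<in> positive_roots. weyl_length (u \<circ> reflection \<alpha>) = weyl_length u + 1} =
        {\<alpha> \<in> positive_roots. quantum_edge u \<alpha> 0}"
      by (auto simp: quantum_edge_def)
  qed (simp add: kappa_simps)
  also have "\<dots> = (\<Sum>\<alpha>\<in>positive_roots. if quantum_edge u \<alpha> 0 then ?t \<alpha> 0 else 0)"
    using finite_positive_roots by (rule sum.inter_filter)
  finally have 0: "(\<Sum>\<alpha> | \<alpha> \<in> positive_roots \<and> weyl_length (u \<circ> reflection \<alpha>) = weyl_length u + 1.
      of_int (pairing (coroot \<alpha>) (fundamental_weight i)) * \<sigma> (u \<circ> reflection \<alpha>)) =
      (\<Sum>\<alpha>\<in>positive_roots. if quantum_edge u \<alpha> 0 then ?t \<alpha> 0 else 0)" .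
  have "(\<Sum>\<alpha> | \<alpha> \<in> positive_roots \<and>
        int (weyl_length (u \<circ> reflection \<alpha>)) = int (weyl_length u) + 1 - pairing (coroot \<alpha>) (2 *s rho).
      of_int (pairing (coroot \<alpha>) (fundamental_weight i)) * \<kappa> (q_monomial (coroot \<alpha>)) * \<sigma> (u \<circ> reflection \<alpha>)) =
      (\<Sum>\<alpha> | \<alpha> \<in> positive_roots \<and> quantum_edge u \<alpha> 1. ?t \<alpha> 1)"
    by (simp add: quantum_edge_def)
  also have "\<dots> = (\<Sum>\<alpha>\<in>positive_roots. if quantum_edge u \<alpha> 1 then ?t \<alpha> 1 else 0)"
    using finite_positive_roots by (rule sum.inter_filter)
  finally have 1: "(\<Sum>\<alpha> | \<alpha> \<in> positive_roots \<and>
        int (weyl_length (u \<circ> reflection \<alpha>)) = int (weyl_length u) + 1 - pairing (coroot \<alpha>) (2 *s rho).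
      of_int (pairing (coroot \<alpha>) (fundamental_weight i)) * \<kappa> (q_monomial (coroot \<alpha>)) * \<sigma> (u \<circ> reflection \<alpha>)) =
      (\<Sum>\<alpha>\<in>positive_roots. if quantum_edge u \<alpha> 1 then ?t \<alpha> 1 else 0)" .
  have "(\<Sum>k\<in>{0 :: int, 1}. g k) = g 0 + g 1" for g :: "int \<Rightarrow> 'q" by simp
  then show ?thesis
    unfolding quantum_chevalley[OF u] 0 1 by (simp only: sum.distrib add.assoc)
qed

lemma near_bruhat_operator_lift:
  assumes v: "v \<in> weyl_group" and adm: "admissible regularity lam z"
  shows "near_bruhat_operator (fundamental_weight i) (chamber_lift v lam z) =
    chamber_lift v lam (\<sigma> (simple_reflection i) * z)"
proof (rule coord_induct[of _ z])
  show "near_bruhat_operator (fundamental_weight i) (chamber_lift v lam (x + y)) =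
      chamber_lift v lam (\<sigma> (simple_reflection i) * (x + y))"
    if "near_bruhat_operator (fundamental_weight i) (chamber_lift v lam x) =
        chamber_lift v lam (\<sigma> (simple_reflection i) * x)"
      "near_bruhat_operator (fundamental_weight i) (chamber_lift v lam y) =
        chamber_lift v lam (\<sigma> (simple_reflection i) * y)" for x y
    by (simp add: distrib_left chamber_lift_add near_bruhat_operator_add that)
  fix u m c
  assume uk: "u \<in> Poly_Mapping.keys (coord z)" and u: "u \<in> weyl_group"
    and m: "m \<in> Poly_Mapping.keys (Poly_Mapping.lookup (coord z) u)"
  let ?l = "lam + exponent_coweight m" and ?w = "fundamental_weight i"
  have d: "deep regularity ?l" using adm uk m unfolding admissible_def by blast
  let ?z = "\<kappa> (Poly_Mapping.single m c)"
  have t1: "?z * (\<kappa> (const_poly s) * \<sigma> u) = \<kappa> (Poly_Mapping.single m (c * s)) * \<sigma> u" for s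
    by (simp add: mult.assoc[symmetric] kappa_simps(3)[symmetric] const_poly_def mult_single)
  have t2: "chamber_lift v lam (?z * (of_int n * \<kappa> (q_monomial (k *s coroot \<alpha>)) * \<sigma> (u \<circ> reflection \<alpha>))) =
      Poly_Mapping.single (chamber_element v (u \<circ> reflection \<alpha>) (?l + k *s coroot \<alpha>)) (c * of_int n)"
    if \<alpha>: "\<alpha> \<in> positive_roots" and k: "k \<in> {0, 1}" for \<alpha> k n
  proof -
    have u': "u \<circ> reflection \<alpha> \<in> weyl_group"
      using weyl_comp[OF u reflection_in_weyl[OF positive_is_root[OF \<alpha>]]] .
    \<comment> \<open>\<open>q_monomial\<close> truncates negative exponents, so returning from
      exponents to coweights uses that positive coroots have nonnegative coordinates.\<close>
    have e: "exponent_coweight (coweight_exponent (k *s coroot \<alpha>)) = k *s coroot \<alpha>"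
      using k coroot_nonneg[OF \<alpha>] by (intro exponent_coweight_exponent) auto
    have "?z * (of_int n * \<kappa> (q_monomial (k *s coroot \<alpha>)) * \<sigma> (u \<circ> reflection \<alpha>)) =
        ?z * \<kappa> (of_int n) * \<kappa> (q_monomial (k *s coroot \<alpha>)) * \<sigma> (u \<circ> reflection \<alpha>)"
      by (simp only: kappa_simps(7) mult.assoc)
    also have "\<dots> = \<kappa> (Poly_Mapping.single (m + coweight_exponent (k *s coroot \<alpha>)) (c * of_int n)) * \<sigma> (u \<circ> reflection \<alpha>)"
      by (simp only: kappa_simps(3)[symmetric] q_monomial_eq single_of_int[symmetric] mult_single
          add_0_right mult_1_right)
    finally show ?thesis by (simp only: chamber_lift_term[OF u'] exponent_coweight_add e add.assoc)
  qed
  have "chamber_lift v lam (\<sigma> (simple_reflection i) * (?z * \<sigma> u)) =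
      chamber_lift v lam (?z * (\<sigma> (simple_reflection i) * \<sigma> u))" by (simp only: mult.left_commute)
  also have "\<dots> = Poly_Mapping.single (chamber_element v u ?l) (c * weight_in_S (?w - u ?w)) +
      edge_sum (quantum_edge u) (\<lambda>\<alpha> k.
        Poly_Mapping.single (chamber_element v (u \<circ> reflection \<alpha>) (?l + k *s coroot \<alpha>)) (c * of_int (pairing (coroot \<alpha>) ?w)))"
    unfolding quantum_chevalley_edges[OF u] distrib_left sum_distrib_left chamber_lift_add chamber_lift_sum
      t1 chamber_lift_term[OF u]
    by (intro arg_cong2[of _ _ _ _ "(+)"] sum.cong HOL.refl)
      (simp add: t2 del: insert_iff pairing_fundamental_weight)
  also have "\<dots> = near_bruhat_operator ?w (chamber_lift v lam (?z * \<sigma> u))"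
    unfolding chamber_lift_term[OF u] using near_bruhat_operator_single[OF v u d] by simp
  finally show "near_bruhat_operator ?w (chamber_lift v lam (?z * \<sigma> u)) =
      chamber_lift v lam (\<sigma> (simple_reflection i) * (?z * \<sigma> u))" by simp
qed (simp add: near_bruhat_operator_zero)

lemma evaluate_support_sum:
  "evaluate P = support_sum (\<lambda>m p. \<kappa> p * (\<Prod>i\<in>UNIV. \<sigma> (simple_reflection i) ^ Poly_Mapping.lookup m i)) P"
  by (simp add: evaluate_def support_sum_def)

lemma evaluate_sum: "evaluate (\<Sum>t\<in>K. P t) = (\<Sum>t\<in>K. evaluate (P t))"
  unfolding evaluate_support_sum by (rule support_sum_sum) (simp_all add: kappa_simps distrib_right)

lemma evaluate_word:
  "evaluate (const_poly p * prod_list (map var_poly ks)) = \<kappa> p * prod_list (map (\<lambda>i. \<sigma> (simple_reflection i)) ks)"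
proof -
  \<comment> \<open>The exponent vector of the commutative monomial spelled by the word.\<close>
  define e where "e ks = (\<Sum>i\<leftarrow>ks. Poly_Mapping.single i (1 :: nat))" for ks :: "'i list"
  have 1: "prod_list (map var_poly ks) = (Poly_Mapping.single (e ks) 1 :: 'i Sq_omega)"
    by (induction ks) (simp_all add: e_def var_poly_def mult_single)
  have 2: "(\<Prod>i\<in>UNIV. \<sigma> (simple_reflection i) ^ Poly_Mapping.lookup (e ks) i) =
      prod_list (map (\<lambda>i. \<sigma> (simple_reflection i)) ks)"
  proof (induction ks)
    case (Cons k ks)
    have "(\<Prod>i\<in>UNIV. \<sigma> (simple_reflection i) ^ Poly_Mapping.lookup (e (k # ks)) i) =
        (\<Prod>i\<in>UNIV. (if i = k then \<sigma> (simple_reflection i) else 1) * \<sigma> (simple_reflection i) ^ Poly_Mapping.lookup (e ks) i)"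
      by (rule prod.cong) (auto simp: e_def lookup_add lookup_single when_def)
    then show ?case using Cons by (simp add: prod.distrib)
  qed (simp add: e_def)
  have "const_poly p * prod_list (map var_poly ks) = Poly_Mapping.single (e ks) p"
    by (simp add: 1 const_poly_def mult_single)
  then show ?thesis by (simp add: evaluate_support_sum support_sum_single kappa_simps 2)
qed

end


section \<open>The comparison\<close>

locale peterson_comparison = grassmannian_homology C \<iota> A \<eta> \<xi> j + quantum_cohomology C \<kappa> \<sigma>
  for C :: "'i::finite \<Rightarrow> 'i \<Rightarrow> int"
    and \<iota> :: "'i S \<Rightarrow> 'a::ring_1" and A :: "'i option \<Rightarrow> 'a"
    and \<eta> :: "'i S \<Rightarrow> 'h::comm_ring_1" and \<xi> :: "'i waf \<Rightarrow> 'h" and j :: "'h \<Rightarrow> 'a"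
    and \<kappa> :: "'i Sq \<Rightarrow> 'q::comm_ring_1" and \<sigma> :: "'i weyl \<Rightarrow> 'q"
begin

abbreviation scal :: "'i S \<Rightarrow> 'q" where "scal s \<equiv> \<kappa> (const_poly s)"

lemma is_ring_hom_scal: "is_ring_hom (\<lambda>s. scal s)"
proof -
  have "is_ring_hom (const_poly :: 'i S \<Rightarrow> 'i Sq)" by (rule is_ring_hom_const_poly)
  then show ?thesis using quantum_scalars by (simp add: is_ring_hom_def)
qed

lemmas scal_simps = is_ring_hom_simps[OF is_ring_hom_scal]

lemma Upsilon_support_sum: "Upsilon f = support_sum (\<lambda>x c. \<iota> c * AA x) f"
  by (simp add: Upsilon_def support_sum_def)

lemma Upsilon_add: "Upsilon (f + g) = Upsilon f + Upsilon g"
  unfolding Upsilon_support_sum by (rule support_sum_add) (simp_all add: scalar_simps distrib_right)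

lemma Upsilon_sum: "Upsilon (\<Sum>y\<in>Y. f y) = (\<Sum>y\<in>Y. Upsilon (f y))"
  by (induction Y rule: infinite_finite_induct) (simp_all add: Upsilon_add, simp_all add: Upsilon_def)

lemma Upsilon_single: "Upsilon (Poly_Mapping.single x c) = \<iota> c * AA x"
  by (simp add: Upsilon_support_sum support_sum_single scalar_simps)

lemma Upsilon_scale: "Upsilon (scale_poly s f) = \<iota> s * Upsilon f"
proof -
  have "Poly_Mapping.keys (scale_poly s f) \<subseteq> Poly_Mapping.keys f"
    by (auto simp: in_keys_iff lookup_scale_poly)
  then have "Upsilon (scale_poly s f) =
      (\<Sum>x\<in>Poly_Mapping.keys f. \<iota> (Poly_Mapping.lookup (scale_poly s f) x) * AA x)"
    unfolding Upsilon_support_sum by (intro support_sum_superset) (simp_all add: scalar_simps)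
  then show ?thesis
    by (simp add: lookup_scale_poly scalar_simps Upsilon_def sum_distrib_left mult.assoc)
qed

definition psi :: "'i weyl \<Rightarrow> 'i coweight \<Rightarrow> 'q \<Rightarrow> 'a" where
  "psi v lam z = Upsilon (chamber_lift v lam z)"

lemma psi_add: "psi v lam (y + z) = psi v lam y + psi v lam z"
  by (simp add: psi_def chamber_lift_add Upsilon_add)

lemma psi_zero [simp]: "psi v lam 0 = 0"
  by (simp add: psi_def Upsilon_def)

lemma psi_sum: "psi v lam (\<Sum>y\<in>Y. f y) = (\<Sum>y\<in>Y. psi v lam (f y))"
  by (simp add: psi_def chamber_lift_sum Upsilon_sum)

lemma psi_scalar: "psi v lam (scal s * z) = \<iota> s * psi v lam z"
  by (simp add: psi_def chamber_lift_scalar Upsilon_scale)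

lemma psi_of_int: "psi v lam (of_int n * z) = of_int n * psi v lam z"
  using psi_scalar[of v lam "of_int n" z] by (simp add: scal_simps(7) scalar_simps(7))

lemma psi_if: "psi v lam (if P then y else z) = (if P then psi v lam y else psi v lam z)"
  by simp

lemma psi_q: "(\<And>i. d $ i \<ge> 0) \<Longrightarrow> psi v lam (\<kappa> (q_monomial d) * z) = psi v (lam + d) z"
  by (simp add: psi_def chamber_lift_q)

lemma psi_term: "u \<in> weyl_group \<Longrightarrow> psi v lam (\<kappa> (Poly_Mapping.single m c) * \<sigma> u) =
    \<iota> c * AA (chamber_element v u (lam + exponent_coweight m))"
  by (simp add: psi_def chamber_lift_term Upsilon_single)

lemma psi_q_term:
  assumes u: "u \<in> weyl_group" and \<alpha>: "\<alpha> \<in> positive_roots" and k: "k \<in> {0, 1}"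
  shows "psi v lam (\<kappa> (q_monomial (k *s coroot \<alpha>)) * (\<kappa> (Poly_Mapping.single m c) * \<sigma> u)) =
    \<iota> c * AA (chamber_element v u (lam + exponent_coweight m + k *s coroot \<alpha>))"
proof -
  have "(k *s coroot \<alpha>) $ i \<ge> 0" for i using k coroot_nonneg[OF \<alpha>, of i] by auto
  then show ?thesis by (subst psi_q) (simp_all add: psi_term[OF u] add.assoc add.left_commute add.commute)
qed

section \<open>Commutators with weights\<close>

text \<open>Additive extension of the divisor classes from fundamental weights to all weights.
  Commutators involve \<open>inv v \<nu>\<close>, which need not be fundamental even if \<nu>
  is.\<close>

definition weight_class :: "'i weight \<Rightarrow> 'q" where
  "weight_class \<mu> = (\<Sum>i\<in>UNIV. of_int (\<mu> $ i) * \<sigma> (simple_reflection i))"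

lemma weight_class_mult:
  assumes u: "u \<in> weyl_group"
  shows "weight_class \<mu> * \<sigma> u = scal (weight_in_S (\<mu> - u \<mu>)) * \<sigma> u +
    edge_sum (quantum_edge u) (\<lambda>\<alpha> k.
        of_int (pairing (coroot \<alpha>) \<mu>) * (\<kappa> (q_monomial (k *s coroot \<alpha>)) * \<sigma> (u \<circ> reflection \<alpha>)))"
proof -
  let ?w = fundamental_weight
  let ?Q = "\<lambda>\<alpha> k. \<kappa> (q_monomial (k *s coroot \<alpha>)) * \<sigma> (u \<circ> reflection \<alpha>)"
  have e: "\<mu> - u \<mu> = (\<Sum>i\<in>UNIV. \<mu> $ i *s (?w i - u (?w i)))"
  proof -
    have "u \<mu> = (\<Sum>i\<in>UNIV. \<mu> $ i *s u (?w i))"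
      by (subst weight_expansion[of \<mu>]) (simp add: weyl_sum weyl_scale u)
    then have "\<mu> - u \<mu> = (\<Sum>i\<in>UNIV. \<mu> $ i *s ?w i) - (\<Sum>i\<in>UNIV. \<mu> $ i *s u (?w i))"
      by (subst weight_expansion[of \<mu>]) simp
    then show ?thesis by (simp only: sum_subtractf[symmetric] vector_ssub_ldistrib)
  qed
  have s: "scal (weight_in_S (\<mu> - u \<mu>)) = (\<Sum>i\<in>UNIV. of_int (\<mu> $ i) * scal (weight_in_S (?w i - u (?w i))))"
    unfolding e weight_in_S_sum weight_in_S_scale scal_simps(8) scal_simps(3) scal_simps(7) ..
  have p: "(of_int (pairing (coroot \<alpha>) \<mu>) :: 'q) = (\<Sum>i\<in>UNIV. of_int (\<mu> $ i) * of_int (pairing (coroot \<alpha>) (?w i)))" for \<alpha>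
    by (simp add: pairing_def[of "coroot \<alpha>" \<mu>] mult.commute)
  have "weight_class \<mu> * \<sigma> u = (\<Sum>i\<in>UNIV. of_int (\<mu> $ i) * (\<sigma> (simple_reflection i) * \<sigma> u))"
    by (simp only: weight_class_def sum_distrib_right mult.assoc)
  also have "\<dots> = (\<Sum>i\<in>UNIV. of_int (\<mu> $ i) * scal (weight_in_S (?w i - u (?w i))) * \<sigma> u) +
      (\<Sum>i\<in>UNIV. \<Sum>\<alpha>\<in>positive_roots. \<Sum>k\<in>{0, 1}. if quantum_edge u \<alpha> k then
        of_int (\<mu> $ i) * of_int (pairing (coroot \<alpha>) (?w i)) * ?Q \<alpha> k else 0)"
    unfolding quantum_chevalley_edges[OF u] distrib_left sum.distrib sum_distrib_left
    by (intro arg_cong2[of _ _ _ _ "(+)"] sum.cong HOL.refl) (simp_all add: mult.assoc del: pairing_fundamental_weight)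
  also have "(\<Sum>i\<in>UNIV. \<Sum>\<alpha>\<in>positive_roots. \<Sum>k\<in>{0, 1}. if quantum_edge u \<alpha> k then
        of_int (\<mu> $ i) * of_int (pairing (coroot \<alpha>) (?w i)) * ?Q \<alpha> k else 0) =
      (\<Sum>\<alpha>\<in>positive_roots. \<Sum>i\<in>UNIV. \<Sum>k\<in>{0, 1}. if quantum_edge u \<alpha> k then
        of_int (\<mu> $ i) * of_int (pairing (coroot \<alpha>) (?w i)) * ?Q \<alpha> k else 0)"
    by (rule sum.swap)
  also have "\<dots> = (\<Sum>\<alpha>\<in>positive_roots. \<Sum>k\<in>{0, 1}. \<Sum>i\<in>UNIV. if quantum_edge u \<alpha> k then
        of_int (\<mu> $ i) * of_int (pairing (coroot \<alpha>) (?w i)) * ?Q \<alpha> k else 0)"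
    by (intro sum.cong HOL.refl) (rule sum.swap)
  also have "\<dots> = edge_sum (quantum_edge u) (\<lambda>\<alpha> k.
        of_int (pairing (coroot \<alpha>) \<mu>) * ?Q \<alpha> k)"
    unfolding p by (intro sum.cong HOL.refl) (simp add: sum_distrib_right del: pairing_fundamental_weight)
  also have "(\<Sum>i\<in>UNIV. of_int (\<mu> $ i) * scal (weight_in_S (?w i - u (?w i))) * \<sigma> u) =
      scal (weight_in_S (\<mu> - u \<mu>)) * \<sigma> u"
    by (simp only: s sum_distrib_right)
  finally show ?thesis .
qed

text \<open>Quantum multiplication by the class of \<mu> contributes \<mu> - u\<mu> on the diagonal,
  so subtracting it from multiplication by \<mu> leaves the desired u\<mu> and the negative near
  sum. A far cocover leaves \<open>u\<close> unchanged, so in the last sum \<open>z\<close> itself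
  survives and is only multiplied by a power of q.\<close>

lemma psi_commutation:
  fixes \<nu> :: "'i weight"
  assumes v: "v \<in> weyl_group" and adm: "admissible 4 lam z"
  defines "\<mu> \<equiv> inv v \<nu>"
  shows "psi v lam z * \<iota> (weight_in_S \<nu>) =
    psi v lam (scal (weight_in_S \<mu>) * z) - psi v lam (weight_class \<mu> * z) -
    edge_sum (\<lambda>\<alpha>. quantum_edge (v \<circ> reflection \<alpha>) \<alpha>) (\<lambda>\<alpha> k.
        of_int (pairing (coroot \<alpha>) \<mu>) * psi (v \<circ> reflection \<alpha>) lam (\<kappa> (q_monomial (k *s coroot \<alpha>)) * z))"
    (is "?L z = ?D z - ?E z - ?F z")
proof (rule coord_induct[of "\<lambda>z. ?L z = ?D z - ?E z - ?F z" z])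
  show "?L 0 = ?D 0 - ?E 0 - ?F 0" by (simp cong: if_cong)
next
  fix x y assume xy: "?L x = ?D x - ?E x - ?F x" "?L y = ?D y - ?E y - ?F y"
  have "?L (x + y) = ?L x + ?L y" "?D (x + y) = ?D x + ?D y" "?E (x + y) = ?E x + ?E y"
    by (simp_all only: psi_add distrib_left distrib_right)
  moreover have if_add: "(if P then a else 0) + (if P then b else 0) = (if P then a + b else 0)"
    for P and a b :: 'a by simp
  have "?F (x + y) = ?F x + ?F y"
    unfolding sum.distrib[symmetric]
    by (intro sum.cong HOL.refl) (simp only: psi_add distrib_left if_add)
  ultimately show "?L (x + y) = ?D (x + y) - ?E (x + y) - ?F (x + y)"
    using xy by (simp only:) (simp add: algebra_simps)
next
  fix u m c
  assume uk: "u \<in> Poly_Mapping.keys (coord z)" and u: "u \<in> weyl_group"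
    and m: "m \<in> Poly_Mapping.keys (Poly_Mapping.lookup (coord z) u)"
  let ?l = "lam + exponent_coweight m" and ?z = "\<kappa> (Poly_Mapping.single m c)"
  have d: "deep 4 ?l" using adm uk m unfolding admissible_def by blast
  have u': "u \<circ> reflection \<alpha> \<in> weyl_group" if "\<alpha> \<in> positive_roots" for \<alpha>
    using weyl_comp[OF u reflection_in_weyl[OF positive_is_root[OF that]]] .
  have com: "\<iota> c * (of_int n * x) = of_int n * (\<iota> c * x)" for n and x :: 'a
    by (metis mult.assoc mult_of_int_commute)
  let ?N = "edge_sum (quantum_edge u) (\<lambda>\<alpha> k.
        of_int (pairing (coroot \<alpha>) \<mu>) * (\<iota> c * AA (chamber_element v (u \<circ> reflection \<alpha>) (?l + k *s coroot \<alpha>))))"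
  have "weight_class \<mu> * (?z * \<sigma> u) = ?z * (weight_class \<mu> * \<sigma> u)" by (rule mult.left_commute)
  also have "\<dots> = scal (weight_in_S (\<mu> - u \<mu>)) * (?z * \<sigma> u) +
    edge_sum (quantum_edge u) (\<lambda>\<alpha> k.
        of_int (pairing (coroot \<alpha>) \<mu>) * (\<kappa> (q_monomial (k *s coroot \<alpha>)) * (?z * \<sigma> (u \<circ> reflection \<alpha>))))"
    unfolding weight_class_mult[OF u] distrib_left sum_distrib_left
    by (intro arg_cong2[of _ _ _ _ "(+)"] sum.cong HOL.refl) (simp_all add: mult.left_commute)
  finally have "?E (?z * \<sigma> u) = \<iota> (weight_in_S (\<mu> - u \<mu>)) * psi v lam (?z * \<sigma> u) + ?N"
    by (simp only: psi_add psi_scalar psi_sum psi_if psi_of_int psi_zero)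
      (intro arg_cong2[of _ _ _ _ "(+)"] sum.cong HOL.refl, simp add: psi_q_term u' del: insert_iff)
  moreover have "?D (?z * \<sigma> u) = \<iota> (weight_in_S \<mu>) * psi v lam (?z * \<sigma> u)" by (rule psi_scalar)
  ultimately have DE: "?D (?z * \<sigma> u) - ?E (?z * \<sigma> u) = \<iota> (weight_in_S (u \<mu>)) * psi v lam (?z * \<sigma> u) - ?N"
    by (simp add: weight_in_S_diff scalar_simps algebra_simps)
  let ?G = "edge_sum (\<lambda>\<alpha>. quantum_edge (v \<circ> reflection \<alpha>) \<alpha>) (\<lambda>\<alpha> k.
        of_int (pairing (coroot \<alpha>) \<mu>) * (\<iota> c * AA (chamber_element (v \<circ> reflection \<alpha>) u (?l + k *s coroot \<alpha>))))"
  have F: "?F (?z * \<sigma> u) = ?G"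
    by (intro sum.cong HOL.refl) (simp only: psi_q_term[OF u] cong: if_cong)
  have dist: "\<iota> c * edge_sum P (\<lambda>\<alpha> k. of_int (n \<alpha>) * f \<alpha> k) =
      edge_sum P (\<lambda>\<alpha> k. of_int (n \<alpha>) * (\<iota> c * f \<alpha> k))"
    for P :: "'i weight \<Rightarrow> int \<Rightarrow> bool" and n and f :: "'i weight \<Rightarrow> int \<Rightarrow> 'a"
    unfolding sum_distrib_left by (intro sum.cong HOL.refl) (simp add: com)
  have "?L (?z * \<sigma> u) = \<iota> c * (AA (chamber_element v u ?l) * \<iota> (weight_in_S \<nu>))"
    by (simp only: psi_term[OF u] mult.assoc)
  also have "\<dots> = \<iota> c * (\<iota> (weight_in_S (u \<mu>)) * AA (chamber_element v u ?l)) - ?N - ?G"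
    unfolding AA_chamber_commutation[OF v u d, of \<nu>, folded \<mu>_def] right_diff_distrib dist ..
  also have "\<iota> c * (\<iota> (weight_in_S (u \<mu>)) * AA (chamber_element v u ?l)) =
      \<iota> (weight_in_S (u \<mu>)) * psi v lam (?z * \<sigma> u)"
    by (simp only: psi_term[OF u] mult.assoc[symmetric] scalar_simps(3)[symmetric]) (simp only: mult.commute)
  finally show "?L (?z * \<sigma> u) = ?D (?z * \<sigma> u) - ?E (?z * \<sigma> u) - ?F (?z * \<sigma> u)"
    unfolding DE F .
qed

text \<open>Replacing \<open>v\<close> by \<open>v r\<^sub>\<alpha>\<close> turns the far part of the commutator into the quantum Chevalley terms of
  \<open>\<sigma>\<^sup>v\<close>; the signs cancel because \<open>\<langle>\<alpha>\<^sup>\<or>, (v r\<^sub>\<alpha>)\<inverse>\<nu>\<rangle> = -\<langle>\<alpha>\<^sup>\<or>, v\<inverse>\<nu>\<rangle>\<close>.\<close>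

lemma psi_sum_commutes:
  assumes adm: "\<And>v. v \<in> weyl_group \<Longrightarrow> admissible 4 lam (\<tau> * \<sigma> v)"
  shows "(\<Sum>v\<in>weyl_group. psi v lam (\<tau> * \<sigma> v)) * \<iota> (weight_in_S \<nu>) =
    \<iota> (weight_in_S \<nu>) * (\<Sum>v\<in>weyl_group. psi v lam (\<tau> * \<sigma> v))"
proof -
  define g where "g \<alpha> k v = (if quantum_edge (v \<circ> reflection \<alpha>) \<alpha> k then of_int (pairing (coroot \<alpha>) (inv v \<nu>)) *
      psi (v \<circ> reflection \<alpha>) lam (\<kappa> (q_monomial (k *s coroot \<alpha>)) * (\<tau> * \<sigma> v)) else 0)" for \<alpha> k v
  define h where "h \<alpha> k v = (if quantum_edge v \<alpha> k then of_int (pairing (coroot \<alpha>) (inv v \<nu>)) *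
      psi v lam (\<kappa> (q_monomial (k *s coroot \<alpha>)) * (\<tau> * \<sigma> (v \<circ> reflection \<alpha>))) else 0)" for \<alpha> k v
  have gh: "(\<Sum>v\<in>weyl_group. g \<alpha> k v) = - (\<Sum>v\<in>weyl_group. h \<alpha> k v)" if \<alpha>: "\<alpha> \<in> positive_roots" for \<alpha> k
  proof -
    have r: "\<alpha> \<in> roots" using positive_is_root \<alpha> .
    note rW = reflection_in_weyl[OF r]
    have rr: "v \<circ> reflection \<alpha> \<circ> reflection \<alpha> = v" for v :: "'i weyl" using r by (simp add: fun_eq_iff reflection_involution)
    have "bij_betw (\<lambda>v. v \<circ> reflection \<alpha>) weyl_group weyl_group"
      by (rule bij_betw_byWitness[where f' = "\<lambda>v. v \<circ> reflection \<alpha>"]) (simp_all add: rr image_subset_iff weyl_comp rW)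
    then have "(\<Sum>v\<in>weyl_group. g \<alpha> k v) = (\<Sum>v\<in>weyl_group. g \<alpha> k (v \<circ> reflection \<alpha>))"
      by (rule sum.reindex_bij_betw[symmetric])
    also have "\<dots> = (\<Sum>v\<in>weyl_group. - h \<alpha> k v)"
    proof (rule sum.cong[OF HOL.refl])
      fix v assume v: "v \<in> weyl_group"
      have "inv (v \<circ> reflection \<alpha>) \<nu> = reflection \<alpha> (inv v \<nu>)"
        using v rW r by (simp add: weyl_inv_comp inv_reflection)
      moreover have "pairing (coroot \<alpha>) (reflection \<alpha> \<mu>) = - pairing (coroot \<alpha>) \<mu>" for \<mu>
        by (simp add: reflection_def pairing_diff_right pairing_scale_right pairing_coroot_self r)
      ultimately show "g \<alpha> k (v \<circ> reflection \<alpha>) = - h \<alpha> k v" by (simp add: g_def h_def rr)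
    qed
    finally show ?thesis by (simp add: sum_negf)
  qed
  have "(\<Sum>v\<in>weyl_group. \<Sum>\<alpha>\<in>positive_roots. \<Sum>k\<in>{0, 1}. g \<alpha> k v) =
      (\<Sum>\<alpha>\<in>positive_roots. \<Sum>k\<in>{0, 1}. \<Sum>v\<in>weyl_group. g \<alpha> k v)"
    by (subst sum.swap) (intro sum.cong HOL.refl, rule sum.swap)
  also have "\<dots> = (\<Sum>\<alpha>\<in>positive_roots. \<Sum>k\<in>{0, 1}. - (\<Sum>v\<in>weyl_group. h \<alpha> k v))"
    by (intro sum.cong HOL.refl gh)
  also have "\<dots> = - (\<Sum>\<alpha>\<in>positive_roots. \<Sum>k\<in>{0, 1}. \<Sum>v\<in>weyl_group. h \<alpha> k v)"
    by (simp only: sum_negf)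
  also have "(\<Sum>\<alpha>\<in>positive_roots. \<Sum>k\<in>{0, 1}. \<Sum>v\<in>weyl_group. h \<alpha> k v) =
      (\<Sum>v\<in>weyl_group. \<Sum>\<alpha>\<in>positive_roots. \<Sum>k\<in>{0, 1}. h \<alpha> k v)"
    by (subst (2) sum.swap) (intro sum.cong HOL.refl, rule sum.swap)
  finally have gh_sum: "(\<Sum>v\<in>weyl_group. \<Sum>\<alpha>\<in>positive_roots. \<Sum>k\<in>{0, 1}. g \<alpha> k v) =
      - (\<Sum>v\<in>weyl_group. \<Sum>\<alpha>\<in>positive_roots. \<Sum>k\<in>{0, 1}. h \<alpha> k v)" .
  \<comment> \<open>Commutativity lets the divisor class act on the factor \<open>\<sigma> v\<close>
    alone, with \<tau> carried along; its off-diagonal Chevalley terms are the sum of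
    \<open>h\<close>.\<close>
  have h: "(\<Sum>\<alpha>\<in>positive_roots. \<Sum>k\<in>{0, 1}. h \<alpha> k v) =
      psi v lam (weight_class (inv v \<nu>) * (\<tau> * \<sigma> v)) -
      \<iota> (weight_in_S (inv v \<nu> - \<nu>)) * psi v lam (\<tau> * \<sigma> v)" if v: "v \<in> weyl_group" for v
  proof -
    let ?\<mu> = "inv v \<nu>"
    have "weight_class ?\<mu> * (\<tau> * \<sigma> v) = \<tau> * (weight_class ?\<mu> * \<sigma> v)" by (rule mult.left_commute)
    also have "\<dots> = scal (weight_in_S (?\<mu> - v ?\<mu>)) * (\<tau> * \<sigma> v) +
      edge_sum (quantum_edge v) (\<lambda>\<alpha> k.
        of_int (pairing (coroot \<alpha>) ?\<mu>) * (\<kappa> (q_monomial (k *s coroot \<alpha>)) * (\<tau> * \<sigma> (v \<circ> reflection \<alpha>))))"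
      unfolding weight_class_mult[OF v] distrib_left sum_distrib_left
      by (intro arg_cong2[of _ _ _ _ "(+)"] sum.cong HOL.refl) (simp_all add: mult.left_commute)
    finally have "psi v lam (weight_class ?\<mu> * (\<tau> * \<sigma> v)) =
        \<iota> (weight_in_S (?\<mu> - v ?\<mu>)) * psi v lam (\<tau> * \<sigma> v) + (\<Sum>\<alpha>\<in>positive_roots. \<Sum>k\<in>{0, 1}. h \<alpha> k v)"
      unfolding h_def by (simp only: psi_add psi_scalar psi_sum psi_if psi_of_int psi_zero)
    then show ?thesis using v by simp
  qed
  \<comment> \<open>The diagonal parts in \<open>inv v \<nu>\<close> cancel and leave \<nu> itself,
    the same for all chambers. Only the sums of \<open>g\<close> and \<open>h\<close> still depend
    on \<open>v\<close>, and these are opposite in total.\<close>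
  have "psi v lam (\<tau> * \<sigma> v) * \<iota> (weight_in_S \<nu>) =
      \<iota> (weight_in_S \<nu>) * psi v lam (\<tau> * \<sigma> v) - (\<Sum>\<alpha>\<in>positive_roots. \<Sum>k\<in>{0, 1}. h \<alpha> k v) -
      (\<Sum>\<alpha>\<in>positive_roots. \<Sum>k\<in>{0, 1}. g \<alpha> k v)" if v: "v \<in> weyl_group" for v
    unfolding psi_commutation[OF v adm[OF v]] h[OF v] psi_scalar g_def
    by (simp add: weight_in_S_diff scalar_simps algebra_simps)
  then have "(\<Sum>v\<in>weyl_group. psi v lam (\<tau> * \<sigma> v)) * \<iota> (weight_in_S \<nu>) =
      (\<Sum>v\<in>weyl_group. \<iota> (weight_in_S \<nu>) * psi v lam (\<tau> * \<sigma> v) -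
        (\<Sum>\<alpha>\<in>positive_roots. \<Sum>k\<in>{0, 1}. h \<alpha> k v) - (\<Sum>\<alpha>\<in>positive_roots. \<Sum>k\<in>{0, 1}. g \<alpha> k v))"
    unfolding sum_distrib_right by (intro sum.cong HOL.refl)
  then show ?thesis by (simp only: sum_subtractf gh_sum sum_distrib_left) simp
qed

lemma psi_sum_in_centralizer:
  assumes "\<And>v. v \<in> weyl_group \<Longrightarrow> admissible 4 lam (\<tau> * \<sigma> v)"
  shows "(\<Sum>v\<in>weyl_group. psi v lam (\<tau> * \<sigma> v)) \<in> centralizer"
proof (rule centralizerI)
  fix i
  show "(\<Sum>v\<in>weyl_group. psi v lam (\<tau> * \<sigma> v)) * \<iota> (var_poly i) =
      \<iota> (var_poly i) * (\<Sum>v\<in>weyl_group. psi v lam (\<tau> * \<sigma> v))"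
    using psi_sum_commutes[OF assms, where \<nu> = "fundamental_weight i"]
    unfolding weight_in_S_fundamental .
qed

section \<open>The left ideal and the Schubert class\<close>

lemma finite_left_ideal_add:
  "x \<in> finite_left_ideal \<Longrightarrow> y \<in> finite_left_ideal \<Longrightarrow> x + y \<in> finite_left_ideal"
proof -
  assume "x \<in> finite_left_ideal" "y \<in> finite_left_ideal"
  then obtain g h where "x = (\<Sum>w\<in>weyl_group - {id}. g w * AA (w, 0))" "y = (\<Sum>w\<in>weyl_group - {id}. h w * AA (w, 0))"
    unfolding finite_left_ideal_def by blast
  then have "x + y = (\<Sum>w\<in>weyl_group - {id}. (g w + h w) * AA (w, 0))"
    by (simp add: distrib_right sum.distrib)
  then show ?thesis unfolding finite_left_ideal_def
    by (intro CollectI exI[of _ "\<lambda>w. g w + h w"]) simp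
qed

lemma finite_left_ideal_mult:
  assumes "w \<in> weyl_group" "w \<noteq> id" shows "x * AA (w, 0) \<in> finite_left_ideal"
proof -
  have "x * AA (w, 0) = (\<Sum>v\<in>weyl_group - {id}. (if v = w then x else 0) * AA (v, 0))"
    using assms finite_weyl_group by (simp add: if_distrib[of "\<lambda>y. y * _"] mult_delta_left cong: if_cong)
  then show ?thesis unfolding finite_left_ideal_def
    by (intro CollectI exI[of _ "\<lambda>v. if v = w then x else 0"]) simp
qed

lemma finite_left_ideal_zero: "0 \<in> finite_left_ideal"
  unfolding finite_left_ideal_def by (intro CollectI exI[of _ "\<lambda>_. 0"]) simp

text \<open>Outside the identity chamber some simple root pairs positively with v\<lambda>. The
  corresponding finite reflection is then a right descent, and a factor \<open>A (Some i)\<close>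
  splits off on the right.\<close>

lemma AA_chamber_in_ideal:
  assumes v: "v \<in> weyl_group" "v \<noteq> id" and u: "u \<in> weyl_group" and lam: "deep 0 lam"
  shows "x * AA (chamber_element v u lam) \<in> finite_left_ideal"
proof -
  let ?x = "chamber_element v u lam"
  have xG: "?x \<in> affine_weyl_group" using chamber_element_closed[OF v(1) u] .
  have "inv v \<noteq> id" using v weyl_inv_inv[OF v(1)] by auto
  then obtain i where i: "inv v (simple_root i) \<notin> positive_roots"
    using weyl_not_id_descent[OF weyl_inv[OF v(1)]] by blast
  let ?g = "affine_generator (Some i)"
  let ?y = "waf_mult ?x ?g"
  have "- inv v (simple_root i) \<in> positive_roots"
    using i uminus_positive_root_iff[OF weyl_root[OF weyl_inv[OF v(1)] simple_root_root]] by blast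
  then have "pairing lam (- inv v (simple_root i)) < 0" using lam by (auto simp: deep_def)
  then have "affine_action ?x (affine_simple_root (Some i)) \<notin> positive_affine_roots"
    using v(1) by (simp add: affine_action_def affine_simple_root_def positive_affine_roots_def
        chamber_element_def pairing_act_coweight pairing_minus_right)
  then have l: "affine_length ?x = Suc (affine_length ?y)"
    using aff.card_inversions_down[OF xG] affine_length_eq_card aff.mult_closed aff.gen_closed xG by simp
  have y: "?y \<in> affine_weyl_group" using aff.mult_closed[OF xG aff.gen_closed] .
  have yx: "waf_mult ?y ?g = ?x" using aff.gen_cancel_right[OF xG] .
  then have x: "AA ?x = AA ?y * A (Some i)" using AA_up_gen[OF y, of "Some i"] l by simp
  have "affine_length (waf_mult ?g waf_one) = Suc (affine_length waf_one)"
    using aff.len_gen[OF aff.e_closed, of "Some i"] aff.len_e by (simp add: affine_length_def)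
  then have "AA (waf_mult ?g waf_one) = A (Some i)"
    using AA_gen_up[OF aff.e_closed] AA_one by simp
  then have "AA (simple_reflection i, 0) = A (Some i)"
    unfolding aff.e_right[OF aff.gen_closed] by (simp add: affine_generator_def)
  then have "x * AA ?x = (x * AA ?y) * AA (simple_reflection i, 0)" by (simp add: x mult.assoc)
  moreover have "simple_reflection i \<noteq> id"
  proof
    assume "simple_reflection i = id"
    then have "- simple_root i = simple_root i" using simple_reflection_simple[of i] by simp
    then show False
      using uminus_positive_root_iff[OF simple_root_root, of i] simple_root_positive[of i] by metis
  qed
  ultimately show ?thesis using finite_left_ideal_mult[OF weyl_simple] by metis
qed

lemma psi_in_ideal:
  assumes v: "v \<in> weyl_group" "v \<noteq> id" and adm: "admissible 0 lam z"
  shows "psi v lam z \<in> finite_left_ideal"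
proof (rule coord_induct[of _ z])
  fix u m c
  assume uk: "u \<in> Poly_Mapping.keys (coord z)" and u: "u \<in> weyl_group"
    and m: "m \<in> Poly_Mapping.keys (Poly_Mapping.lookup (coord z) u)"
  have "deep 0 (lam + exponent_coweight m)" using adm uk m unfolding admissible_def by blast
  then show "psi v lam (\<kappa> (Poly_Mapping.single m c) * \<sigma> u) \<in> finite_left_ideal"
    unfolding psi_term[OF u] by (rule AA_chamber_in_ideal[OF v u])
qed (simp_all add: psi_add finite_left_ideal_add finite_left_ideal_zero)

text \<open>Right multiplication by a finite element changes the chamber and keeps \<open>u\<close>.
  By the length formula the length grows with the length of the chamber, which is least for the
  identity.\<close>

lemma chamber_element_grassmannian:
  assumes w: "w \<in> weyl_group" and lam: "deep 0 lam" shows "(w, lam) \<in> grassmannian_elements"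
proof -
  have e: "(w, lam) = chamber_element id w lam" by (simp add: chamber_element_def)
  have "affine_length (w, lam) \<le> affine_length (waf_mult (w, lam) (v, 0))" if v: "v \<in> weyl_group" for v
  proof -
    have "waf_mult (w, lam) (v, 0) = chamber_element (inv v) w lam"
      using v by (simp add: waf_mult_def chamber_element_def weyl_inv_inv)
    moreover have "weyl_length id = 0" by (simp add: weyl_length_def fin.len_e)
    ultimately show ?thesis
      using affine_length_chamber_element[OF weyl_group.one w lam] affine_length_chamber_element[OF weyl_inv[OF v] w lam]
      unfolding e by simp
  qed
  then show ?thesis using w by (simp add: grassmannian_elements_def waf_closed)
qed

lemma j_schubert_eq_psi_sum:
  assumes w: "w \<in> weyl_group" and lam: "deep 0 lam"
    and adm: "\<And>v. v \<in> weyl_group \<Longrightarrow> admissible 4 lam (\<sigma> w * \<sigma> v)"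
  shows "j (\<xi> (w, lam)) = (\<Sum>v\<in>weyl_group. psi v lam (\<sigma> w * \<sigma> v))"
proof -
  let ?a = "\<Sum>v\<in>weyl_group. psi v lam (\<sigma> w * \<sigma> v)"
  have adm0: "admissible 0 lam (\<sigma> w * \<sigma> v)" if "v \<in> weyl_group" for v
    using adm[OF that] deep_mono[of 4 _ 0] by (auto simp: admissible_def)
  \<comment> \<open>As \<open>\<sigma> id\<close> is 1, the product is a single Schubert class
    without q-corrections, and its image is a single \<open>A_elem\<close>.\<close>
  have id_part: "psi id lam (\<sigma> w * \<sigma> id) = AA (w, lam)"
    using psi_term[OF w, of id lam 0 1]
    by (simp add: sigma_one kappa_simps scalar_simps(1) chamber_element_def)
  have "?a = psi id lam (\<sigma> w * \<sigma> id) + (\<Sum>v\<in>weyl_group - {id}. psi v lam (\<sigma> w * \<sigma> v))"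
    by (rule sum.remove[OF finite_weyl_group weyl_group.one])
  moreover have "(\<Sum>v\<in>weyl_group - {id}. psi v lam (\<sigma> w * \<sigma> v)) \<in> finite_left_ideal"
    by (rule sum_closed[of "\<lambda>x. x \<in> finite_left_ideal"])
      (auto intro: finite_left_ideal_zero finite_left_ideal_add psi_in_ideal adm0)
  ultimately have "?a - AA (w, lam) \<in> finite_left_ideal" unfolding id_part by (simp only: add_diff_cancel_left')
  then show ?thesis
    using j_schubert_unique[OF chamber_element_grassmannian[OF w lam] psi_sum_in_centralizer[OF adm]] by simp
qed

section \<open>Iterated operators and uniform depth\<close>

abbreviation word_class :: "'i list \<Rightarrow> 'q" where
  "word_class ks \<equiv> prod_list (map (\<lambda>i. \<sigma> (simple_reflection i)) ks)"

text \<open>Depth is required for the product over every proper initial part of the word, because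
  each operator must be applied inside the superregular range. The final product needs none.\<close>

lemma fold_near_bruhat_operator_lift:
  assumes "v \<in> weyl_group" "\<And>n. n < length ks \<Longrightarrow> admissible regularity lam (word_class (take n ks) * z)"
  shows "fold near_bruhat_operator (map fundamental_weight ks) (chamber_lift v lam z) =
    chamber_lift v lam (word_class ks * z)"
  using assms(2)
proof (induction ks arbitrary: z)
  case (Cons k ks)
  have "admissible regularity lam z" using Cons.prems[of 0] by simp
  then have "near_bruhat_operator (fundamental_weight k) (chamber_lift v lam z) =
      chamber_lift v lam (\<sigma> (simple_reflection k) * z)"
    by (rule near_bruhat_operator_lift[OF assms(1)])
  moreover have "admissible regularity lam (word_class (take n ks) * (\<sigma> (simple_reflection k) * z))"
    if "n < length ks" for n
    using Cons.prems[of "Suc n"] that by (simp add: ac_simps)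
  ultimately show ?case using Cons.IH[of "\<sigma> (simple_reflection k) * z"] by (simp add: ac_simps)
qed simp

lemma fold_near_bruhat_operator_sum:
  "fold near_bruhat_operator \<mu>s (\<Sum>y\<in>Y. f y) = (\<Sum>y\<in>Y. fold near_bruhat_operator \<mu>s (f y))"
  by (induction \<mu>s arbitrary: f) (simp_all add: near_bruhat_operator_sum)

lemma b_eq_psi_sum:
  assumes "\<And>v n. v \<in> weyl_group \<Longrightarrow> n < length ks \<Longrightarrow> admissible regularity lam (word_class (take n ks) * \<sigma> v)"
  shows "b lam (map fundamental_weight ks) = (\<Sum>v\<in>weyl_group. psi v lam (word_class ks * \<sigma> v))"
proof -
  have "(\<Sum>v\<in>weyl_group. Poly_Mapping.single (translation (act_coweight v lam)) 1) =
      (\<Sum>v\<in>weyl_group. chamber_lift v lam (\<sigma> v))"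
    by (intro sum.cong HOL.refl) (simp add: translation_eq_chamber_element chamber_lift_sigma)
  then have "b lam (map fundamental_weight ks) =
      Upsilon (\<Sum>v\<in>weyl_group. fold near_bruhat_operator (map fundamental_weight ks) (chamber_lift v lam (\<sigma> v)))"
    by (simp add: b_def fold_near_bruhat_operator_sum)
  also have "\<dots> = Upsilon (\<Sum>v\<in>weyl_group. chamber_lift v lam (word_class ks * \<sigma> v))"
    using fold_near_bruhat_operator_lift assms by (intro arg_cong[of _ _ Upsilon] sum.cong HOL.refl) auto
  finally show ?thesis by (simp add: Upsilon_sum psi_def)
qed

text \<open>Turns finitely many depth thresholds into one; monotonicity of \<open>deep\<close> in
  its margin makes the maximum work.\<close>

lemma deep_uniform:
  assumes "finite Y" "\<And>y. y \<in> Y \<Longrightarrow> \<exists>N. \<forall>lam. deep N lam \<longrightarrow> Q y lam"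
  shows "\<exists>N. \<forall>lam. deep N lam \<longrightarrow> (\<forall>y\<in>Y. Q y lam)"
  using assms
proof (induction Y)
  case (insert y Y)
  obtain N where N: "\<And>lam. deep N lam \<Longrightarrow> \<forall>y\<in>Y. Q y lam" using insert by blast
  obtain M where M: "\<And>lam. deep M lam \<Longrightarrow> Q y lam" using insert by blast
  have "\<forall>y\<in>insert y Y. Q y lam" if "deep (max N M) lam" for lam
    using N M deep_mono[OF that] by simp
  then show ?case by blast
qed simp

text \<open>The threshold pays for the exponents in the expansion of \<open>z\<close> and for the
  shift \<open>d\<close>, both bounded crudely by sums of absolute values.\<close>

lemma deep_shift: "\<exists>N. \<forall>lam. deep N lam \<longrightarrow> admissible n (lam + d) z"
proof -
  let ?D = "\<Sum>\<alpha>\<in>positive_roots. \<bar>pairing d \<alpha>\<bar>"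
  have "admissible n (lam + d) z" if lam: "deep (n + exponent_bound z + ?D) lam" for lam
  proof (rule deep_imp_admissible, unfold deep_def, intro ballI)
    fix \<alpha> assume \<alpha>: "\<alpha> \<in> positive_roots"
    have "\<bar>pairing d \<alpha>\<bar> \<le> ?D" using \<alpha> finite_positive_roots by (intro member_le_sum) auto
    moreover have "pairing lam \<alpha> < - (n + exponent_bound z + ?D)" using lam \<alpha> unfolding deep_def by blast
    ultimately show "pairing (lam + d) \<alpha> < - (n + exponent_bound z)"
      unfolding pairing_add_left by linarith
  qed
  then show ?thesis by blast
qed

text \<open>Terms, chambers and initial words form a finite set, and the products with Schubert
  classes on the other side are finite in number as well. All depth requirements are thus met by one
  \<open>k\<close> that depends on the polynomial and not on \<open>lam\<close>.\<close>

theorem schubert_class_from_polynomial: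
  fixes K :: "'t set" and a :: "'t \<Rightarrow> 'i S" and d :: "'t \<Rightarrow> 'i coweight" and word :: "'t \<Rightarrow> 'i list"
  assumes w: "w \<in> weyl_group" and K: "finite K" and d: "\<And>t i. t \<in> K \<Longrightarrow> d t $ i \<ge> 0"
    and P: "P = (\<Sum>t\<in>K. const_poly (const_poly (a t) * q_monomial (d t)) * prod_list (map var_poly (word t)))"
    and schubert: "quantum_schubert_polynomial w P"
  shows "\<exists>k>0. \<forall>lam. antidominant lam \<and> sufficiently_superregular_coweight k lam \<longrightarrow>
    j (\<xi> (w, lam)) = (\<Sum>t\<in>K. \<iota> (a t) * b (lam + d t) (map fundamental_weight (word t)))"
proof -
  have fin: "finite (SIGMA t:K. weyl_group \<times> {..<length (word t)})"
    using K finite_weyl_group by (intro finite_SigmaI) auto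
  obtain N1 where N1: "\<And>lam. deep N1 lam \<Longrightarrow> \<forall>(t, v, n)\<in>(SIGMA t:K. weyl_group \<times> {..<length (word t)}).
      admissible regularity (lam + d t) (word_class (take n (word t)) * \<sigma> v)"
    using deep_uniform[OF fin, of "\<lambda>(t, v, n) lam. admissible regularity (lam + d t) (word_class (take n (word t)) * \<sigma> v)"]
      deep_shift by force
  obtain N2 where N2: "\<And>lam. deep N2 lam \<Longrightarrow> \<forall>v\<in>weyl_group. admissible 4 lam (\<sigma> w * \<sigma> v)"
    using deep_uniform[OF finite_weyl_group, of "\<lambda>v lam. admissible 4 lam (\<sigma> w * \<sigma> v)"] deep_shift[of 4 0] by force
  obtain k where k: "k > 0" "\<And>lam. antidominant lam \<and> sufficiently_superregular_coweight k lam \<Longrightarrow>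
      deep (max 0 (max N1 N2)) lam"
    using sufficiently_superregular_deep by blast
  \<comment> \<open>Evaluating the polynomial expands the Schubert class into words of divisor
    classes. After multiplication by \<open>\<sigma> v\<close> and transport by \<open>psi\<close>,
    each scalar comes out on the left and each q-monomial shifts \<open>lam\<close> by
    \<open>d t\<close>.\<close>
  have sw: "\<sigma> w = (\<Sum>t\<in>K. scal (a t) * (\<kappa> (q_monomial (d t)) * word_class (word t)))"
    using schubert unfolding quantum_schubert_polynomial_def P evaluate_sum evaluate_word
    by (simp add: kappa_simps(3) mult.assoc)
  have "j (\<xi> (w, lam)) = (\<Sum>t\<in>K. \<iota> (a t) * b (lam + d t) (map fundamental_weight (word t)))"
    if "antidominant lam \<and> sufficiently_superregular_coweight k lam" for lam
  proof -
    have deep: "deep 0 lam" "deep N1 lam" "deep N2 lam" using deep_mono[OF k(2)[OF that]] by auto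
    have b: "b (lam + d t) (map fundamental_weight (word t)) =
        (\<Sum>v\<in>weyl_group. psi v (lam + d t) (word_class (word t) * \<sigma> v))" if "t \<in> K" for t
      by (rule b_eq_psi_sum) (use N1[OF deep(2)] that in auto)
    have "psi v lam (\<sigma> w * \<sigma> v) = (\<Sum>t\<in>K. \<iota> (a t) * psi v (lam + d t) (word_class (word t) * \<sigma> v))" for v
    proof -
      have "psi v lam (\<sigma> w * \<sigma> v) =
          (\<Sum>t\<in>K. \<iota> (a t) * psi v lam (\<kappa> (q_monomial (d t)) * (word_class (word t) * \<sigma> v)))"
        unfolding sw sum_distrib_right psi_sum mult.assoc psi_scalar ..
      then show ?thesis by (simp add: psi_q d)
    qed
    then have "j (\<xi> (w, lam)) =
        (\<Sum>v\<in>weyl_group. \<Sum>t\<in>K. \<iota> (a t) * psi v (lam + d t) (word_class (word t) * \<sigma> v))"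
      using j_schubert_eq_psi_sum[OF w deep(1)] N2[OF deep(3)] by simp
    also have "\<dots> = (\<Sum>t\<in>K. \<Sum>v\<in>weyl_group. \<iota> (a t) * psi v (lam + d t) (word_class (word t) * \<sigma> v))"
      by (rule sum.swap)
    also have "\<dots> = (\<Sum>t\<in>K. \<iota> (a t) * b (lam + d t) (map fundamental_weight (word t)))"
      by (simp add: b sum_distrib_left)
    finally show ?thesis .
  qed
  then show ?thesis using k(1) by blast
qed

end

theorem theorem8p1:
  fixes C :: "'i::finite \<Rightarrow> 'i \<Rightarrow> int"
    and \<iota> :: "'i S \<Rightarrow> 'a::ring_1" and A :: "'i option \<Rightarrow> 'a"
    and \<eta> :: "'i S \<Rightarrow> 'h::comm_ring_1" and \<xi> :: "'i waf \<Rightarrow> 'h" and j :: "'h \<Rightarrow> 'a"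
    and \<kappa> :: "'i Sq \<Rightarrow> 'q::comm_ring_1" and \<sigma> :: "'i weyl \<Rightarrow> 'q"
    and w :: "'i weyl" and \<SS> :: "'i Sq_omega"
    and K :: "'t set" and a :: "'t \<Rightarrow> 'i S" and d :: "'t \<Rightarrow> 'i coweight" and word :: "'t \<Rightarrow> 'i list"
  assumes "grassmannian_homology C \<iota> A \<eta> \<xi> j"
    and "quantum_cohomology C \<kappa> \<sigma>"
    and "w \<in> root_datum.weyl_group C"
    and "finite K"
    and "\<And>t i. t \<in> K \<Longrightarrow> d t $ i \<ge> 0"
    and "\<SS> = (\<Sum>t\<in>K. const_poly (const_poly (a t) * q_monomial (d t)) * prod_list (map var_poly (word t)))"
    and "quantum_cohomology.quantum_schubert_polynomial C \<kappa> \<sigma> w \<SS>"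
  shows "\<exists>k>0. \<forall>lam. root_datum.antidominant C lam \<and> root_datum.sufficiently_superregular_coweight C k lam \<longrightarrow>
    j (\<xi> (w, lam)) =
      (\<Sum>t\<in>K. \<iota> (a t) * nil_hecke_ring.b C \<iota> A (lam + d t) (map fundamental_weight (word t)))"
proof -
  interpret peterson_comparison C \<iota> A \<eta> \<xi> j \<kappa> \<sigma>
    using assms(1,2) by (rule peterson_comparison.intro)
  show ?thesis using schubert_class_from_polynomial[OF assms(3-7)] .
qed

end
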